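(* Let $M_1$ be a matroid with a subset $X$ such that $M_1|X\cong U_{2,n}$ for some $n\ge 2$, identify $X$ with the subset $\{x_1,\dots,x_n\}$ of the ground set of $\Theta_n$ (disjoint otherwise from $E(M_1)$), and let $M=P_X(M_1,\Theta_n)$. Then $F(M)\cong F(M_1)$.
   Context: For $n\ge2$, $\Theta_n$ is the matroid on $X\sqcup Y$, $X=\{x_1,\dots,x_n\}$, $Y=\{y_1,\dots,y_n\}$, whose bases are: $Y$; the sets $(Y-\{y_i\})\cup\{x_j\}$ for distinct $i,j$; and the sets $(Y-Y')\cup X'$ with $Y'\subseteq Y$, $X'\subseteq X$, $|Y'|=|X'|=2$. $X$ is a modular flat of $\Theta_n$ and $\Theta_n|X\cong U_{2,n}$. For matroids $M_1,M_2$ on $E_1,E_2$ with $E_1\cap E_2=X$, $M_1|X=M_2|X$ and $X$ a modular flat of one of them, the generalized parallel connection $P_X(M_1,M_2)$ is the matroid on $E_1\cup E_2$ whose flats are the sets $F$ with $F\cap E_i$ a flat of $M_i$ for $i=1,2$. A pasture is a commutative monoid $P$ with absorbing element $0$, $P^\times=P\setminus\{0\}$, and a nullset $N_P$ of formal sums $a+b+c$ such that: $a+0+0\in N_P$ iff $a=0$; $N_P$ is closed under multiplying all terms by any $d\in P$; there is a unique $\epsilon\in P^\times$ with $1+\epsilon+0\in N_P$. Morphisms are multiplicative maps preserving $0,1$ and null sums. For a matroid $N$ on $E$ with hyperplanes $\mathcal H$, a $P$-representation is a family $f_H:E\to P$ with $f_H(e)=0$ iff $e\in H$ such that for each modular triple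 of hyperplanes $(H_1,H_2,H_3)$ ($H_1\cap H_2\cap H_3$ a corank-2 flat equal to each pairwise intersection) there are $c_i\in P$ not all $0$ with $\sum c_if_{H_i}(e)\in N_P$ for all $e$; rescaling equivalence is $f'_H(e)=c_Hc_ef_H(e)$ with $c_H,c_e\in P^\times$. The foundation $F(N)$ is the pasture such that $\mathrm{Hom}(F(N),P)$ is naturally in bijection with rescaling classes of $P$-representations of $N$. *)

theory Defs
  imports "HOL-Algebra.Group" "HOL-Library.Multiset" "HOL-Library.FuncSet"
begin

section \<open>Matroids\<close>

record 'e matroid =
  ground :: "'e set"
  bases :: "'e set set"

definition matroid :: "'e matroid \<Rightarrow> bool" where
  "matroid M \<longleftrightarrow>
     finite (ground M) \<and> bases M \<subseteq> Pow (ground M) \<and> bases M \<noteq> {} \<and>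
     (\<forall>B\<in>bases M. \<forall>B'\<in>bases M. \<forall>u\<in>B - B'. \<exists>v\<in>B' - B. insert v (B - {u}) \<in> bases M)"

definition indep :: "'e matroid \<Rightarrow> 'e set \<Rightarrow> bool" where
  "indep M I \<longleftrightarrow> (\<exists>B\<in>bases M. I \<subseteq> B)"

definition rank_of :: "'e matroid \<Rightarrow> 'e set \<Rightarrow> nat" where
  "rank_of M A = Max {card I | I. indep M I \<and> I \<subseteq> A}"

definition matroid_rank :: "'e matroid \<Rightarrow> nat" where
  "matroid_rank M = rank_of M (ground M)"

definition flat :: "'e matroid \<Rightarrow> 'e set \<Rightarrow> bool" where
  "flat M F \<longleftrightarrow> F \<subseteq> ground M \<and> (\<forall>e\<in>ground M - F. rank_of M F < rank_of M (insert e F))"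

definition hyperplanes :: "'e matroid \<Rightarrow> 'e set set" where
  "hyperplanes M = {H. flat M H \<and> rank_of M H + 1 = matroid_rank M}"

definition restriction :: "'e matroid \<Rightarrow> 'e set \<Rightarrow> 'e matroid" where
  "restriction M X =
     \<lparr> ground = X,
       bases = {I. indep M I \<and> I \<subseteq> X \<and> (\<forall>J. indep M J \<and> J \<subseteq> X \<and> I \<subseteq> J \<longrightarrow> J = I)} \<rparr>"

definition matroid_iso :: "'e matroid \<Rightarrow> 'f matroid \<Rightarrow> bool" where
  "matroid_iso M N \<longleftrightarrow>
     (\<exists>\<phi>. bij_betw \<phi> (ground M) (ground N) \<and> bases N = (\<lambda>B. \<phi> ` B) ` bases M)"

definition uniform_matroid :: "nat \<Rightarrow> nat \<Rightarrow> nat matroid" where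
  "uniform_matroid r n = \<lparr> ground = {1..n}, bases = {B. B \<subseteq> {1..n} \<and> card B = r} \<rparr>"

text \<open>
  The elements \<open>x\<^sub>1, \<dots>, x\<^sub>n\<close> and \<open>y\<^sub>1, \<dots>, y\<^sub>n\<close> are given as
  families indexed by \<open>{1..n}\<close>, which are meant to be injective with disjoint images.
\<close>

definition Theta :: "nat \<Rightarrow> (nat \<Rightarrow> 'e) \<Rightarrow> (nat \<Rightarrow> 'e) \<Rightarrow> 'e matroid" where
  "Theta n x y =
     (let X = x ` {1..n}; Y = y ` {1..n} in
      \<lparr> ground = X \<union> Y,
        bases = {Y}
          \<union> {insert (x j) (Y - {y i}) | i j. i \<in> {1..n} \<and> j \<in> {1..n} \<and> i \<noteq> j}
          \<union> {(Y - Y') \<union> X' | Y' X'. Y' \<subseteq> Y \<and> X' \<subseteq> X \<and> card Y' = 2 \<and> card X' = 2} \<rparr>)"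

text \<open>
  \<open>is_gen_parallel_connection X M\<^sub>1 M\<^sub>2 M\<close> says that \<open>M = P\<^sub>X(M\<^sub>1, M\<^sub>2)\<close>.
  A matroid is determined by its ground set and its flats, so there is at most one such \<open>M\<close>.
  Modularity of \<open>X\<close> in \<open>M\<^sub>1\<close> or \<open>M\<^sub>2\<close> is a sufficient condition for existence
  and is deliberately not built in: for \<open>n \<ge> 3\<close> the set \<open>X\<close> is always a modular flat
  of \<open>Theta n x y\<close>, whereas \<open>Theta 2 x y\<close> has rank \<open>2\<close> and each of \<open>y\<^sub>1, y\<^sub>2\<close>
  is parallel to an element of \<open>X\<close>. In that case \<open>X\<close> is not literally a flat, but
  the matroid with the prescribed flats still exists.
\<close>

definition is_gen_parallel_connection ::
    "'e set \<Rightarrow> 'e matroid \<Rightarrow> 'e matroid \<Rightarrow> 'e matroid \<Rightarrow> bool" where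
  "is_gen_parallel_connection X M\<^sub>1 M\<^sub>2 M \<longleftrightarrow>
     ground M\<^sub>1 \<inter> ground M\<^sub>2 = X \<and> restriction M\<^sub>1 X = restriction M\<^sub>2 X \<and>
     matroid M \<and> ground M = ground M\<^sub>1 \<union> ground M\<^sub>2 \<and>
     (\<forall>F \<subseteq> ground M\<^sub>1 \<union> ground M\<^sub>2.
        flat M F \<longleftrightarrow> flat M\<^sub>1 (F \<inter> ground M\<^sub>1) \<and> flat M\<^sub>2 (F \<inter> ground M\<^sub>2))"


section \<open>Pastures\<close>

text \<open>A formal sum \<open>a + b + c\<close> is the multiset \<open>{#a, b, c#}\<close>, zero terms included.\<close>

record 'p pasture = "'p monoid" +
  pzero :: 'p
  nullset :: "'p multiset set"

definition pasture :: "'p pasture \<Rightarrow> bool" where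
  "pasture P \<longleftrightarrow>
     comm_monoid P \<and>
     pzero P \<in> carrier P \<and> (\<forall>a\<in>carrier P. pzero P \<otimes>\<^bsub>P\<^esub> a = pzero P) \<and>
     Units P = carrier P - {pzero P} \<and>
     nullset P \<subseteq> {s. size s = 3 \<and> set_mset s \<subseteq> carrier P} \<and>
     (\<forall>a\<in>carrier P. {#a, pzero P, pzero P#} \<in> nullset P \<longleftrightarrow> a = pzero P) \<and>
     (\<forall>d\<in>carrier P. \<forall>s\<in>nullset P. image_mset (\<lambda>a. d \<otimes>\<^bsub>P\<^esub> a) s \<in> nullset P) \<and>
     (\<exists>!\<epsilon>. \<epsilon> \<in> Units P \<and> {#\<one>\<^bsub>P\<^esub>, \<epsilon>, pzero P#} \<in> nullset P)"

text \<open>Morphisms are extensional, so that distinct functions are distinct morphisms.\<close>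

definition pasture_hom :: "'p pasture \<Rightarrow> 'q pasture \<Rightarrow> ('p \<Rightarrow> 'q) set" where
  "pasture_hom P Q =
     {\<phi> \<in> hom P Q. \<phi> \<in> extensional (carrier P) \<and>
        \<phi> \<one>\<^bsub>P\<^esub> = \<one>\<^bsub>Q\<^esub> \<and> \<phi> (pzero P) = pzero Q \<and>
        (\<forall>s\<in>nullset P. image_mset \<phi> s \<in> nullset Q)}"

definition pasture_iso :: "'p pasture \<Rightarrow> 'q pasture \<Rightarrow> bool" where
  "pasture_iso P Q \<longleftrightarrow>
     (\<exists>\<phi>\<in>pasture_hom P Q. \<exists>\<psi>\<in>pasture_hom Q P.
        (\<forall>a\<in>carrier P. \<psi> (\<phi> a) = a) \<and> (\<forall>b\<in>carrier Q. \<phi> (\<psi> b) = b))"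


section \<open>Representations and the foundation\<close>

definition modular_triple :: "'e matroid \<Rightarrow> 'e set \<Rightarrow> 'e set \<Rightarrow> 'e set \<Rightarrow> bool" where
  "modular_triple N H\<^sub>1 H\<^sub>2 H\<^sub>3 \<longleftrightarrow>
     H\<^sub>1 \<in> hyperplanes N \<and> H\<^sub>2 \<in> hyperplanes N \<and> H\<^sub>3 \<in> hyperplanes N \<and>
     (let L = H\<^sub>1 \<inter> H\<^sub>2 \<inter> H\<^sub>3 in
        flat N L \<and> rank_of N L + 2 = matroid_rank N \<and>
        H\<^sub>1 \<inter> H\<^sub>2 = L \<and> H\<^sub>1 \<inter> H\<^sub>3 = L \<and> H\<^sub>2 \<inter> H\<^sub>3 = L)"

definition representations :: "'e matroid \<Rightarrow> 'p pasture \<Rightarrow> ('e set \<Rightarrow> 'e \<Rightarrow> 'p) set" where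
  "representations N P =
     {f \<in> hyperplanes N \<rightarrow>\<^sub>E (ground N \<rightarrow>\<^sub>E carrier P).
        (\<forall>H\<in>hyperplanes N. \<forall>e\<in>ground N. f H e = pzero P \<longleftrightarrow> e \<in> H) \<and>
        (\<forall>H\<^sub>1 H\<^sub>2 H\<^sub>3. modular_triple N H\<^sub>1 H\<^sub>2 H\<^sub>3 \<longrightarrow>
          (\<exists>c\<^sub>1\<in>carrier P. \<exists>c\<^sub>2\<in>carrier P. \<exists>c\<^sub>3\<in>carrier P.
             \<not> (c\<^sub>1 = pzero P \<and> c\<^sub>2 = pzero P \<and> c\<^sub>3 = pzero P) \<and>
             (\<forall>e\<in>ground N.
                {#c\<^sub>1 \<otimes>\<^bsub>P\<^esub> f H\<^sub>1 e, c\<^sub>2 \<otimes>\<^bsub>P\<^esub> f H\<^sub>2 e, c\<^sub>3 \<otimes>\<^bsub>P\<^esub> f H\<^sub>3 e#} \<in> nullset P)))}"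

definition rescaling :: "'e matroid \<Rightarrow> 'p pasture \<Rightarrow> ('e set \<Rightarrow> 'e \<Rightarrow> 'p) rel" where
  "rescaling N P =
     {(f, f'). f \<in> representations N P \<and> f' \<in> representations N P \<and>
        (\<exists>c\<in>hyperplanes N \<rightarrow> Units P. \<exists>d\<in>ground N \<rightarrow> Units P.
           \<forall>H\<in>hyperplanes N. \<forall>e\<in>ground N. f' H e = c H \<otimes>\<^bsub>P\<^esub> d e \<otimes>\<^bsub>P\<^esub> f H e)}"

definition rescaling_classes :: "'e matroid \<Rightarrow> 'p pasture \<Rightarrow> ('e set \<Rightarrow> 'e \<Rightarrow> 'p) set set" where
  "rescaling_classes N P = representations N P // rescaling N P"

definition push_forward ::
    "'e matroid \<Rightarrow> ('p \<Rightarrow> 'q) \<Rightarrow> ('e set \<Rightarrow> 'e \<Rightarrow> 'p) \<Rightarrow> ('e set \<Rightarrow> 'e \<Rightarrow> 'q)" where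
  "push_forward N \<phi> f = (\<lambda>H\<in>hyperplanes N. \<lambda>e\<in>ground N. \<phi> (f H e))"

text \<open>
  \<open>F\<close> represents the functor sending \<open>P\<close> to the set of rescaling classes of
  \<open>P\<close>-representations of \<open>N\<close>. Quantification over types not being available, \<open>P\<close>
  ranges over all pastures with carrier in the (arbitrary) type of \<open>F\<close>.
  A foundation of a matroid is a finitely generated, hence countable, pasture, so this determines
  it up to isomorphism as soon as that type is infinite, and the choice of such a type is irrelevant.
  The last line is naturality of \<open>\<eta>\<close>, expressed on members of classes.
\<close>

definition is_foundation :: "'p pasture \<Rightarrow> 'e matroid \<Rightarrow> bool" where
  "is_foundation F N \<longleftrightarrow>
     pasture F \<and>
     (\<exists>\<eta> :: 'p pasture \<Rightarrow> ('p \<Rightarrow> 'p) \<Rightarrow> ('e set \<Rightarrow> 'e \<Rightarrow> 'p) set.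
        (\<forall>P. pasture P \<longrightarrow> bij_betw (\<eta> P) (pasture_hom F P) (rescaling_classes N P)) \<and>
        (\<forall>P Q. \<forall>\<phi>\<in>pasture_hom P Q. \<forall>g\<in>pasture_hom F P. pasture P \<and> pasture Q \<longrightarrow>
           (\<forall>f\<in>\<eta> P g. push_forward N \<phi> f \<in> \<eta> Q (compose (carrier F) \<phi> g))))"

end

theory Submission
  imports Defs
begin

text \<open>By Yoneda it suffices to find, for every pasture \<open>P\<close>, a natural bijection between the rescaling
  classes of \<open>P\<close>-representations of \<open>M\<close> and of \<open>M\<^sub>1\<close>. It is the restriction to the minor
  \<open>M / (Y - {y\<^sub>1, y\<^sub>2})\<close>, which is \<open>M\<^sub>1\<close> up to two parallel elements. It is injective because
  elements that are parallel in a contraction by \<open>K\<close> have a constant ratio on all hyperplanes above \<open>K\<close>,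
  and such ratios determine a representation of \<open>M\<close> up to rescaling. It is surjective because a
  representation of \<open>M\<^sub>1\<close> induces brackets on the line \<open>X\<close>, in terms of which the hyperplane
  functions of \<open>M\<close> are given by explicit formulas; all their linear relations reduce to three-term
  Pluecker relations.\<close>

section \<open>Rank and flats of a matroid\<close>

text \<open>Injectivity therefore works with products only: quotients of corresponding values are
  compared two columns at a time and units are cancelled. Surjectivity needs a complete list of the
  modular triples of \<open>M\<close> and a verified three-term relation for each kind. Both rest on
  one encoding: a flat of \<open>M\<close> is its trace on \<open>E\<^sub>1\<close> together with
  the set of absent y_i, subject to a condition on the points of \<open>X\<close> in it. The
  formulas come from the linear picture: if \<open>b i k\<close> is the determinant of x_i and x_k
  in a plane, then putting x_k = sum of \<open>b i k\<close> y_i over all i represents Theta. The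
  zero diagonal makes x_k dependent on the y_i with i \<noteq> k, and the 2-by-2 minor with rows i,
  j and columns k, l is \<open>b i j\<close> times \<open>b k l\<close> by the Pluecker relation,
  hence nonzero.\<close>

lemma matroid_finite: "matroid M \<Longrightarrow> finite (ground M)"
  by (simp add: matroid_def)

lemma matroid_exchange:
  assumes "matroid M" "B \<in> bases M" "B' \<in> bases M" "u \<in> B" "u \<notin> B'"
  obtains v where "v \<in> B'" "v \<notin> B" "insert v (B - {u}) \<in> bases M"
proof -
  have "\<forall>B\<in>bases M. \<forall>B'\<in>bases M. \<forall>u\<in>B - B'. \<exists>v\<in>B' - B. insert v (B - {u}) \<in> bases M"
    using assms(1) by (simp add: matroid_def)
  then have "\<exists>v\<in>B' - B. insert v (B - {u}) \<in> bases M" using assms(2-5) by blast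
  then show thesis using that by blast
qed

lemma basis_subset: "matroid M \<Longrightarrow> B \<in> bases M \<Longrightarrow> B \<subseteq> ground M"
  by (auto simp: matroid_def)

lemma basis_finite: "matroid M \<Longrightarrow> B \<in> bases M \<Longrightarrow> finite B"
  by (meson basis_subset finite_subset matroid_finite)

text \<open>Induction on the size of \<open>B - B'\<close>: an exchange replaces an element of
  \<open>B - B'\<close> by one of \<open>B' - B\<close> and keeps the cardinality of the first
  basis.\<close>

lemma bases_card_le:
  assumes M: "matroid M" and "B \<in> bases M" "B' \<in> bases M"
  shows "card B \<le> card B'"
  using assms(2,3)
proof (induction "card (B - B')" arbitrary: B)
  case 0
  then have "B \<subseteq> B'" using basis_finite[OF M] by auto
  then show ?case using basis_finite[OF M 0(3)] by (simp add: card_mono)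
next
  case (Suc k)
  have fin: "finite B" using basis_finite[OF M Suc(3)] .
  obtain u where u: "u \<in> B" "u \<notin> B'" using Suc(2)
    by (metis DiffE card.empty ex_in_conv nat.distinct(1))
  obtain v where v: "v \<in> B'" "v \<notin> B" "insert v (B - {u}) \<in> bases M"
    using matroid_exchange[OF M Suc(3,4) u] .
  have "insert v (B - {u}) - B' = (B - B') - {u}" using v by auto
  then have "card (insert v (B - {u}) - B') = k"
    using Suc(2) u fin by (simp add: card_Diff_singleton)
  then have "card (insert v (B - {u})) \<le> card B'" using Suc v(3) by simp
  moreover have "card (insert v (B - {u})) = card B" using fin u v
    by (metis card.remove card_insert_disjoint finite_Diff DiffE)
  ultimately show ?case by simp
qed

lemma bases_card_eq:
  assumes "matroid M" "B \<in> bases M" "B' \<in> bases M"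
  shows "card B = card B'"
  using bases_card_le assms by (metis le_antisym)

lemma indep_subset: "indep M I \<Longrightarrow> J \<subseteq> I \<Longrightarrow> indep M J"
  by (auto simp: indep_def)

lemma indep_ground: "matroid M \<Longrightarrow> indep M I \<Longrightarrow> I \<subseteq> ground M"
  using basis_subset by (fastforce simp: indep_def)

lemma indep_finite: "matroid M \<Longrightarrow> indep M I \<Longrightarrow> finite I"
  by (meson finite_subset indep_ground matroid_finite)

lemma indep_empty: "matroid M \<Longrightarrow> indep M {}"
  by (auto simp: indep_def matroid_def)

text \<open>If no element of \<open>J\<close> extends \<open>I\<close>, take a basis
  \<open>B1\<close> above \<open>I\<close> and a basis \<open>B2\<close> above \<open>J\<close> with
  as little as possible outside \<open>J \<union> B1\<close>. Exchanges in both directions then give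
  \<open>B2 - B1 = J - I\<close> and \<open>B1 - B2 \<subseteq> I - J\<close>, and equicardinality
  of bases contradicts \<open>card I < card J\<close>.\<close>

lemma indep_augment:
  assumes M: "matroid M" and I: "indep M I" and J: "indep M J" and less: "card I < card J"
  obtains e where "e \<in> J" "e \<notin> I" "indep M (insert e I)"
proof -
  have "\<exists>e\<in>J - I. indep M (insert e I)"
  proof (rule ccontr)
    assume no: "\<not> ?thesis"
    obtain B1 where B1: "B1 \<in> bases M" "I \<subseteq> B1" using I by (auto simp: indep_def)
    obtain B0 where B0: "B0 \<in> bases M \<and> J \<subseteq> B0" using J by (auto simp: indep_def)
    define B2 where "B2 = arg_min (\<lambda>B. card (B - (J \<union> B1))) (\<lambda>B. B \<in> bases M \<and> J \<subseteq> B)"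
    have B2: "B2 \<in> bases M" "J \<subseteq> B2"
      using arg_min_natI[of "\<lambda>B. B \<in> bases M \<and> J \<subseteq> B", OF B0] unfolding B2_def by auto
    have min: "card (B2 - (J \<union> B1)) \<le> card (B - (J \<union> B1))" if "B \<in> bases M" "J \<subseteq> B" for B
      unfolding B2_def by (rule arg_min_nat_le) (use that in auto)
    have JI: "J \<inter> B1 \<subseteq> I"
    proof
      fix e assume e: "e \<in> J \<inter> B1"
      then have "indep M (insert e I)" unfolding indep_def using B1 by blast
      then show "e \<in> I" using no e by blast
    qed
    have "B2 - (J \<union> B1) = {}"
    proof (rule ccontr)
      assume "B2 - (J \<union> B1) \<noteq> {}"
      then obtain u where u: "u \<in> B2" "u \<notin> J" "u \<notin> B1" by auto
      obtain v where v: "v \<in> B1" "v \<notin> B2" "insert v (B2 - {u}) \<in> bases M"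
        using matroid_exchange[OF M B2(1) B1(1) u(1,3)] .
      have "card (B2 - (J \<union> B1)) \<le> card (insert v (B2 - {u}) - (J \<union> B1))"
        using min v(3) B2(2) u(2) by blast
      also have "insert v (B2 - {u}) - (J \<union> B1) = (B2 - (J \<union> B1)) - {u}" using v(1) by auto
      also have "card \<dots> < card (B2 - (J \<union> B1))"
        using u basis_finite[OF M B2(1)] by (intro card_Diff1_less) auto
      finally show False by simp
    qed
    then have D2: "B2 - B1 = J - I" using B2 JI B1 by auto
    have "B1 - (I \<union> B2) = {}"
    proof (rule ccontr)
      assume "B1 - (I \<union> B2) \<noteq> {}"
      then obtain u where u: "u \<in> B1" "u \<notin> B2" "u \<notin> I" by auto
      obtain v where v: "v \<in> B2" "v \<notin> B1" "insert v (B1 - {u}) \<in> bases M"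
        using matroid_exchange[OF M B1(1) B2(1) u(1,2)] .
      have "v \<in> J - I" using v D2 by blast
      moreover have "insert v I \<subseteq> insert v (B1 - {u})" using B1(2) u(3) by auto
      then have "indep M (insert v I)" unfolding indep_def using v(3) by auto
      ultimately show False using no by blast
    qed
    then have D1: "B1 - B2 \<subseteq> I - J" using B2 by auto
    have fin: "finite B1" "finite B2" "finite I" "finite J"
      using basis_finite[OF M] indep_finite[OF M] B1 B2 I J by auto
    have "card (B1 - B2) = card (B2 - B1)"
      using bases_card_eq[OF M B1(1) B2(1)] fin
      by (simp add: card_Diff_subset_Int Int_commute)
    then have "card (J - I) \<le> card (I - J)" using D1 D2 fin by (metis card_mono finite_Diff)
    moreover have "card (J - I) + card (J \<inter> I) = card J" "card (I - J) + card (J \<inter> I) = card I"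
      using fin card_Diff_subset_Int[of J I] card_Diff_subset_Int[of I J]
        card_mono[of J "J \<inter> I"] card_mono[of I "J \<inter> I"] by (auto simp: Int_commute)
    ultimately show False using less by simp
  qed
  then show ?thesis using that by auto
qed

section \<open>The rank function\<close>

lemma rank_of_eqI:
  assumes "finite A" "indep M I" "I \<subseteq> A" "\<And>J. indep M J \<Longrightarrow> J \<subseteq> A \<Longrightarrow> card J \<le> card I"
  shows "rank_of M A = card I"
proof -
  have "{card I | I. indep M I \<and> I \<subseteq> A} \<subseteq> card ` Pow A" by auto
  then have "finite {card I | I. indep M I \<and> I \<subseteq> A}"
    using assms(1) finite_subset by blast
  then show ?thesis unfolding rank_of_def
    by (intro Max_eqI) (use assms in auto)
qed

lemma rank_of_obtain:
  assumes M: "matroid M" and A: "A \<subseteq> ground M"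
  obtains I where "indep M I" "I \<subseteq> A" "card I = rank_of M A"
    "\<And>J. indep M J \<Longrightarrow> J \<subseteq> A \<Longrightarrow> card J \<le> card I"
proof -
  have fin: "finite A" using A M finite_subset matroid_finite by blast
  define I where "I = (ARG_MAX card I. indep M I \<and> I \<subseteq> A)"
  have P: "indep M {} \<and> {} \<subseteq> A" using indep_empty[OF M] by simp
  have b: "\<forall>y. indep M y \<and> y \<subseteq> A \<longrightarrow> card y < Suc (card A)"
    using fin by (simp add: card_mono le_imp_less_Suc)
  have 1: "indep M I \<and> I \<subseteq> A" unfolding I_def by (rule arg_max_natI[OF P b])
  have 2: "card J \<le> card I" if "indep M J" "J \<subseteq> A" for J
    unfolding I_def using arg_max_nat_le[of "\<lambda>I. indep M I \<and> I \<subseteq> A" J card] that b by blast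
  show ?thesis using that[of I] 1 2 rank_of_eqI[OF fin, of M I] by auto
qed

lemma rank_of_ge:
  assumes "matroid M" "A \<subseteq> ground M" "indep M I" "I \<subseteq> A"
  shows "card I \<le> rank_of M A"
  by (metis rank_of_obtain[OF assms(1,2)] assms(3,4))

lemma rank_of_mono:
  assumes "matroid M" "B \<subseteq> ground M" "A \<subseteq> B"
  shows "rank_of M A \<le> rank_of M B"
proof -
  have "A \<subseteq> ground M" using assms by auto
  then obtain I where "indep M I" "I \<subseteq> A" "card I = rank_of M A"
    by (metis rank_of_obtain[OF assms(1)])
  then show ?thesis using rank_of_ge[OF assms(1,2), of I] assms by auto
qed

lemma rank_of_insert_le:
  assumes M: "matroid M" and A: "A \<subseteq> ground M" and e: "e \<in> ground M"
  shows "rank_of M (insert e A) \<le> Suc (rank_of M A)"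
proof -
  have "insert e A \<subseteq> ground M" using A e by auto
  then obtain I where I: "indep M I" "I \<subseteq> insert e A" "card I = rank_of M (insert e A)"
    by (metis rank_of_obtain[OF M])
  have 1: "card (I - {e}) \<le> rank_of M A"
    using rank_of_ge[OF M A, of "I - {e}"] I indep_subset[of M I "I - {e}"] by blast
  have "card I \<le> Suc (card (I - {e}))"
    using card_Suc_Diff1[OF indep_finite[OF M I(1)], of e] by (cases "e \<in> I") auto
  with 1 I(3) show ?thesis by simp
qed

lemma indep_extend:
  assumes M: "matroid M" and B: "B \<subseteq> ground M" and I: "indep M I" "I \<subseteq> B"
  obtains J where "indep M J" "I \<subseteq> J" "J \<subseteq> B" "card J = rank_of M B"
proof -
  have "\<exists>J. indep M J \<and> I \<subseteq> J \<and> J \<subseteq> B \<and> card J = rank_of M B"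
    using I
  proof (induction "rank_of M B - card I" arbitrary: I)
    case 0
    then have "card I = rank_of M B" using rank_of_ge[OF M B, of I] by simp
    then show ?case using 0 by auto
  next
    case (Suc k)
    obtain J where J: "indep M J" "J \<subseteq> B" "card J = rank_of M B"
      using rank_of_obtain[OF M B] by metis
    obtain e where e: "e \<in> J" "e \<notin> I" "indep M (insert e I)"
      using indep_augment[OF M Suc(3) J(1)] Suc(2) J(3) by (metis nat.distinct(1) zero_less_Suc zero_less_diff)
    have "card (insert e I) = Suc (card I)" using e indep_finite[OF M Suc(3)] by simp
    then have "k = rank_of M B - card (insert e I)" using Suc(2) by simp
    from Suc(1)[OF this e(3)] show ?case using e J Suc(4) by auto
  qed
  then show ?thesis using that by auto
qed

text \<open>The instance of submodularity on which closure rests. A maximal independent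
  \<open>I\<close> in \<open>A\<close> is extended to a maximal independent \<open>J\<close> in
  \<open>B\<close>; if \<open>e\<close> raised the rank of \<open>B\<close>, augmentation would have
  to add \<open>e\<close> itself to \<open>J\<close>, and hence to \<open>I\<close>.\<close>

lemma rank_of_insert_eq_mono:
  assumes M: "matroid M" and B: "B \<subseteq> ground M" and AB: "A \<subseteq> B" and e: "e \<in> ground M"
    and eq: "rank_of M (insert e A) = rank_of M A"
  shows "rank_of M (insert e B) = rank_of M B"
proof (rule ccontr)
  assume neq: "\<not> ?thesis"
  have A: "A \<subseteq> ground M" using AB B by auto
  obtain I where I: "indep M I" "I \<subseteq> A" "card I = rank_of M A"
    using rank_of_obtain[OF M A] by metis
  have "I \<subseteq> B" using I(2) AB by auto
  then obtain J where J: "indep M J" "I \<subseteq> J" "J \<subseteq> B" "card J = rank_of M B"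
    using indep_extend[OF M B I(1)] by metis
  have "insert e B \<subseteq> ground M" using B e by auto
  then obtain K where K: "indep M K" "K \<subseteq> insert e B" "card K = rank_of M (insert e B)"
    by (metis rank_of_obtain[OF M])
  have "card J < card K"
    using neq J(4) K(3) rank_of_mono[OF M, of "insert e B" B] B e by fastforce
  then obtain v where v: "v \<in> K" "v \<notin> J" "indep M (insert v J)"
    using indep_augment[OF M J(1) K(1)] by metis
  have "v = e"
  proof (rule ccontr)
    assume "v \<noteq> e"
    then have "insert v J \<subseteq> B" using v K J by auto
    from rank_of_ge[OF M B v(3) this] show False using v J indep_finite[OF M J(1)] by simp
  qed
  then have "indep M (insert e I)" "e \<notin> I" using v J(2) indep_subset by blast+
  then show False using rank_of_ge[OF M, of "insert e A" "insert e I"] A e I eq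
      indep_finite[OF M I(1)] by auto
qed

section \<open>The closure operator\<close>

definition mcl :: "'e matroid \<Rightarrow> 'e set \<Rightarrow> 'e set" where
  "mcl M A = {e \<in> ground M. rank_of M (insert e A) = rank_of M A}"

lemma flat_subset: "flat M F \<Longrightarrow> F \<subseteq> ground M"
  by (simp add: flat_def)

lemma flat_ground: "flat M (ground M)"
  by (simp add: flat_def)

lemma mcl_subset_ground: "mcl M A \<subseteq> ground M"
  by (auto simp: mcl_def)

lemma mcl_extensive: "A \<subseteq> ground M \<Longrightarrow> A \<subseteq> mcl M A"
  by (auto simp: mcl_def insert_absorb)

lemma rank_of_mcl:
  assumes M: "matroid M" and A: "A \<subseteq> ground M"
  shows "rank_of M (mcl M A) = rank_of M A"
proof -
  have "finite (mcl M A)" using M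
    by (meson mcl_subset_ground finite_subset matroid_finite)
  have "rank_of M (A \<union> B) = rank_of M A" if "finite B" "B \<subseteq> mcl M A" for B
    using that
  proof (induction B rule: finite_induct)
    case (insert b B)
    have "rank_of M (insert b (A \<union> B)) = rank_of M (A \<union> B)"
      by (rule rank_of_insert_eq_mono[OF M, of _ A])
        (use insert A mcl_subset_ground[of M A] in \<open>auto simp: mcl_def\<close>)
    then show ?case using insert by simp
  qed simp
  from this[of "mcl M A"] show ?thesis
    using mcl_extensive[OF A] \<open>finite (mcl M A)\<close> by (simp add: Un_absorb1)
qed

lemma flat_mcl:
  assumes M: "matroid M" and A: "A \<subseteq> ground M"
  shows "flat M (mcl M A)"
  unfolding flat_def
proof (intro conjI ballI)
  fix e assume e: "e \<in> ground M - mcl M A"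
  have "rank_of M (mcl M A) = rank_of M A" by (rule rank_of_mcl[OF M A])
  also have "\<dots> < rank_of M (insert e A)"
    using e rank_of_mono[OF M, of "insert e A" A] A by (fastforce simp: mcl_def)
  also have "\<dots> \<le> rank_of M (insert e (mcl M A))"
    using rank_of_mono[OF M, of "insert e (mcl M A)" "insert e A"] e
      mcl_extensive[OF A] mcl_subset_ground[of M A] by blast
  finally show "rank_of M (mcl M A) < rank_of M (insert e (mcl M A))" .
qed (rule mcl_subset_ground)

lemma mcl_least:
  assumes M: "matroid M" and F: "flat M F" and A: "A \<subseteq> F"
  shows "mcl M A \<subseteq> F"
proof
  fix e assume e: "e \<in> mcl M A"
  have "rank_of M (insert e F) = rank_of M F"
    using rank_of_insert_eq_mono[OF M flat_subset[OF F] A] e by (auto simp: mcl_def)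
  then show "e \<in> F" using F e unfolding flat_def mcl_def
    by (metis (mono_tags, lifting) DiffI less_irrefl mem_Collect_eq)
qed

lemma flat_Int:
  assumes M: "matroid M" and F: "flat M F" and G: "flat M G"
  shows "flat M (F \<inter> G)"
proof -
  have sub: "F \<inter> G \<subseteq> ground M" using flat_subset[OF F] by auto
  have "mcl M (F \<inter> G) = F \<inter> G"
    using mcl_least[OF M F, of "F \<inter> G"] mcl_least[OF M G, of "F \<inter> G"]
      mcl_extensive[OF sub] by auto
  then show ?thesis using flat_mcl[OF M sub] by simp
qed

lemma mcl_insertI:
  assumes "A \<subseteq> ground M" "e \<in> ground M"
  shows "e \<in> mcl M (insert e A)" "A \<subseteq> mcl M (insert e A)"
  using mcl_extensive[of "insert e A" M] assms by auto

lemma rank_of_insert_flat: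
  assumes M: "matroid M" and F: "flat M F" and e: "e \<in> ground M" "e \<notin> F"
  shows "rank_of M (insert e F) = Suc (rank_of M F)"
  using rank_of_insert_le[OF M flat_subset[OF F] e(1)] F e unfolding flat_def
  by (meson DiffI Suc_leI le_antisym)

text \<open>For \<open>a\<close> and \<open>b\<close> outside a flat, each raises the rank by
  exactly one; if both together raise it by only one, either of them spans the other over the
  flat.\<close>

lemma mcl_exchange:
  assumes M: "matroid M" and F: "flat M F" and a: "a \<in> ground M"
    and b: "b \<in> mcl M (insert a F)" "b \<notin> F"
  shows "a \<in> mcl M (insert b F)"
proof (cases "a \<in> F")
  case True
  then show ?thesis
    using b insert_absorb[OF True] mcl_least[OF M F] by (metis order_refl subsetD)
next
  case False
  have bg: "b \<in> ground M" using b by (auto simp: mcl_def)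
  have "rank_of M (insert a (insert b F)) = rank_of M (insert b (insert a F))"
    by (simp add: insert_commute)
  also have "\<dots> = rank_of M (insert a F)" using b by (auto simp: mcl_def)
  also have "\<dots> = rank_of M (insert b F)"
    using rank_of_insert_flat[OF M F] False a bg b by simp
  finally show ?thesis using a by (simp add: mcl_def)
qed

lemma rank_of_flat_strict_mono:
  assumes M: "matroid M" and F: "flat M F" and G: "flat M G" and FG: "F \<subset> G"
  shows "rank_of M F < rank_of M G"
proof -
  obtain e where e: "e \<in> G" "e \<notin> F" using FG by auto
  have "rank_of M F < rank_of M (insert e F)"
    using F e flat_subset[OF G] by (auto simp: flat_def)
  also have "\<dots> \<le> rank_of M G" using rank_of_mono[OF M flat_subset[OF G]] e FG by auto
  finally show ?thesis .
qed

lemma rank_of_flat_eq: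
  assumes "matroid M" "flat M F" "flat M G" "F \<subseteq> G" "rank_of M G \<le> rank_of M F"
  shows "F = G"
  using rank_of_flat_strict_mono[OF assms(1-3)] assms(4,5) by force

section \<open>Hyperplanes as maximal proper flats\<close>

lemma hyperplane_flat: "H \<in> hyperplanes M \<Longrightarrow> flat M H"
  by (simp add: hyperplanes_def)

lemma hyperplane_subset: "H \<in> hyperplanes M \<Longrightarrow> H \<subseteq> ground M"
  by (simp add: hyperplanes_def flat_def)

lemma hyperplane_proper: "H \<in> hyperplanes M \<Longrightarrow> H \<noteq> ground M"
  by (auto simp: hyperplanes_def matroid_rank_def)

lemma hyperplane_maximal:
  assumes "matroid M" "H \<in> hyperplanes M" "flat M F" "H \<subseteq> F"
  shows "F = H \<or> F = ground M"
proof (rule ccontr)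
  assume "\<not> ?thesis"
  then have "rank_of M H < rank_of M F" "rank_of M F < rank_of M (ground M)"
    using rank_of_flat_strict_mono assms flat_ground[of M] flat_subset[OF assms(3)]
      hyperplane_flat[OF assms(2)] by (metis psubsetI)+
  then show False using assms(2) by (simp add: hyperplanes_def matroid_rank_def)
qed

text \<open>The glued matroid is known only through its flats, and its rank is never evaluated;
  hyperplanes are therefore recognised inside the lattice of flats.\<close>

lemma hyperplaneI:
  assumes M: "matroid M" and H: "flat M H" "H \<noteq> ground M"
    and max: "\<And>F. flat M F \<Longrightarrow> H \<subset> F \<Longrightarrow> F = ground M"
  shows "H \<in> hyperplanes M"
proof -
  obtain e where e: "e \<in> ground M" "e \<notin> H" using H flat_subset[OF H(1)] by auto
  let ?C = "mcl M (insert e H)"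
  have sub: "insert e H \<subseteq> ground M" using e flat_subset[OF H(1)] by auto
  have "?C = ground M"
    using max[OF flat_mcl[OF M sub]] mcl_extensive[OF sub] e by auto
  then have "matroid_rank M = rank_of M (insert e H)"
    using rank_of_mcl[OF M sub] by (simp add: matroid_rank_def)
  then show ?thesis using rank_of_insert_flat[OF M H(1) e] H by (simp add: hyperplanes_def)
qed

text \<open>A flat avoiding \<open>e\<close> that is not yet a hyperplane lies below a proper flat
  \<open>G\<close>. If \<open>G\<close> contains \<open>e\<close>, an element \<open>b\<close>
  outside \<open>G\<close> is added to \<open>F\<close> instead: by exchange the closure cannot
  contain \<open>e\<close>, or else \<open>b\<close> would lie in \<open>G\<close>.\<close>

lemma hyperplane_avoiding:
  assumes M: "matroid M" and F: "flat M F" and e: "e \<in> ground M" "e \<notin> F"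
  obtains H where "H \<in> hyperplanes M" "F \<subseteq> H" "e \<notin> H"
proof -
  have "\<exists>H. H \<in> hyperplanes M \<and> F \<subseteq> H \<and> e \<notin> H"
    using F e(2)
  proof (induction "card (ground M - F)" arbitrary: F rule: less_induct)
    case less
    show ?case
    proof (cases "F \<in> hyperplanes M")
      case False
      then obtain G where G: "flat M G" "F \<subset> G" "G \<noteq> ground M"
        using hyperplaneI[OF M less(2)] less(3) e by blast
      have card: "card (ground M - F') < card (ground M - F)" if "flat M F'" "F \<subset> F'" for F'
        using that flat_subset[OF that(1)] matroid_finite[OF M] by (intro psubset_card_mono) auto
      show ?thesis
      proof (cases "e \<in> G")
        case False
        then show ?thesis using less(1)[OF card[OF G(1,2)] G(1)] G by blast
      next
        case True
        obtain b where b: "b \<in> ground M" "b \<notin> G" using G flat_subset by blast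
        have Fg: "F \<subseteq> ground M" using less(2) flat_subset by blast
        let ?F = "mcl M (insert b F)"
        have fl: "flat M ?F" using flat_mcl M b Fg by (metis insert_subset)
        have sub: "F \<subset> ?F" using mcl_insertI[OF Fg b(1)] b G by blast
        have "e \<notin> ?F"
        proof
          assume "e \<in> ?F"
          then have "b \<in> mcl M (insert e F)"
            using mcl_exchange[OF M less(2) b(1)] less(3) by blast
          then show False using mcl_least[OF M G(1), of "insert e F"] True G b by blast
        qed
        then show ?thesis using less(1)[OF card[OF fl sub] fl] sub by blast
      qed
    qed (use less in auto)
  qed
  then show ?thesis using that by blast
qed

section \<open>Colines and modular triples\<close>

definition coline :: "'e matroid \<Rightarrow> 'e set \<Rightarrow> bool" where
  "coline M L \<longleftrightarrow> flat M L \<and> rank_of M L + 2 = matroid_rank M"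

lemma hyperplane_Int_neq:
  assumes "matroid M" "H \<in> hyperplanes M" "H' \<in> hyperplanes M" "H \<noteq> H'"
  shows "H \<inter> H' \<subset> H"
  using hyperplane_maximal[OF assms(1,2) hyperplane_flat[OF assms(3)]] assms
    hyperplane_proper by blast

lemma coline_Int:
  assumes M: "matroid M" and L: "coline M L" and H: "H \<in> hyperplanes M" "H' \<in> hyperplanes M" "H \<noteq> H'"
    and sub: "L \<subseteq> H" "L \<subseteq> H'"
  shows "H \<inter> H' = L"
proof -
  have fl: "flat M (H \<inter> H')" using flat_Int[OF M] H hyperplane_flat by blast
  have "rank_of M (H \<inter> H') < rank_of M H"
    using rank_of_flat_strict_mono[OF M fl hyperplane_flat[OF H(1)] hyperplane_Int_neq[OF M H]] .
  then have "rank_of M (H \<inter> H') \<le> rank_of M L"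
    using L H(1) by (simp add: coline_def hyperplanes_def)
  then show ?thesis using rank_of_flat_eq[OF M _ fl, of L] L sub by (auto simp: coline_def)
qed

text \<open>Distinct hyperplanes through a common coline meet exactly in it, so only the coline and
  the three inclusions have to be produced.\<close>

lemma modular_tripleI:
  assumes M: "matroid M" and L: "coline M L"
    and H: "H\<^sub>1 \<in> hyperplanes M" "H\<^sub>2 \<in> hyperplanes M" "H\<^sub>3 \<in> hyperplanes M"
    and neq: "H\<^sub>1 \<noteq> H\<^sub>2" "H\<^sub>1 \<noteq> H\<^sub>3" "H\<^sub>2 \<noteq> H\<^sub>3"
    and sub: "L \<subseteq> H\<^sub>1" "L \<subseteq> H\<^sub>2" "L \<subseteq> H\<^sub>3"
  shows "modular_triple M H\<^sub>1 H\<^sub>2 H\<^sub>3"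
proof -
  have "H\<^sub>1 \<inter> H\<^sub>2 = L" "H\<^sub>1 \<inter> H\<^sub>3 = L" "H\<^sub>2 \<inter> H\<^sub>3 = L"
    using coline_Int[OF M L] H neq sub by auto
  moreover from this have "H\<^sub>1 \<inter> H\<^sub>2 \<inter> H\<^sub>3 = L" by auto
  ultimately show ?thesis using L H by (simp add: modular_triple_def coline_def Let_def)
qed

lemma modular_tripleD:
  assumes M: "matroid M" and t: "modular_triple M H\<^sub>1 H\<^sub>2 H\<^sub>3"
  obtains L where "coline M L"
    "H\<^sub>1 \<in> hyperplanes M" "H\<^sub>2 \<in> hyperplanes M" "H\<^sub>3 \<in> hyperplanes M"
    "H\<^sub>1 \<noteq> H\<^sub>2" "H\<^sub>1 \<noteq> H\<^sub>3" "H\<^sub>2 \<noteq> H\<^sub>3"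
    "H\<^sub>1 \<inter> H\<^sub>2 = L" "H\<^sub>1 \<inter> H\<^sub>3 = L" "H\<^sub>2 \<inter> H\<^sub>3 = L"
proof -
  let ?L = "H\<^sub>1 \<inter> H\<^sub>2 \<inter> H\<^sub>3"
  have L: "coline M ?L" and H: "H\<^sub>1 \<in> hyperplanes M" "H\<^sub>2 \<in> hyperplanes M" "H\<^sub>3 \<in> hyperplanes M"
    and I: "H\<^sub>1 \<inter> H\<^sub>2 = ?L" "H\<^sub>1 \<inter> H\<^sub>3 = ?L" "H\<^sub>2 \<inter> H\<^sub>3 = ?L"
    using t by (auto simp: modular_triple_def coline_def Let_def)
  have "H \<noteq> ?L" if "H \<in> hyperplanes M" for H
    using L that by (auto simp: coline_def hyperplanes_def)
  then have "H\<^sub>1 \<noteq> H\<^sub>2" "H\<^sub>1 \<noteq> H\<^sub>3" "H\<^sub>2 \<noteq> H\<^sub>3" using I H by (metis Int_absorb)+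
  then show ?thesis using that[OF L H] I by blast
qed

lemma coline_cover:
  assumes M: "matroid M" and L: "coline M L" and H: "H \<in> hyperplanes M"
    and F: "flat M F" "L \<subseteq> F" "F \<subseteq> H"
  shows "F = L \<or> F = H"
proof (rule ccontr)
  assume "\<not> ?thesis"
  then have "rank_of M L < rank_of M F" "rank_of M F < rank_of M H"
    using rank_of_flat_strict_mono[OF M] F L hyperplane_flat[OF H] by (auto simp: coline_def)
  then show False using L H by (simp add: coline_def hyperplanes_def)
qed

text \<open>The counterpart of \<open>hyperplaneI\<close> one level down: being covered by one
  hyperplane is a condition on flats and fixes the corank.\<close>

lemma colineI:
  assumes M: "matroid M" and L: "flat M L" and H: "H \<in> hyperplanes M" and LH: "L \<subset> H"
    and cover: "\<And>F. flat M F \<Longrightarrow> L \<subset> F \<Longrightarrow> F \<subseteq> H \<Longrightarrow> F = H"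
  shows "coline M L"
proof -
  obtain e where e: "e \<in> H" "e \<notin> L" using LH by auto
  have eg: "e \<in> ground M" using e hyperplane_subset[OF H] by auto
  have sub: "insert e L \<subseteq> ground M" using eg flat_subset[OF L] by auto
  have "mcl M (insert e L) = H"
    by (rule cover[OF flat_mcl[OF M sub]])
      (use mcl_extensive[OF sub] e mcl_least[OF M hyperplane_flat[OF H]] LH in auto)
  then have "rank_of M H = Suc (rank_of M L)"
    using rank_of_mcl[OF M sub] rank_of_insert_flat[OF M L eg e(2)] by simp
  then show ?thesis using L H by (simp add: coline_def hyperplanes_def)
qed

lemma coline_insert_hyperplane:
  assumes M: "matroid M" and L: "coline M L" and e: "e \<in> ground M" "e \<notin> L"
  shows "mcl M (insert e L) \<in> hyperplanes M"
proof -
  have fl: "flat M L" and sub: "insert e L \<subseteq> ground M"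
    using L e flat_subset by (auto simp: coline_def)
  show ?thesis
    using rank_of_mcl[OF M sub] rank_of_insert_flat[OF M fl e] L flat_mcl[OF M sub]
    by (simp add: coline_def hyperplanes_def)
qed

text \<open>The intersection lies strictly below \<open>H\<close>, so its corank is at least two;
  two further elements that span the matroid make it at most two.\<close>

lemma coline_Int_of_spanning:
  assumes M: "matroid M" and H: "H \<in> hyperplanes M" "H' \<in> hyperplanes M" "H \<noteq> H'"
    and ae: "a \<in> ground M" "e \<in> ground M"
    and F: "\<And>F. flat M F \<Longrightarrow> insert a (insert e (H \<inter> H')) \<subseteq> F \<Longrightarrow> F = ground M"
  shows "coline M (H \<inter> H')"
proof -
  let ?L = "H \<inter> H'"
  have fl: "flat M ?L" using flat_Int[OF M] H hyperplane_flat by blast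
  have Lg: "?L \<subseteq> ground M" using flat_subset[OF fl] .
  have sub: "insert a (insert e ?L) \<subseteq> ground M" using Lg ae by auto
  have "mcl M (insert a (insert e ?L)) = ground M"
    using F[OF flat_mcl[OF M sub] mcl_extensive[OF sub]] .
  then have "matroid_rank M = rank_of M (insert a (insert e ?L))"
    using rank_of_mcl[OF M sub] by (simp add: matroid_rank_def)
  also have "\<dots> \<le> Suc (rank_of M (insert e ?L))" using rank_of_insert_le[OF M] ae Lg by auto
  also have "\<dots> \<le> Suc (Suc (rank_of M ?L))" using rank_of_insert_le[OF M Lg] ae by auto
  finally have 1: "matroid_rank M \<le> rank_of M ?L + 2" by simp
  have "rank_of M ?L < rank_of M H"
    using rank_of_flat_strict_mono[OF M fl hyperplane_flat[OF H(1)] hyperplane_Int_neq[OF M H]] .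
  then show ?thesis using 1 fl H(1) by (auto simp: coline_def hyperplanes_def)
qed

section \<open>Pastures and representations\<close>

locale pasture_struct = comm_monoid P for P :: "'p pasture" (structure) +
  assumes pasture: "pasture P"
begin

abbreviation zero :: 'p (\<open>\<zero>\<close>) where "\<zero> \<equiv> pzero P"

abbreviation null :: "'p \<Rightarrow> 'p \<Rightarrow> 'p \<Rightarrow> bool" where
  "null a b c \<equiv> {#a, b, c#} \<in> nullset P"

section \<open>Arithmetic in a pasture\<close>

lemma zero_closed [simp, intro]: "\<zero> \<in> carrier P"
  using pasture by (simp add: pasture_def)

lemma zero_mult [simp]: "a \<in> carrier P \<Longrightarrow> \<zero> \<otimes> a = \<zero>"
  using pasture by (simp add: pasture_def)

lemma mult_zero [simp]: "a \<in> carrier P \<Longrightarrow> a \<otimes> \<zero> = \<zero>"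
  using m_comm[of a \<zero>] by simp

lemma Units_iff: "a \<in> Units P \<longleftrightarrow> a \<in> carrier P \<and> a \<noteq> \<zero>"
  using pasture by (auto simp: pasture_def)

lemma one_neq_zero [simp]: "\<one> \<noteq> \<zero>"
  using Units_iff[of \<one>] by simp

lemma zero_notin_Units [simp]: "\<zero> \<notin> Units P"
  using Units_iff by auto

lemma inv_neq_zero [simp]: "a \<in> Units P \<Longrightarrow> inv a \<noteq> \<zero>"
  using Units_iff Units_inv_Units by auto

lemma cancel_left:
  assumes "d \<in> Units P" "d \<otimes> a = d \<otimes> b" "a \<in> carrier P" "b \<in> carrier P"
  shows "a = b"
  using assms by simp

lemma mult_eq_zero [simp]:
  assumes "a \<in> carrier P" "b \<in> carrier P"
  shows "a \<otimes> b = \<zero> \<longleftrightarrow> a = \<zero> \<or> b = \<zero>"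
proof
  assume *: "a \<otimes> b = \<zero>"
  show "a = \<zero> \<or> b = \<zero>"
  proof (rule ccontr)
    assume "\<not> ?thesis"
    then have "a \<in> Units P" "b \<in> Units P" using assms by (simp_all add: Units_iff)
    then have "a \<otimes> b \<in> Units P" by (rule Units_m_closed)
    then show False using * by simp
  qed
qed (use assms in auto)

lemma null_rotate: "null a b c \<longleftrightarrow> null b c a"
  by (metis add_mset_commute)

lemma null_swap: "null a b c \<longleftrightarrow> null b a c"
  by (metis add_mset_commute)

lemma null_single: "a \<in> carrier P \<Longrightarrow> null a \<zero> \<zero> \<longleftrightarrow> a = \<zero>"
  using pasture by (simp add: pasture_def)

lemma null_zero [simp]: "null \<zero> \<zero> \<zero>"
  using null_single by simp

lemma null_mult:
  assumes "null a b c" "d \<in> carrier P"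
  shows "null (d \<otimes> a) (d \<otimes> b) (d \<otimes> c)"
proof -
  have "image_mset (\<lambda>a. d \<otimes> a) {#a, b, c#} \<in> nullset P"
    using assms pasture unfolding pasture_def by blast
  then show ?thesis by simp
qed

lemma null_mult_iff:
  assumes d: "d \<in> Units P" and "a \<in> carrier P" "b \<in> carrier P" "c \<in> carrier P"
  shows "null (d \<otimes> a) (d \<otimes> b) (d \<otimes> c) \<longleftrightarrow> null a b c"
proof
  assume *: "null (d \<otimes> a) (d \<otimes> b) (d \<otimes> c)"
  have "inv d \<otimes> (d \<otimes> x) = x" if "x \<in> carrier P" for x
    using that d m_assoc[of "inv d" d x] by (simp add: Units_closed)
  then show "null a b c" using null_mult[OF *, of "inv d"] assms by simp
qed (use assms null_mult in auto)

text \<open>The element in the role of -1, which the axioms single out without naming it.\<close>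

definition neg :: 'p (\<open>\<epsilon>\<close>) where
  "\<epsilon> = (THE e. e \<in> Units P \<and> null \<one> e \<zero>)"

lemma neg_spec: "\<epsilon> \<in> Units P \<and> null \<one> \<epsilon> \<zero>"
  unfolding neg_def by (rule theI') (use pasture in \<open>unfold pasture_def, elim conjE\<close>)

lemma neg_unique: "e \<in> Units P \<Longrightarrow> null \<one> e \<zero> \<Longrightarrow> e = \<epsilon>"
  using neg_spec pasture unfolding pasture_def by blast

lemma neg_Units [simp, intro]: "\<epsilon> \<in> Units P"
  using neg_spec by simp

lemma neg_closed [simp, intro]: "\<epsilon> \<in> carrier P"
  by (rule Units_closed[OF neg_Units])

lemma neg_neq_zero [simp]: "\<epsilon> \<noteq> \<zero>"
  using neg_Units Units_iff by blast

text \<open>The bridge from null sums to equations: a nonzero \<open>a\<close> is scaled to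
  \<open>\<one>\<close>, where uniqueness of \<open>\<epsilon>\<close> decides. Every equation
  extracted from a representation comes from a null sum with a vanishing term.\<close>

lemma null_pair:
  assumes a: "a \<in> carrier P" and b: "b \<in> carrier P"
  shows "null a b \<zero> \<longleftrightarrow> b = \<epsilon> \<otimes> a"
proof (cases "a = \<zero>")
  case True
  then show ?thesis using null_single[OF b] null_swap by auto
next
  case False
  then have u: "a \<in> Units P" using a Units_iff by simp
  show ?thesis
  proof
    assume n: "null a b \<zero>"
    have "b \<noteq> \<zero>" using n null_single[OF a] False by auto
    then have "inv a \<otimes> b \<in> Units P" using u b Units_iff by (intro Units_m_closed) auto
    moreover have "null \<one> (inv a \<otimes> b) \<zero>" using null_mult[OF n, of "inv a"] u by simp
    ultimately have "inv a \<otimes> b = \<epsilon>" using neg_unique by blast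
    then have "a \<otimes> \<epsilon> = b" using u b a by (metis Units_inv_closed Units_r_inv m_assoc l_one)
    then show "b = \<epsilon> \<otimes> a" using m_comm[OF a neg_closed] by simp
  next
    assume "b = \<epsilon> \<otimes> a"
    then show "null a b \<zero>" using null_mult[of \<one> \<epsilon> \<zero> a] neg_spec a m_comm[of a \<epsilon>] by simp
  qed
qed

lemma neg_neg [simp]: "\<epsilon> \<otimes> \<epsilon> = \<one>"
proof -
  have "null \<epsilon> \<one> \<zero>" using neg_spec null_swap by blast
  then show ?thesis using null_pair[of \<epsilon> \<one>] by simp
qed

lemma neg_neg_mult [simp]: "a \<in> carrier P \<Longrightarrow> \<epsilon> \<otimes> (\<epsilon> \<otimes> a) = a"
  by (simp add: m_assoc[symmetric])

text \<open>The condition on modular triples, separated from \<open>representations\<close> so that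
  permuting the three functions and shrinking the ground set can be treated once.\<close>

definition dependent :: "'e set \<Rightarrow> ('e \<Rightarrow> 'p) \<Rightarrow> ('e \<Rightarrow> 'p) \<Rightarrow> ('e \<Rightarrow> 'p) \<Rightarrow> bool" where
  "dependent E u v w \<longleftrightarrow> (\<exists>a\<in>carrier P. \<exists>b\<in>carrier P. \<exists>c\<in>carrier P.
     \<not> (a = \<zero> \<and> b = \<zero> \<and> c = \<zero>) \<and> (\<forall>e\<in>E. null (a \<otimes> u e) (b \<otimes> v e) (c \<otimes> w e)))"

lemma dependentI:
  assumes "a \<in> carrier P" "b \<in> carrier P" "c \<in> carrier P" "\<not> (a = \<zero> \<and> b = \<zero> \<and> c = \<zero>)"
    "\<And>e. e \<in> E \<Longrightarrow> null (a \<otimes> u e) (b \<otimes> v e) (c \<otimes> w e)"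
  shows "dependent E u v w"
  using assms unfolding dependent_def by blast

lemma dependent_cong:
  assumes "dependent E u v w" "E' \<subseteq> E"
    "\<And>e. e \<in> E' \<Longrightarrow> u' e = u e" "\<And>e. e \<in> E' \<Longrightarrow> v' e = v e" "\<And>e. e \<in> E' \<Longrightarrow> w' e = w e"
  shows "dependent E' u' v' w'"
proof -
  obtain a b c where "a \<in> carrier P" "b \<in> carrier P" "c \<in> carrier P" "\<not> (a = \<zero> \<and> b = \<zero> \<and> c = \<zero>)"
    and n: "\<And>e. e \<in> E \<Longrightarrow> null (a \<otimes> u e) (b \<otimes> v e) (c \<otimes> w e)"
    using assms(1) unfolding dependent_def by blast
  then show ?thesis using assms(2-5) by (intro dependentI[of a b c]) auto
qed

lemma dependent_rotate: "dependent E u v w \<Longrightarrow> dependent E v w u"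
  unfolding dependent_def by (subst (asm) null_rotate) blast

lemma dependent_swap: "dependent E u v w \<Longrightarrow> dependent E v u w"
  unfolding dependent_def by (subst (asm) null_swap) blast

section \<open>Representations over a fixed pasture\<close>

lemma representations_iff:
  "f \<in> representations N P \<longleftrightarrow>
     f \<in> hyperplanes N \<rightarrow>\<^sub>E (ground N \<rightarrow>\<^sub>E carrier P) \<and>
     (\<forall>H\<in>hyperplanes N. \<forall>e\<in>ground N. f H e = \<zero> \<longleftrightarrow> e \<in> H) \<and>
     (\<forall>H\<^sub>1 H\<^sub>2 H\<^sub>3. modular_triple N H\<^sub>1 H\<^sub>2 H\<^sub>3 \<longrightarrow> dependent (ground N) (f H\<^sub>1) (f H\<^sub>2) (f H\<^sub>3))"
  unfolding representations_def dependent_def by simp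

lemma rep_closed:
  assumes "f \<in> representations N P" "H \<in> hyperplanes N" "e \<in> ground N"
  shows "f H e \<in> carrier P"
proof -
  have "f \<in> hyperplanes N \<rightarrow>\<^sub>E (ground N \<rightarrow>\<^sub>E carrier P)"
    using assms(1) by (simp add: representations_iff)
  then show ?thesis using assms(2,3) by (meson PiE_mem)
qed

lemma rep_zero:
  "f \<in> representations N P \<Longrightarrow> H \<in> hyperplanes N \<Longrightarrow> e \<in> ground N \<Longrightarrow> f H e = \<zero> \<longleftrightarrow> e \<in> H"
  by (simp add: representations_iff)

lemma rep_Units:
  "f \<in> representations N P \<Longrightarrow> H \<in> hyperplanes N \<Longrightarrow> e \<in> ground N \<Longrightarrow> f H e \<in> Units P \<longleftrightarrow> e \<notin> H"
  by (simp add: Units_iff rep_closed rep_zero)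

lemma rep_triple:
  "f \<in> representations N P \<Longrightarrow> modular_triple N H\<^sub>1 H\<^sub>2 H\<^sub>3 \<Longrightarrow>
     dependent (ground N) (f H\<^sub>1) (f H\<^sub>2) (f H\<^sub>3)"
  by (simp add: representations_iff)

text \<open>If every flat above \<open>K\<close> contains both or none of \<open>e\<close> and \<open>z\<close>, then \<open>e\<close> and \<open>z\<close> are parallel
  in the contraction by \<open>K\<close>, and a representation sees them as proportional columns. The proof joins
  two hyperplanes avoiding \<open>e\<close> by a path of modular pairs; the third hyperplane on each coline of the
  path is the one through \<open>e\<close>.\<close>

lemma rep_ratio:
  assumes N: "matroid N" and f: "f \<in> representations N P"
    and K: "e \<in> ground N" "z \<in> ground N" "\<And>F. flat N F \<Longrightarrow> K \<subseteq> F \<Longrightarrow> z \<in> F \<longleftrightarrow> e \<in> F"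
    and H: "H \<in> hyperplanes N" "H' \<in> hyperplanes N" "K \<subseteq> H" "K \<subseteq> H'" "e \<notin> H" "e \<notin> H'"
  shows "f H e \<otimes> f H' z = f H' e \<otimes> f H z"
  using H
proof (induction "card (ground N - (H \<inter> H'))" arbitrary: H H' rule: less_induct)
  case less
  have zH: "z \<notin> H" "z \<notin> H'" using K(3) hyperplane_flat less.prems by blast+
  have car: "f H e \<in> Units P" "f H z \<in> Units P" "f H' e \<in> Units P" "f H' z \<in> Units P"
    using rep_Units[OF f] less.prems K(1,2) zH by auto
  note car = car car[THEN Units_closed]
  let ?L = "H \<inter> H'"
  consider "H = H'" | "H \<noteq> H'" "coline N ?L" | "H \<noteq> H'" "\<not> coline N ?L" by blast
  then show ?case
  proof cases
    case 1
    then show ?thesis using car by simp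
  next
    case 2
    let ?D = "mcl N (insert e ?L)"
    have Lg: "?L \<subseteq> ground N" using hyperplane_subset less.prems(1) by blast
    have D: "?D \<in> hyperplanes N" "e \<in> ?D" "?L \<subseteq> ?D"
      using coline_insert_hyperplane[OF N 2(2) K(1)] mcl_insertI[OF Lg K(1)] less.prems(5) by auto
    then have zD: "z \<in> ?D" using K(3) hyperplane_flat less.prems(3,4) by blast
    have "H \<noteq> ?D" "H' \<noteq> ?D" using D less.prems(5,6) by auto
    then have "modular_triple N H H' ?D"
      using modular_tripleI[OF N 2(2) less.prems(1,2) D(1) 2(1)] D by auto
    then have "dependent (ground N) (f H) (f H') (f ?D)" using rep_triple[OF f] by blast
    then obtain a b c where abc: "a \<in> carrier P" "b \<in> carrier P" "c \<in> carrier P"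
        "\<not> (a = \<zero> \<and> b = \<zero> \<and> c = \<zero>)"
        "\<And>x. x \<in> ground N \<Longrightarrow> null (a \<otimes> f H x) (b \<otimes> f H' x) (c \<otimes> f ?D x)"
      unfolding dependent_def by blast
    have "f ?D e = \<zero>" "f ?D z = \<zero>" using rep_zero[OF f D(1)] K(1,2) D zD by auto
    then have ez: "b \<otimes> f H' e = \<epsilon> \<otimes> (a \<otimes> f H e)" "b \<otimes> f H' z = \<epsilon> \<otimes> (a \<otimes> f H z)"
      using abc(5)[OF K(1)] abc(5)[OF K(2)] null_pair abc(1-3) car by auto
    \<comment> \<open>If \<open>b\<close> vanished, the unit \<open>f H e\<close> would force
      \<open>a = \<zero>\<close>, and a point outside \<open>?D\<close> would then force
      \<open>c = \<zero>\<close>.\<close>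
    have "b \<noteq> \<zero>"
    proof
      assume b: "b = \<zero>"
      then have "\<epsilon> \<otimes> (a \<otimes> f H e) = \<zero>" using ez(1) car by auto
      then have "a = \<zero>" using car abc(1) Units_iff by auto
      obtain w where w: "w \<in> ground N" "w \<notin> ?D" using hyperplane_proper[OF D(1)] hyperplane_subset[OF D(1)] by blast
      have "null \<zero> \<zero> (c \<otimes> f ?D w)"
        using abc(5)[OF w(1)] b \<open>a = \<zero>\<close> rep_closed[OF f] less.prems w D by simp
      then have "c \<otimes> f ?D w = \<zero>"
        using null_single[of "c \<otimes> f ?D w"] null_rotate abc(3) rep_closed[OF f D(1) w(1)] by fastforce
      then have "c = \<zero>" using abc(3) rep_closed[OF f D(1) w(1)] rep_zero[OF f D(1) w(1)] w by auto
      then show False using abc(4) b \<open>a = \<zero>\<close> by simp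
    qed
    then have bU: "b \<in> Units P" using abc(2) Units_iff by simp
    have "b \<otimes> (f H e \<otimes> f H' z) = f H e \<otimes> (b \<otimes> f H' z)"
      using abc(2) car by (simp add: m_ac)
    also have "\<dots> = f H z \<otimes> (\<epsilon> \<otimes> (a \<otimes> f H e))"
      unfolding ez(2) using abc(1) car by (simp add: m_ac)
    also have "\<dots> = b \<otimes> (f H' e \<otimes> f H z)"
      unfolding ez(1)[symmetric] using abc(2) car by (simp add: m_ac)
    finally show ?thesis using cancel_left[OF bU] car by auto
  next
    case 3
    have fl: "flat N ?L" using flat_Int[OF N] hyperplane_flat less.prems(1,2) by blast
    have Lg: "?L \<subseteq> ground N" using hyperplane_subset less.prems(1) by blast
    obtain a where a: "a \<in> H" "a \<notin> H'"
      using hyperplane_Int_neq[OF N less.prems(1,2) 3(1)] by auto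
    have ag: "a \<in> ground N" using a hyperplane_subset less.prems(1) by auto
    let ?F = "mcl N (insert a ?L)"
    have Fa: "flat N ?F" "a \<in> ?F" "?L \<subseteq> ?F" "?F \<subseteq> H"
      using flat_mcl[OF N] mcl_insertI[OF Lg ag] ag Lg mcl_least[OF N hyperplane_flat[OF less.prems(1)]] a
      by auto
    have eF: "e \<notin> ?F" using Fa less.prems(5) by auto
    \<comment> \<open>If adding any such \<open>b\<close> to \<open>?F\<close> captured
      \<open>e\<close>, exchange would put all of \<open>H'\<close> into every flat containing
      \<open>a\<close>, \<open>e\<close> and \<open>?L\<close>; then \<open>a\<close> and
      \<open>e\<close> would span over \<open>?L\<close>, making it a coline. So some
      \<open>b\<close> leaves \<open>e\<close> out, and a hyperplane through \<open>?L\<close>,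
      \<open>a\<close> and \<open>b\<close> that avoids \<open>e\<close> meets both \<open>H\<close>
      and \<open>H'\<close> in more than \<open>?L\<close>, which decreases the measure.\<close>
    have "\<exists>b. b \<in> H' \<and> b \<notin> H \<and> e \<notin> mcl N (insert b ?F)"
    proof (rule ccontr)
      assume no: "\<not> ?thesis"
      have "F = ground N" if F: "flat N F" "insert a (insert e ?L) \<subseteq> F" for F
      proof -
        have FF: "?F \<subseteq> F" using mcl_least[OF N F(1)] F(2) by blast
        have "b \<in> F" if b: "b \<in> H'" for b
        proof (cases "b \<in> H")
          case False
          have bg: "b \<in> ground N" using b hyperplane_subset less.prems(2) by auto
          have "e \<in> mcl N (insert b ?F)" using no b False by blast
          then have "b \<in> mcl N (insert e ?F)" using mcl_exchange[OF N Fa(1) bg _ eF] by blast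
          moreover have "insert e ?F \<subseteq> F" using FF F(2) by auto
          then have "mcl N (insert e ?F) \<subseteq> F" by (rule mcl_least[OF N F(1)])
          ultimately show ?thesis by blast
        qed (use b F in auto)
        then have "H' \<subseteq> F" by blast
        then show ?thesis using hyperplane_maximal[OF N less.prems(2) F(1)] F(2) a by blast
      qed
      then show False using coline_Int_of_spanning[OF N less.prems(1,2) 3(1) ag K(1)] 3(2) by blast
    qed
    then obtain b where b: "b \<in> H'" "b \<notin> H" "e \<notin> mcl N (insert b ?F)" by blast
    have bg: "b \<in> ground N" using b hyperplane_subset less.prems(2) by auto
    have Fg: "?F \<subseteq> ground N" using flat_subset[OF Fa(1)] .
    obtain H'' where H'': "H'' \<in> hyperplanes N" "mcl N (insert b ?F) \<subseteq> H''" "e \<notin> H''"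
      using hyperplane_avoiding[OF N flat_mcl[OF N] K(1) b(3)] bg Fg by blast
    have sub: "?L \<subseteq> H''" "a \<in> H''" "b \<in> H''"
      using H''(2) mcl_insertI[OF Fg bg] Fa by auto
    have KL: "K \<subseteq> H''" using sub less.prems by auto
    have fin: "finite (ground N)" using matroid_finite[OF N] .
    have "card (ground N - (H \<inter> H'')) < card (ground N - ?L)"
      by (rule psubset_card_mono) (use fin a ag sub in auto)
    then have 1: "f H e \<otimes> f H'' z = f H'' e \<otimes> f H z"
      using less.hyps less.prems H'' KL by blast
    have "card (ground N - (H'' \<inter> H')) < card (ground N - ?L)"
      by (rule psubset_card_mono) (use fin b bg sub in auto)
    then have 2: "f H'' e \<otimes> f H' z = f H' e \<otimes> f H'' z"
      using less.hyps less.prems H'' KL by blast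
    have "z \<notin> H''" using K(3)[OF hyperplane_flat[OF H''(1)] KL] H''(3) by simp
    then have U: "f H'' e \<in> Units P" "f H'' z \<in> Units P"
      using rep_Units[OF f H''(1)] K(1,2) H''(3) by auto
    note U = U U[THEN Units_closed]
    have U': "f H'' e \<otimes> f H'' z \<in> Units P" using U by blast
    have "(f H'' e \<otimes> f H'' z) \<otimes> (f H e \<otimes> f H' z) = (f H e \<otimes> f H'' z) \<otimes> (f H'' e \<otimes> f H' z)"
      using U car by (simp add: m_ac)
    also have "\<dots> = (f H'' e \<otimes> f H'' z) \<otimes> (f H' e \<otimes> f H z)"
      unfolding 1 2 using U car by (simp add: m_ac)
    finally show ?thesis using cancel_left[OF U'] car by auto
  qed
qed

end

lemma pasture_structI: "pasture P \<Longrightarrow> pasture_struct P"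
  by (rule pasture_struct.intro, unfold pasture_def, elim conjE, assumption)
    (unfold pasture_struct_axioms_def pasture_def, intro conjI; elim conjE)

text \<open>Serves to express the function of \<open>H\<close> on a line through \<open>u\<close>
  and \<open>v\<close> by functions vanishing at \<open>u\<close> and at \<open>v\<close>. Among the
  hyperplanes containing \<open>u\<close> but not \<open>v\<close>, one with the largest possible
  intersection with \<open>H\<close> must meet \<open>H\<close> in a coline; \<open>B\<close> is the
  hyperplane through that coline and \<open>v\<close>.\<close>

lemma modular_triple_through:
  assumes M: "matroid M" and H: "H \<in> hyperplanes M" and uv: "u \<in> ground M" "v \<in> ground M"
    "u \<notin> H" "v \<notin> H" and sep: "flat M S" "u \<in> S" "v \<notin> S"
  obtains A B where "A \<in> hyperplanes M" "B \<in> hyperplanes M" "u \<in> A" "v \<notin> A" "v \<in> B" "u \<notin> B"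
    "modular_triple M H A B"
proof -
  define Q where "Q A \<longleftrightarrow> A \<in> hyperplanes M \<and> u \<in> A \<and> v \<notin> A" for A
  obtain A0 where A0: "A0 \<in> hyperplanes M" "S \<subseteq> A0" "v \<notin> A0"
    using hyperplane_avoiding[OF M sep(1) uv(2) sep(3)] .
  then have Q0: "Q A0" using sep(2) by (auto simp: Q_def)
  have fin: "finite (ground M)" using matroid_finite[OF M] .
  have b: "\<forall>A. Q A \<longrightarrow> card (A \<inter> H) < Suc (card (ground M))"
    using fin hyperplane_subset by (auto simp: Q_def less_Suc_eq_le intro!: card_mono)
  define A where "A = (ARG_MAX (\<lambda>A. card (A \<inter> H)) A. Q A)"
  have QA: "Q A" unfolding A_def by (rule arg_max_natI[of Q, OF Q0 b])
  have max: "card (A' \<inter> H) \<le> card (A \<inter> H)" if "Q A'" for A'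
    unfolding A_def using arg_max_nat_le[of Q A' "\<lambda>A. card (A \<inter> H)"] that b by blast
  have A: "A \<in> hyperplanes M" "u \<in> A" "v \<notin> A" using QA by (auto simp: Q_def)
  have neq: "H \<noteq> A" using A uv by auto
  let ?L = "H \<inter> A"
  have fl: "flat M ?L" using flat_Int[OF M] hyperplane_flat H A by blast
  have Lg: "?L \<subseteq> ground M" using hyperplane_subset H by blast
  let ?F = "mcl M (insert u ?L)"
  have F: "flat M ?F" "u \<in> ?F" "?L \<subseteq> ?F" "?F \<subseteq> A"
    using flat_mcl[OF M] mcl_insertI[OF Lg uv(1)] uv(1) Lg mcl_least[OF M hyperplane_flat[OF A(1)]] A
    by auto
  have Fg: "?F \<subseteq> ground M" using flat_subset[OF F(1)] .
  have "coline M ?L"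
  proof (rule coline_Int_of_spanning[OF M H A(1) neq uv(1,2)])
    fix G assume G: "flat M G" "insert u (insert v ?L) \<subseteq> G"
    have FG: "?F \<subseteq> G" using mcl_least[OF M G(1)] G(2) by blast
    have "b \<in> G" if bH: "b \<in> H" for b
    proof (cases "b \<in> A")
      case False
      have bg: "b \<in> ground M" using bH hyperplane_subset H by auto
      \<comment> \<open>Otherwise a hyperplane through \<open>?F\<close> and \<open>b\<close>
        avoiding \<open>v\<close> would compete with \<open>A\<close> and meet \<open>H\<close> in
        the additional element \<open>b\<close>.\<close>
      have "v \<in> mcl M (insert b ?F)"
      proof (rule ccontr)
        assume v: "v \<notin> mcl M (insert b ?F)"
        have "flat M (mcl M (insert b ?F))" using flat_mcl[OF M] bg Fg by blast
        then obtain A' where A': "A' \<in> hyperplanes M" "mcl M (insert b ?F) \<subseteq> A'" "v \<notin> A'"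
          using hyperplane_avoiding[OF M _ uv(2) v] by blast
        have sub: "b \<in> A'" "?F \<subseteq> A'" using A'(2) mcl_insertI[OF Fg bg] by auto
        then have "card (A' \<inter> H) \<le> card (A \<inter> H)" using max A' F by (auto simp: Q_def)
        moreover have "card (A \<inter> H) < card (A' \<inter> H)"
          by (rule psubset_card_mono)
            (use sub F bH False finite_subset[OF hyperplane_subset[OF H] fin] in auto)
        ultimately show False by simp
      qed
      then have "b \<in> mcl M (insert v ?F)" using mcl_exchange[OF M F(1) bg] F(4) A(3) by blast
      moreover have "insert v ?F \<subseteq> G" using FG G(2) by auto
      then have "mcl M (insert v ?F) \<subseteq> G" by (rule mcl_least[OF M G(1)])
      ultimately show ?thesis by blast
    qed (use bH G in auto)
    then show "G = ground M" using hyperplane_maximal[OF M H G(1)] G(2) uv(3) by blast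
  qed
  let ?B = "mcl M (insert v ?L)"
  have B: "?B \<in> hyperplanes M" "v \<in> ?B" "?L \<subseteq> ?B"
    using coline_insert_hyperplane[OF M \<open>coline M ?L\<close> uv(2)] mcl_insertI[OF Lg uv(2)] uv(4) by auto
  have nB: "H \<noteq> ?B" "A \<noteq> ?B" using B(2) uv(4) A(3) by auto
  have "A \<inter> ?B = ?L" by (rule coline_Int[OF M \<open>coline M ?L\<close> A(1) B(1) nB(2)]) (use B in auto)
  then have "u \<notin> ?B" using A(2) uv(3) by blast
  moreover have "modular_triple M H A ?B"
    by (rule modular_tripleI[OF M \<open>coline M ?L\<close> H A(1) B(1) neq nB]) (use B in auto)
  ultimately show ?thesis using that A B by blast
qed

section \<open>Flats of Theta\<close>

locale theta_labels =
  fixes n :: nat and x y :: "nat \<Rightarrow> 'e"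
  assumes n: "2 \<le> n" and inj_x: "inj_on x {1..n}" and inj_y: "inj_on y {1..n}"
    and disjoint: "x ` {1..n} \<inter> y ` {1..n} = {}"
begin

abbreviation N :: "nat set" where "N \<equiv> {1..n}"

text \<open>A subset of the ground set is replaced by a pair of index sets, so that bases, ranks and
  flats of Theta become statements about finite sets of numbers.\<close>

abbreviation cell :: "nat set \<Rightarrow> nat set \<Rightarrow> 'e set" where
  "cell A B \<equiv> x ` A \<union> y ` B"

lemma x_eq [simp]: "i \<in> N \<Longrightarrow> j \<in> N \<Longrightarrow> x i = x j \<longleftrightarrow> i = j"
  using inj_x by (meson inj_onD)

lemma y_eq [simp]: "i \<in> N \<Longrightarrow> j \<in> N \<Longrightarrow> y i = y j \<longleftrightarrow> i = j"
  using inj_y by (meson inj_onD)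

lemma x_neq_y [simp]: "i \<in> N \<Longrightarrow> j \<in> N \<Longrightarrow> x i \<noteq> y j" "i \<in> N \<Longrightarrow> j \<in> N \<Longrightarrow> y j \<noteq> x i"
  using disjoint by (metis IntI empty_iff imageI)+

lemma cell_subset_iff:
  assumes "A \<subseteq> N" "B \<subseteq> N" "A' \<subseteq> N" "B' \<subseteq> N"
  shows "cell A B \<subseteq> cell A' B' \<longleftrightarrow> A \<subseteq> A' \<and> B \<subseteq> B'"
proof
  assume *: "cell A B \<subseteq> cell A' B'"
  show "A \<subseteq> A' \<and> B \<subseteq> B'"
  proof (intro conjI subsetI)
    fix a assume a: "a \<in> A"
    then have "x a \<in> cell A' B'" using * by blast
    then consider a' where "a' \<in> A'" "x a = x a'" | b where "b \<in> B'" "x a = y b" by blast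
    then show "a \<in> A'" using a assms by cases (metis subsetD x_eq x_neq_y(1))+
  next
    fix b assume b: "b \<in> B"
    then have "y b \<in> cell A' B'" using * by blast
    then consider a where "a \<in> A'" "y b = x a" | b' where "b' \<in> B'" "y b = y b'" by blast
    then show "b \<in> B'" using b assms by cases (metis subsetD y_eq x_neq_y(2))+
  qed
qed blast

lemma cell_eq_iff:
  assumes "A \<subseteq> N" "B \<subseteq> N" "A' \<subseteq> N" "B' \<subseteq> N"
  shows "cell A B = cell A' B' \<longleftrightarrow> A = A' \<and> B = B'"
  unfolding set_eq_subset[of "cell A B"] set_eq_subset[of A] set_eq_subset[of B]
    cell_subset_iff[OF assms] cell_subset_iff[OF assms(3,4,1,2)] by satx

lemma x_in_cell: "i \<in> N \<Longrightarrow> A \<subseteq> N \<Longrightarrow> B \<subseteq> N \<Longrightarrow> x i \<in> cell A B \<longleftrightarrow> i \<in> A"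
  using cell_subset_iff[of "{i}" "{}" A B] by auto

lemma y_in_cell: "i \<in> N \<Longrightarrow> A \<subseteq> N \<Longrightarrow> B \<subseteq> N \<Longrightarrow> y i \<in> cell A B \<longleftrightarrow> i \<in> B"
  using cell_subset_iff[of "{}" "{i}" A B] by auto

lemma card_cell:
  assumes "A \<subseteq> N" "B \<subseteq> N"
  shows "card (cell A B) = card A + card B"
proof -
  have "x ` A \<inter> y ` B = {}" using disjoint assms by blast
  then have "card (cell A B) = card (x ` A) + card (y ` B)"
    using assms by (intro card_Un_disjoint) (auto intro: finite_subset)
  then show ?thesis using assms inj_x inj_y by (metis card_image inj_on_subset)
qed

lemma subset_cellE:
  assumes "S \<subseteq> cell A B"
  obtains A' B' where "A' \<subseteq> A" "B' \<subseteq> B" "S = cell A' B'"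
proof
  show "{a \<in> A. x a \<in> S} \<subseteq> A" "{b \<in> B. y b \<in> S} \<subseteq> B" by auto
  show "S = cell {a \<in> A. x a \<in> S} {b \<in> B. y b \<in> S}" using assms by auto
qed

section \<open>Bases, independent sets and rank of Theta\<close>

lemma ground_Theta [simp]: "ground (Theta n x y) = cell N N"
  by (simp add: Theta_def Let_def)

lemma bases_Theta:
  assumes AB: "A \<subseteq> N" "B \<subseteq> N"
  shows "cell A B \<in> bases (Theta n x y) \<longleftrightarrow>
     A = {} \<and> B = N \<or> (\<exists>i\<in>N. \<exists>j\<in>N. i \<noteq> j \<and> A = {j} \<and> B = N - {i}) \<or> card A = 2 \<and> card B + 2 = n"
    (is "?L \<longleftrightarrow> ?R")
proof -
  have Ydiff: "y ` N - y ` C = y ` (N - C)" if "C \<subseteq> N" for C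
    using inj_on_image_set_diff[OF inj_y, of N C] that by auto
  have 1: "cell A B = y ` N \<longleftrightarrow> A = {} \<and> B = N"
    using cell_eq_iff[of A B "{}" N] AB by simp
  have 2: "cell A B = insert (x j) (y ` N - {y i}) \<longleftrightarrow> A = {j} \<and> B = N - {i}"
    if "i \<in> N" "j \<in> N" for i j
    using cell_eq_iff[of A B "{j}" "N - {i}"] AB that Ydiff[of "{i}"] by simp
  have 3: "(\<exists>Y' X'. cell A B = (y ` N - Y') \<union> X' \<and> Y' \<subseteq> y ` N \<and> X' \<subseteq> x ` N \<and> card Y' = 2 \<and> card X' = 2)
      \<longleftrightarrow> card A = 2 \<and> card B + 2 = n" (is "?P \<longleftrightarrow> ?Q")
  proof
    assume ?P
    then obtain Y' X' where YX: "cell A B = (y ` N - Y') \<union> X'" "Y' \<subseteq> y ` N" "X' \<subseteq> x ` N"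
      "card Y' = 2" "card X' = 2" by blast
    obtain C where C: "C \<subseteq> N" "Y' = y ` C" using YX(2) by (meson subset_image_iff)
    obtain D where D: "D \<subseteq> N" "X' = x ` D" using YX(3) by (meson subset_image_iff)
    have cc: "card C = 2" "card D = 2"
      using YX(4,5) C D card_image[OF inj_on_subset[OF inj_y C(1)]]
        card_image[OF inj_on_subset[OF inj_x D(1)]] by auto
    have "cell A B = cell D (N - C)"
      unfolding YX(1) D(2) C(2) Ydiff[OF C(1)] by (rule Un_commute)
    then have "A = D" "B = N - C" using cell_eq_iff[of A B D "N - C"] AB D by auto
    then show ?Q using cc C(1) card_mono[of N C] by (simp add: card_Diff_subset finite_subset[of C N])
  next
    assume Q: ?Q
    have "y ` N - y ` (N - B) = y ` (N - (N - B))" by (rule Ydiff) auto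
    also have "N - (N - B) = B" using AB by auto
    finally have e: "cell A B = (y ` N - y ` (N - B)) \<union> x ` A" by (simp only: Un_commute)
    have sub: "y ` (N - B) \<subseteq> y ` N" "x ` A \<subseteq> x ` N" using AB by auto
    have "card (y ` (N - B)) = card (N - B)" by (rule card_image[OF inj_on_subset[OF inj_y]]) auto
    also have "\<dots> = card N - card B" using AB(2) by (intro card_Diff_subset finite_subset[of B N]) auto
    also have "\<dots> = 2" using Q by auto
    finally have "card (y ` (N - B)) = 2" .
    moreover have "card (x ` A) = 2" using Q card_image[OF inj_on_subset[OF inj_x AB(1)]] by simp
    ultimately show ?P using e sub by blast
  qed
  have "S \<in> bases (Theta n x y) \<longleftrightarrow> S = y ` N \<or>
      (\<exists>i\<in>N. \<exists>j\<in>N. i \<noteq> j \<and> S = insert (x j) (y ` N - {y i})) \<or>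
      (\<exists>Y' X'. S = (y ` N - Y') \<union> X' \<and> Y' \<subseteq> y ` N \<and> X' \<subseteq> x ` N \<and> card Y' = 2 \<and> card X' = 2)" for S
    unfolding Theta_def Let_def matroid.select_convs Un_iff mem_Collect_eq singleton_iff disj_assoc
    by (intro disj_cong refl iffI; elim exE conjE bexE; blast)
  then have "?L \<longleftrightarrow> cell A B = y ` N \<or>
      (\<exists>i\<in>N. \<exists>j\<in>N. i \<noteq> j \<and> cell A B = insert (x j) (y ` N - {y i})) \<or>
      (\<exists>Y' X'. cell A B = (y ` N - Y') \<union> X' \<and> Y' \<subseteq> y ` N \<and> X' \<subseteq> x ` N \<and> card Y' = 2 \<and> card X' = 2)"
    by (rule meta_spec)
  also have "\<dots> \<longleftrightarrow> ?R" unfolding 1 3 using 2 by auto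
  finally show ?thesis .
qed

lemma bases_Theta_cell:
  assumes "S \<in> bases (Theta n x y)"
  obtains A B where "A \<subseteq> N" "B \<subseteq> N" "S = cell A B"
proof -
  have "S \<subseteq> cell N N" using assms unfolding Theta_def Let_def by auto
  then show ?thesis using subset_cellE that by metis
qed

text \<open>A basis above a single x_a either omits one y_i with i \<noteq> a or omits two of the y.
  In both cases \<open>B\<close> misses an index different from \<open>a\<close>, which is what the
  two inequations in the middle disjunct express.\<close>

lemma indep_Theta:
  assumes AB: "A \<subseteq> N" "B \<subseteq> N"
  shows "indep (Theta n x y) (cell A B) \<longleftrightarrow>
     A = {} \<or> (\<exists>a. A = {a} \<and> B \<noteq> N \<and> B \<noteq> N - {a}) \<or> card A = 2 \<and> card B + 2 \<le> n"
    (is "_ \<longleftrightarrow> ?R")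
proof
  assume "indep (Theta n x y) (cell A B)"
  then obtain S where S: "S \<in> bases (Theta n x y)" "cell A B \<subseteq> S" by (auto simp: indep_def)
  obtain A' B' where AB': "A' \<subseteq> N" "B' \<subseteq> N" "S = cell A' B'" using bases_Theta_cell[OF S(1)] .
  have sub: "A \<subseteq> A'" "B \<subseteq> B'" using S(2) AB' cell_subset_iff[OF AB AB'(1,2)] by auto
  consider "A' = {}" | i j where "i \<in> N" "i \<noteq> j" "A' = {j}" "B' = N - {i}"
    | "card A' = 2" "card B' + 2 = n"
    using S(1) AB'(3) bases_Theta[OF AB'(1,2)] by blast
  then show ?R
  proof cases
    case 1
    then show ?thesis using sub by auto
  next
    case 2
    have "B \<noteq> N" using 2(1,4) sub(2) by blast
    moreover have "B \<noteq> N - {j}" using 2(1,2,4) sub(2) by blast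
    moreover have "A = {} \<or> A = {j}" using 2(3) sub(1) by (simp add: subset_singleton_iff)
    ultimately show ?thesis by blast
  next
    case 3
    have fin: "finite A'" "finite B'" using AB' finite_subset by blast+
    have cB: "card B + 2 \<le> n" using 3 card_mono[OF fin(2) sub(2)] by simp
    have "card A \<le> 2" using 3 card_mono[OF fin(1) sub(1)] by simp
    then consider "card A = 0" | "card A = 1" | "card A = 2" by linarith
    then show ?thesis
    proof cases
      case 1
      then show ?thesis using sub fin finite_subset by fastforce
    next
      case 2
      then obtain a where a: "A = {a}" by (auto simp: card_1_singleton_iff)
      moreover have "B \<noteq> N" using cB by auto
      moreover have "B \<noteq> N - {a}" using cB AB(1) a by auto
      ultimately show ?thesis by blast
    qed (use cB in auto)
  qed
next
  assume ?R
  have "\<exists>A' B'. A' \<subseteq> N \<and> B' \<subseteq> N \<and> A \<subseteq> A' \<and> B \<subseteq> B' \<and> cell A' B' \<in> bases (Theta n x y)"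
    using \<open>?R\<close>
  proof (elim disjE exE conjE)
    assume "A = {}"
    then show ?thesis using AB bases_Theta[of "{}" N] by blast
  next
    fix a assume a: "A = {a}" "B \<noteq> N" "B \<noteq> N - {a}"
    have "\<exists>i\<in>N. i \<notin> B \<and> i \<noteq> a" using AB a by blast
    then obtain i where i: "i \<in> N" "i \<notin> B" "i \<noteq> a" by blast
    have "cell {a} (N - {i}) \<in> bases (Theta n x y)"
      by (subst bases_Theta) (use i AB a(1) in blast)+
    moreover have "{a} \<subseteq> N" "N - {i} \<subseteq> N" "A \<subseteq> {a}" "B \<subseteq> N - {i}" using AB a(1) i by blast+
    ultimately show ?thesis by blast
  next
    assume c: "card A = 2" "card B + 2 \<le> n"
    have "2 \<le> card (N - B)" using c AB by (simp add: card_Diff_subset finite_subset[of B N])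
    then obtain C where C: "C \<subseteq> N - B" "card C = 2" by (meson obtain_subset_with_card_n)
    have "card (N - C) + 2 = n"
    proof -
      have "C \<subseteq> N" "finite C" using C by (auto intro: finite_subset)
      then show ?thesis using C(2) n by (simp add: card_Diff_subset)
    qed
    then have "cell A (N - C) \<in> bases (Theta n x y)" using bases_Theta[of A "N - C"] c AB by auto
    then show ?thesis using AB C by (intro exI[of _ A] exI[of _ "N - C"]) auto
  qed
  then obtain A' B' where "A \<subseteq> A'" "B \<subseteq> B'" "cell A' B' \<in> bases (Theta n x y)" by blast
  moreover from this have "cell A B \<subseteq> cell A' B'" by auto
  ultimately show "indep (Theta n x y) (cell A B)" unfolding indep_def by blast
qed

text \<open>Subsets of the ground set are recorded as \<open>cell T (N - C)\<close>: here \<open>T\<close> lists the indices of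
  the \<open>x\<^sub>i\<close> that are present, but \<open>C\<close> those of the \<open>y\<^sub>i\<close> that are absent.\<close>

definition theta_rank :: "nat set \<Rightarrow> nat set \<Rightarrow> nat" where
  "theta_rank T C =
     (if T = {} then n - card C
      else if card T = 1 then (if C = {} then n else if C = T then n - 1 else Suc n - card C)
      else if card C \<le> 1 then n else n + 2 - card C)"

text \<open>In each case an explicit independent \<open>cell A B\<close> attains the value, and
  \<open>indep_Theta\<close> bounds all others. If only x_i is present and \<open>C\<close> is empty
  or \<open>{i}\<close>, then x_i contributes nothing, being spanned by the y of index other than i;
  this is the exceptional branch of \<open>theta_rank\<close>.\<close>

lemma rank_of_Theta:
  assumes T: "T \<subseteq> N" and C: "C \<subseteq> N"
  shows "rank_of (Theta n x y) (cell T (N - C)) = theta_rank T C"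
proof -
  let ?th = "Theta n x y"
  have fin: "finite T" "finite C" using finite_subset[OF T] finite_subset[OF C] by auto
  then have fin: "finite T" "finite C" "finite (cell T (N - C))" by auto
  have cNC: "card (N - C) + card C = n"
    using card_Diff_subset[OF fin(2) C] card_mono[OF _ C] by simp
  have eqI: "rank_of ?th (cell T (N - C)) = card A + card B"
    if "A \<subseteq> T" "B \<subseteq> N - C" "indep ?th (cell A B)"
      "\<And>A' B'. A' \<subseteq> T \<Longrightarrow> B' \<subseteq> N - C \<Longrightarrow> indep ?th (cell A' B') \<Longrightarrow> card A' + card B' \<le> card A + card B"
    for A B
  proof -
    have cAB: "card (cell A B) = card A + card B" using card_cell[of A B] that(1,2) T by auto
    have "rank_of ?th (cell T (N - C)) = card (cell A B)"
    proof (rule rank_of_eqI[OF fin(3) that(3)])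
      show "cell A B \<subseteq> cell T (N - C)" using that by auto
      fix J assume J: "indep ?th J" "J \<subseteq> cell T (N - C)"
      obtain A' B' where J': "A' \<subseteq> T" "B' \<subseteq> N - C" "J = cell A' B'" using subset_cellE[OF J(2)] .
      have "card J = card A' + card B'" using J' T card_cell[of A' B'] by auto
      then show "card J \<le> card (cell A B)" using that(4) J J' cAB by simp
    qed
    then show ?thesis using cAB by simp
  qed
  have bound: "card A' + card B' \<le> n"
    if "A' \<subseteq> N" "B' \<subseteq> N" "indep ?th (cell A' B')" for A' B'
  proof -
    have "A' = {} \<or> (\<exists>a. A' = {a} \<and> B' \<noteq> N \<and> B' \<noteq> N - {a}) \<or> card A' = 2 \<and> card B' + 2 \<le> n"
      using indep_Theta[OF that(1,2)] that(3) by (rule iffD1)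
    moreover have "card B' \<le> n" using card_mono[OF _ that(2)] by simp
    moreover have "card B' < n" if "B' \<noteq> N"
      using psubset_card_mono[of N B'] that \<open>B' \<subseteq> N\<close> by simp
    ultimately show "card A' + card B' \<le> n" by (elim disjE exE conjE) simp_all
  qed
  consider "T = {}" | i where "T = {i}" | "2 \<le> card T"
    using fin by (metis One_nat_def Suc_1 Suc_leI card_1_singletonE card_gt_0_iff le_neq_implies_less)
  then show ?thesis
  proof cases
    case 1
    have "rank_of ?th (cell T (N - C)) = card ({}::nat set) + card (N - C)"
    proof (rule eqI)
      show "indep ?th (cell {} (N - C))" using indep_Theta[of "{}" "N - C"] by simp
      fix A' B' assume "A' \<subseteq> T" "B' \<subseteq> N - C"
      then show "card A' + card B' \<le> card ({}::nat set) + card (N - C)"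
        using 1 by (auto intro: card_mono)
    qed auto
    then show ?thesis using 1 cNC by (simp add: theta_rank_def)
  next
    case 2
    show ?thesis
    proof (cases "C = {} \<or> C = {i}")
      case True
      have "rank_of ?th (cell T (N - C)) = card ({}::nat set) + card (N - C)"
      proof (rule eqI)
        show "indep ?th (cell {} (N - C))" using indep_Theta[of "{}" "N - C"] by simp
        fix A' B' assume J: "A' \<subseteq> T" "B' \<subseteq> N - C" "indep ?th (cell A' B')"
        have le: "card B' \<le> card (N - C)" using J(2) by (intro card_mono) auto
        show "card A' + card B' \<le> card ({}::nat set) + card (N - C)"
        proof (cases "A' = {}")
          case False
          then have A': "A' = {i}" using J(1) 2 by auto
          have "B' \<noteq> N \<and> B' \<noteq> N - {i}" using indep_Theta[of A' B'] J T A' by auto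
          then have "B' \<subset> N - C" using J(2) True by auto
          then have "card B' < card (N - C)" by (intro psubset_card_mono) auto
          then show ?thesis using A' by simp
        qed (use le in simp)
      qed auto
      then show ?thesis using 2 True cNC by (auto simp: theta_rank_def)
    next
      case False
      have "rank_of ?th (cell T (N - C)) = card {i} + card (N - C)"
      proof (rule eqI)
        have "N - C \<noteq> N" "N - C \<noteq> N - {i}" using False C T 2 by blast+
        then show "indep ?th (cell {i} (N - C))" using indep_Theta[of "{i}" "N - C"] 2 T by simp
        fix A' B' assume J: "A' \<subseteq> T" "B' \<subseteq> N - C"
        then have "card A' \<le> card {i}" "card B' \<le> card (N - C)"
          using 2 by (auto intro!: card_mono simp del: card.insert)
        then show "card A' + card B' \<le> card {i} + card (N - C)" by simp
      qed (use 2 in auto)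
      then show ?thesis using 2 False cNC by (auto simp: theta_rank_def)
    qed
  next
    case 3
    consider "C = {}" | c where "C = {c}" | "2 \<le> card C"
      using fin by (metis One_nat_def Suc_1 Suc_leI card_1_singletonE card_gt_0_iff le_neq_implies_less)
    then show ?thesis
    proof cases
      case C1: 1
      have "rank_of ?th (cell T (N - C)) = card ({}::nat set) + card (N - C)"
      proof (rule eqI)
        show "indep ?th (cell {} (N - C))" using indep_Theta[of "{}" "N - C"] by simp
        fix A' B' assume "A' \<subseteq> T" "B' \<subseteq> N - C" "indep ?th (cell A' B')"
        then show "card A' + card B' \<le> card ({}::nat set) + card (N - C)"
          using bound[of A' B'] T C1 by auto
      qed auto
      then show ?thesis using 3 C1 by (auto simp: theta_rank_def)
    next
      case C2: 2
      have "\<not> T \<subseteq> {c}"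
      proof
        assume "T \<subseteq> {c}"
        from card_mono[OF _ this] show False using 3 by simp
      qed
      then obtain t where t: "t \<in> T" "t \<noteq> c" by blast
      have cc: "c \<in> N" using C C2 by simp
      have "rank_of ?th (cell T (N - C)) = card {t} + card (N - C)"
      proof (rule eqI)
        have "N - C \<noteq> N" "N - C \<noteq> N - {t}" using cc C2 t T by blast+
        then show "indep ?th (cell {t} (N - C))" using indep_Theta[of "{t}" "N - C"] t T by auto
        fix A' B' assume "A' \<subseteq> T" "B' \<subseteq> N - C" "indep ?th (cell A' B')"
        then have "card A' + card B' \<le> n" using bound[of A' B'] T by auto
        then show "card A' + card B' \<le> card {t} + card (N - C)" using cNC C2 by simp
      qed (use t in auto)
      then show ?thesis using 3 C2 cNC by (auto simp: theta_rank_def)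
    next
      case C3: 3
      obtain A where A: "A \<subseteq> T" "card A = 2" using 3 by (meson obtain_subset_with_card_n)
      have "rank_of ?th (cell T (N - C)) = card A + card (N - C)"
      proof (rule eqI)
        show "indep ?th (cell A (N - C))" using indep_Theta[of A "N - C"] A T C3 cNC by auto
        fix A' B' assume J: "A' \<subseteq> T" "B' \<subseteq> N - C" "indep ?th (cell A' B')"
        then have "A' = {} \<or> (\<exists>a. A' = {a}) \<or> card A' = 2" using indep_Theta[of A' B'] T by blast
        then have "card A' \<le> 2" by auto
        moreover have "card B' \<le> card (N - C)" using J by (intro card_mono) auto
        ultimately show "card A' + card B' \<le> card A + card (N - C)" using A by simp
      qed (use A in auto)
      then show ?thesis using 3 C3 cNC A by (auto simp: theta_rank_def)
    qed
  qed
qed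

text \<open>Three or more absent y impose no condition. The other clauses reflect dependencies: Y
  spans every x; Y - {y_i} spans x_i and no other point of the line; modulo Y - {y_i, y_j} the point
  x_i is parallel to y_j, so it cannot be present while y_j is absent.\<close>

definition theta_closed :: "nat set \<Rightarrow> nat set \<Rightarrow> bool" where
  "theta_closed T C \<longleftrightarrow> (C = {} \<longrightarrow> T = N) \<and> (\<forall>i. C = {i} \<longrightarrow> T = {i}) \<and>
     (\<forall>i j. i \<noteq> j \<longrightarrow> C = {i, j} \<longrightarrow> i \<notin> T \<and> j \<notin> T)"

lemma flat_Theta_iff_rank:
  assumes T: "T \<subseteq> N" and C: "C \<subseteq> N"
  shows "flat (Theta n x y) (cell T (N - C)) \<longleftrightarrow>
     (\<forall>j\<in>N - T. theta_rank T C < theta_rank (insert j T) C) \<and>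
     (\<forall>j\<in>C. theta_rank T C < theta_rank T (C - {j}))"
proof -
  have ix: "insert (x j) (cell T (N - C)) = cell (insert j T) (N - C)" for j by auto
  have iy: "insert (y j) (cell T (N - C)) = cell T (N - (C - {j}))" if "j \<in> C" for j
    using that C by auto
  have g: "cell N N - cell T (N - C) = x ` (N - T) \<union> y ` C"
  proof -
    have "x i \<in> cell T (N - C) \<longleftrightarrow> i \<in> T" "y i \<in> cell T (N - C) \<longleftrightarrow> i \<notin> C" if "i \<in> N" for i
      using x_in_cell[OF that T] y_in_cell[OF that T] that by auto
    note mem = this
    show ?thesis
    proof (intro equalityI subsetI)
      fix e assume e: "e \<in> cell N N - cell T (N - C)"
      then consider i where "i \<in> N" "e = x i" | i where "i \<in> N" "e = y i" by blast
      then show "e \<in> x ` (N - T) \<union> y ` C"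
        by cases (use e mem in \<open>metis DiffD2 DiffI UnI1 UnI2 imageI\<close>)+
    next
      fix e assume "e \<in> x ` (N - T) \<union> y ` C"
      then consider i where "i \<in> N - T" "e = x i" | i where "i \<in> C" "e = y i" by blast
      then show "e \<in> cell N N - cell T (N - C)"
        by cases (use mem C in \<open>metis DiffD1 DiffD2 DiffI UnI1 UnI2 imageI subsetD\<close>)+
    qed
  qed
  have "cell T (N - C) \<subseteq> cell N N" using T by auto
  then have "flat (Theta n x y) (cell T (N - C)) \<longleftrightarrow> (\<forall>e\<in>x ` (N - T) \<union> y ` C.
      rank_of (Theta n x y) (cell T (N - C)) < rank_of (Theta n x y) (insert e (cell T (N - C))))"
    unfolding flat_def using g by simp
  also have "\<dots> \<longleftrightarrow> (\<forall>j\<in>N - T. rank_of (Theta n x y) (cell T (N - C)) < rank_of (Theta n x y) (cell (insert j T) (N - C))) \<and>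
     (\<forall>j\<in>C. rank_of (Theta n x y) (cell T (N - C)) < rank_of (Theta n x y) (cell T (N - (C - {j}))))"
    unfolding ball_Un ball_simps using ix iy by auto
  also have "\<dots> \<longleftrightarrow> (\<forall>j\<in>N - T. theta_rank T C < theta_rank (insert j T) C) \<and>
     (\<forall>j\<in>C. theta_rank T C < theta_rank T (C - {j}))"
  proof -
    have "rank_of (Theta n x y) (cell (insert j T) (N - C)) = theta_rank (insert j T) C" if "j \<in> N - T" for j
      by (rule rank_of_Theta) (use that T C in auto)
    moreover have "rank_of (Theta n x y) (cell T (N - (C - {j}))) = theta_rank T (C - {j})" for j
      by (rule rank_of_Theta) (use T C in auto)
    ultimately show ?thesis using rank_of_Theta[OF T C] by simp
  qed
  finally show ?thesis .
qed

text \<open>Flats of the other matroid meet the line in nothing, one point or everything, and only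
  for such \<open>T\<close> is the short condition \<open>theta_closed\<close> exact: two points
  together with all but two y already have full rank, although \<open>theta_closed\<close> may hold
  for them.\<close>

lemma flat_Theta_iff:
  assumes T: "T = {} \<or> (\<exists>i\<in>N. T = {i}) \<or> T = N" and C: "C \<subseteq> N"
  shows "flat (Theta n x y) (cell T (N - C)) \<longleftrightarrow> theta_closed T C"
proof -
  have TN: "T \<subseteq> N" using T by auto
  have finC: "finite C" using C finite_subset by auto
  have cC: "card C \<le> n" using card_mono[OF _ C] by simp
  have other: "\<exists>j\<in>N. j \<noteq> i" for i
  proof (cases "i = 1")
    case True
    then show ?thesis using n by (intro bexI[of _ 2]) auto
  next
    case False
    then show ?thesis using n by (intro bexI[of _ 1]) auto
  qed
  have cardN: "card N = n" by simp
  have cd: "card (C - {j}) = card C - 1" if "j \<in> C" for j using that by simp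
  consider "C = {}" | c where "C = {c}" "c \<in> N" | c d where "C = {c, d}" "c \<noteq> d" "c \<in> N" "d \<in> N"
    | "3 \<le> card C"
  proof -
    have "card C = 0 \<or> card C = 1 \<or> card C = 2 \<or> 3 \<le> card C" by linarith
    then show ?thesis using that finC C by (auto simp: card_1_singleton_iff card_2_iff)
  qed
  note C_cases = this
  have 4: "theta_closed T C" if "3 \<le> card C"
  proof -
    have "C \<noteq> {}" "C \<noteq> {i}" "C \<noteq> {i, j}" for i j
      using that card_length[of "[i, j]"] by auto
    then show ?thesis by (simp add: theta_closed_def)
  qed
  show ?thesis using T
  proof (elim disjE bexE)
    assume T: "T = {}"
    have r: "theta_rank T C' = n - card C'" for C' using T by (simp add: theta_rank_def)
    have r1: "theta_rank (insert j T) C = (if C = {} then n else if C = {j} then n - 1 else Suc n - card C)" for j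
      using T by (simp add: theta_rank_def)
    note F = flat_Theta_iff_rank[OF TN C, unfolded r r1]
    show ?thesis using C_cases
    proof cases
      case 1
      then show ?thesis unfolding F using T n by (auto simp: theta_closed_def)
    next
      case (2 c)
      then show ?thesis unfolding F using T n by (auto simp: theta_closed_def)
    next
      case (3 c d)
      then show ?thesis unfolding F using T n by (auto simp: theta_closed_def doubleton_eq_iff)
    next
      case c: 4
      have "C \<noteq> {}" "C \<noteq> {j}" for j using c by auto
      then show ?thesis unfolding F using 4[OF c] c cC cd by auto
    qed
  next
    fix i assume i: "i \<in> N" and T: "T = {i}"
    have r: "theta_rank T C' = (if C' = {} then n else if C' = {i} then n - 1 else Suc n - card C')" for C'
      using T by (auto simp: theta_rank_def)
    have r1: "theta_rank (insert j T) C = (if card C \<le> 1 then n else n + 2 - card C)" if "j \<in> N - T" for j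
      using that T by (auto simp: theta_rank_def card_insert_if)
    have TnN: "T \<noteq> N" using T other[of i] by auto
    have "(\<forall>j\<in>N - T. theta_rank T C < theta_rank (insert j T) C) \<longleftrightarrow>
       theta_rank T C < (if card C \<le> 1 then n else n + 2 - card C)"
      using r1 other[of i] T by auto
    note F = flat_Theta_iff_rank[OF TN C, unfolded this, unfolded r]
    show ?thesis using C_cases
    proof cases
      case 1
      then show ?thesis unfolding F using TnN by (auto simp: theta_closed_def)
    next
      case (2 c)
      then show ?thesis unfolding F using T n by (auto simp: theta_closed_def)
    next
      case (3 c d)
      have e: "{c, d} - {c} = {d}" "{c, d} - {d} = {c}" "card {c, d} = 2" "{c, d} \<noteq> {i}"
        using 3(2) by auto
      have cl: "theta_closed T {c, d} \<longleftrightarrow> i \<noteq> c \<and> i \<noteq> d"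
        unfolding theta_closed_def T using 3(2) by (auto simp: doubleton_eq_iff)
      have s: "({c, d} = {}) = False" "({c, d} = {i}) = False" "({c} = {i}) = (i = c)"
          "({d} = {i}) = (i = d)" "({c} = {}) = False" "({d} = {}) = False"
          "card {c} = 1" "card {d} = 1" using 3(2) by auto
      have a: "Suc n - 2 < n + 2 - 2" "\<not> Suc n - 2 < n - 1" "Suc n - 2 < Suc n - 1" "\<not> (2::nat) \<le> 1"
        using n by auto
      show ?thesis unfolding F unfolding 3(1) cl ball_simps e s
        by (cases "i = c"; cases "i = d"; simp only: if_True if_False a simp_thms)
    next
      case c: 4
      have ne: "(C = {}) = False" "(C = {i}) = False" using c by auto
      have c1: "\<not> card C \<le> 1" "Suc n - card C < n + 2 - card C" using c cC by auto
      have "Suc n - card C < theta_rank T (C - {j})" if "j \<in> C" for j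
      proof -
        have "2 \<le> card (C - {j})" unfolding cd[OF that] using c by linarith
        then have "card (C - {j}) \<noteq> card ({} :: nat set)" "card (C - {j}) \<noteq> card {i}"
          using card.empty[where 'a = nat] is_singletonI[of i, unfolded is_singleton_altdef] by linarith+
        then have ne: "(C - {j} = {}) = False" "(C - {j} = {i}) = False" by metis+
        show ?thesis unfolding r ne if_False cd[OF that] using c cC by linarith
      qed
      then show ?thesis unfolding F ne if_False using 4[OF c] c1 r by simp
    qed
  next
    assume T: "T = N"
    have "T \<noteq> {}" "card T \<noteq> 1" using T n by auto
    then have r: "theta_rank T C' = (if card C' \<le> 1 then n else n + 2 - card C')" for C'
      by (simp add: theta_rank_def)
    have NT: "N - T = {}" using T by simp
    note F = flat_Theta_iff_rank[OF TN C, unfolded r NT]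
    show ?thesis using C_cases
    proof cases
      case 1
      then show ?thesis unfolding F using T by (auto simp: theta_closed_def)
    next
      case (2 c)
      then show ?thesis unfolding F using T other[of c] by (auto simp: theta_closed_def)
    next
      case (3 c d)
      then show ?thesis unfolding F using T by (auto simp: theta_closed_def doubleton_eq_iff)
    next
      case c: 4
      then show ?thesis unfolding F using 4[OF c] cC cd by auto
    qed
  qed
qed

end

section \<open>Hyperplanes and modular triples of the extension\<close>

lemma two_subsets_of_three:
  assumes "card S = 3" "P \<subseteq> S" "Q \<subseteq> S" "card P = 2" "card Q = 2" "P \<noteq> Q"
  obtains i j k where "distinct [i, j, k]" "S = {i, j, k}" "P = {i, j}" "Q = {i, k}"
proof -
  have fin: "finite S" "finite P" "finite Q"
    using assms(1,4,5) by (auto intro: card_ge_0_finite)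
  have "\<not> Q \<subseteq> P" using card_subset_eq[OF fin(2), of Q] assms(4-6) by auto
  then obtain k where k: "k \<in> Q" "k \<notin> P" by blast
  obtain i where i: "Q = {i, k}" "i \<noteq> k"
    using assms(5) k(1) by (auto simp: card_2_iff)
  have "insert k P \<subseteq> S" using assms(2,3) k by blast
  moreover have "card (insert k P) = card S" using k(2) fin assms(1,4) by simp
  ultimately have S: "insert k P = S" using card_subset_eq[OF fin(1)] by blast
  then have "i \<in> P" using i assms(3) by blast
  then obtain j where j: "P = {i, j}" "j \<noteq> i" using assms(4) by (auto simp: card_2_iff)
  show ?thesis by (rule that[of i j k]) (use S i j k in auto)
qed

text \<open>The interface between the matroid hypotheses and all that follows: \<open>line\<close>
  and \<open>separated\<close> express through flats alone that the x_i form a rank-two uniform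
  restriction, and \<open>flat_M\<close> is the parallel connection with the flats of Theta already
  evaluated.\<close>

locale theta_extension = theta_labels n x y
  for n :: nat and x y :: "nat \<Rightarrow> 'e" +
  fixes M\<^sub>1 M :: "'e matroid"
  assumes M1: "matroid M\<^sub>1" and M: "matroid M"
    and x_ground: "x ` {1..n} \<subseteq> ground M\<^sub>1" and y_ground: "y ` {1..n} \<inter> ground M\<^sub>1 = {}"
    and ground_M: "ground M = ground M\<^sub>1 \<union> y ` {1..n}"
    and line: "\<And>F i j. flat M\<^sub>1 F \<Longrightarrow> i \<in> {1..n} \<Longrightarrow> j \<in> {1..n} \<Longrightarrow> i \<noteq> j \<Longrightarrow> x i \<in> F \<Longrightarrow> x j \<in> F
      \<Longrightarrow> x ` {1..n} \<subseteq> F"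
    and separated: "\<And>i j. i \<in> {1..n} \<Longrightarrow> j \<in> {1..n} \<Longrightarrow> i \<noteq> j \<Longrightarrow> \<exists>F. flat M\<^sub>1 F \<and> x i \<in> F \<and> x j \<notin> F"
    and flat_M: "\<And>F. F \<subseteq> ground M \<Longrightarrow> flat M F \<longleftrightarrow>
      flat M\<^sub>1 (F \<inter> ground M\<^sub>1) \<and> theta_closed {i \<in> {1..n}. x i \<in> F} {i \<in> {1..n}. y i \<notin> F}"
begin

section \<open>Flats as pairs of a trace and a set of absent indices\<close>

abbreviation E\<^sub>1 :: "'e set" where "E\<^sub>1 \<equiv> ground M\<^sub>1"

lemma x_E1 [simp]: "i \<in> N \<Longrightarrow> x i \<in> E\<^sub>1"
  using x_ground by auto

lemma y_E1 [simp]: "i \<in> N \<Longrightarrow> y i \<notin> E\<^sub>1"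
  using y_ground by blast

text \<open>The second argument lists the y that are left out, matching \<open>theta_closed\<close>;
  trace and \<open>missing\<close> recover the two components.\<close>

definition glue :: "'e set \<Rightarrow> nat set \<Rightarrow> 'e set" where
  "glue F C = F \<union> y ` (N - C)"

definition missing :: "'e set \<Rightarrow> nat set" where
  "missing F = {i \<in> N. y i \<notin> F}"

definition on_line :: "'e set \<Rightarrow> nat set" where
  "on_line F = {i \<in> N. x i \<in> F}"

lemma mem_on_line: "i \<in> N \<Longrightarrow> x i \<in> F \<longleftrightarrow> i \<in> on_line F"
  by (simp add: on_line_def)

lemma missing_subset: "missing F \<subseteq> N"
  by (auto simp: missing_def)

lemma finite_missing: "finite (missing F)"
  using finite_subset[OF missing_subset] by auto

lemma glue_Int: "F \<subseteq> E\<^sub>1 \<Longrightarrow> glue F C \<inter> E\<^sub>1 = F"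
  by (auto simp: glue_def)

lemma y_in_glue: "F \<subseteq> E\<^sub>1 \<Longrightarrow> i \<in> N \<Longrightarrow> y i \<in> glue F C \<longleftrightarrow> i \<notin> C"
  unfolding glue_def using inj_y by (auto dest: inj_onD)

lemma missing_glue: "F \<subseteq> E\<^sub>1 \<Longrightarrow> C \<subseteq> N \<Longrightarrow> missing (glue F C) = C"
  using y_in_glue unfolding missing_def by blast

lemma on_line_glue: "F \<subseteq> E\<^sub>1 \<Longrightarrow> on_line (glue F C) = on_line F"
  by (auto simp: on_line_def glue_def)

lemma glue_eq: "F \<subseteq> ground M \<Longrightarrow> glue (F \<inter> E\<^sub>1) (missing F) = F"
  using ground_M unfolding glue_def missing_def by auto

lemma glue_subset_ground: "F \<subseteq> E\<^sub>1 \<Longrightarrow> glue F C \<subseteq> ground M"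
  using ground_M by (auto simp: glue_def)

lemma glue_mono: "F \<subseteq> F' \<Longrightarrow> C' \<subseteq> C \<Longrightarrow> glue F C \<subseteq> glue F' C'"
  by (auto simp: glue_def)

lemma glue_ground [simp]: "glue E\<^sub>1 {} = ground M"
  using ground_M by (simp add: glue_def)

lemma E1_subset: "E\<^sub>1 \<subseteq> ground M"
  using ground_M by simp

lemma eq_if_same_trace:
  assumes "A \<subseteq> ground M" "B \<subseteq> ground M" "A \<inter> E\<^sub>1 = B \<inter> E\<^sub>1" "missing A = missing B"
  shows "A = B"
  by (metis assms glue_eq)

lemma missing_Int: "missing (A \<inter> B) = missing A \<union> missing B"
  by (auto simp: missing_def)

lemma missing_mono: "A \<subseteq> B \<Longrightarrow> missing B \<subseteq> missing A"
  by (auto simp: missing_def)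

lemma flat_M_iff:
  "F \<subseteq> ground M \<Longrightarrow> flat M F \<longleftrightarrow> flat M\<^sub>1 (F \<inter> E\<^sub>1) \<and> theta_closed (on_line F) (missing F)"
  using flat_M unfolding on_line_def missing_def by blast

lemma flat_trace: "flat M F \<Longrightarrow> flat M\<^sub>1 (F \<inter> E\<^sub>1)"
  using flat_M_iff flat_subset by blast

lemma flat_glue_iff:
  "F \<subseteq> E\<^sub>1 \<Longrightarrow> C \<subseteq> N \<Longrightarrow> flat M (glue F C) \<longleftrightarrow> flat M\<^sub>1 F \<and> theta_closed (on_line F) C"
  using flat_M_iff[OF glue_subset_ground] by (simp add: glue_Int missing_glue on_line_glue)

text \<open>Three is the least number of absent y that is free of conditions. This is the source of
  the hyperplanes of \<open>M\<close> containing \<open>E\<^sub>1\<close>.\<close>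

lemma theta_closed_large: "3 \<le> card C \<Longrightarrow> theta_closed T C"
proof -
  assume *: "3 \<le> card C"
  have "C \<noteq> {i, j}" for i j using * card_length[of "[i, j]"] by auto
  moreover have "C \<noteq> {}" "C \<noteq> {i}" for i using * by auto
  ultimately show ?thesis by (simp add: theta_closed_def)
qed

lemma flat_glue_large:
  "flat M\<^sub>1 F \<Longrightarrow> C \<subseteq> N \<Longrightarrow> 3 \<le> card C \<Longrightarrow> flat M (glue F C)"
  using flat_glue_iff[OF flat_subset] theta_closed_large by blast

lemma on_line_cases:
  assumes F: "flat M\<^sub>1 F" and i: "i \<in> N" "x i \<in> F"
  shows "on_line F = {i} \<or> on_line F = N"
proof (cases "\<exists>j\<in>N. j \<noteq> i \<and> x j \<in> F")
  case True
  then have "x ` N \<subseteq> F" using line[OF F i(1) _ _ i(2)] by blast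
  then show ?thesis by (auto simp: on_line_def)
qed (use i in \<open>auto simp: on_line_def\<close>)

text \<open>Contracting \<open>Y - {y\<^sub>i, y\<^sub>j}\<close> in \<open>M\<close> gives \<open>M\<^sub>1\<close> with \<open>y\<^sub>i\<close> added parallel to \<open>x\<^sub>j\<close> and
  \<open>y\<^sub>j\<close> added parallel to \<open>x\<^sub>i\<close>; \<open>ext i j F\<close> is the flat of \<open>M\<close> that corresponds to \<open>F\<close>.\<close>

definition ext_missing :: "nat \<Rightarrow> nat \<Rightarrow> 'e set \<Rightarrow> nat set" where
  "ext_missing i j F = (if x j \<in> F then {} else {i}) \<union> (if x i \<in> F then {} else {j})"

definition ext :: "nat \<Rightarrow> nat \<Rightarrow> 'e set \<Rightarrow> 'e set" where
  "ext i j F = glue F (ext_missing i j F)"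

lemma ext_commute: "ext i j F = ext j i F"
  by (simp add: ext_def ext_missing_def Un_commute)

lemma ext_missing_subset: "ext_missing i j F \<subseteq> {i, j}"
  by (auto simp: ext_missing_def)

lemma ext_Int [simp]: "F \<subseteq> E\<^sub>1 \<Longrightarrow> ext i j F \<inter> E\<^sub>1 = F"
  by (simp add: ext_def glue_Int)

lemma missing_ext: "F \<subseteq> E\<^sub>1 \<Longrightarrow> i \<in> N \<Longrightarrow> j \<in> N \<Longrightarrow> missing (ext i j F) = ext_missing i j F"
  unfolding ext_def using missing_glue ext_missing_subset by (metis empty_subsetI insert_subset subset_trans)

lemma ext_mono: "F \<subseteq> G \<Longrightarrow> ext i j F \<subseteq> ext i j G"
  unfolding ext_def by (rule glue_mono) (auto simp: ext_missing_def)

lemma y_in_ext: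
  assumes "F \<subseteq> E\<^sub>1" "k \<in> N"
  shows "y k \<in> ext i j F \<longleftrightarrow> (k = i \<longrightarrow> x j \<in> F) \<and> (k = j \<longrightarrow> x i \<in> F)"
  unfolding ext_def y_in_glue[OF assms] by (auto simp: ext_missing_def)

lemma ext_ground: "i \<in> N \<Longrightarrow> j \<in> N \<Longrightarrow> ext i j E\<^sub>1 = ground M"
  by (simp add: ext_def ext_missing_def)

lemma flat_ext:
  assumes F: "flat M\<^sub>1 F" and ij: "i \<in> N" "j \<in> N" "i \<noteq> j"
  shows "flat M (ext i j F)"
proof -
  have cl: "theta_closed (on_line F) (ext_missing i j F)"
  proof (cases "x i \<in> F")
    case i: True
    show ?thesis
    proof (cases "x j \<in> F")
      case True
      then have "on_line F = N" using line[OF F ij i] unfolding on_line_def by blast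
      then show ?thesis using i True by (simp add: ext_missing_def theta_closed_def)
    next
      case False
      then have "on_line F \<noteq> N" using ij(2) mem_on_line by blast
      then have "on_line F = {i}" using on_line_cases[OF F ij(1) i] by blast
      then show ?thesis using i False by (auto simp: ext_missing_def theta_closed_def)
    qed
  next
    case i: False
    show ?thesis
    proof (cases "x j \<in> F")
      case True
      have "on_line F \<noteq> N" using i ij(1) mem_on_line by blast
      then have "on_line F = {j}" using on_line_cases[OF F ij(2) True] by blast
      then show ?thesis using i True by (auto simp: ext_missing_def theta_closed_def)
    next
      case False
      then show ?thesis using i ij
        by (auto simp: ext_missing_def theta_closed_def on_line_def doubleton_eq_iff)
    qed
  qed
  have "ext_missing i j F \<subseteq> N" using ext_missing_subset[of i j F] ij by blast
  then show ?thesis unfolding ext_def using flat_glue_iff[OF flat_subset[OF F]] F cl by blast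
qed

text \<open>Each of the four possible sets of absent y is tied by \<open>theta_closed\<close> to one
  answer to whether x_i and x_j lie in \<open>F\<close>. Flats above Y - {y_i, y_j} thus correspond
  to flats of \<open>M\<^sub>1\<close>, which is the lattice form of the parallel elements in the
  contraction.\<close>

lemma flat_eq_ext:
  assumes F: "flat M F" and ij: "i \<in> N" "j \<in> N" "i \<noteq> j" and C: "missing F \<subseteq> {i, j}"
  shows "F = ext i j (F \<inter> E\<^sub>1)"
proof -
  have sub: "F \<subseteq> ground M" using flat_subset[OF F] .
  have cl: "theta_closed (on_line F) (missing F)" using F flat_M_iff[OF sub] by blast
  consider "missing F = {}" | "missing F = {i}" | "missing F = {j}" | "missing F = {i, j}"
    using C by blast
  then have "missing F = ext_missing i j (F \<inter> E\<^sub>1)"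
  proof cases
    case 1
    then have "on_line F = N" using cl by (simp add: theta_closed_def)
    then have "x i \<in> F" "x j \<in> F" using ij by (simp_all add: mem_on_line)
    then show ?thesis using 1 ij by (simp add: ext_missing_def)
  next
    case 2
    then have "on_line F = {i}" using cl by (simp add: theta_closed_def)
    then have "x i \<in> F" "x j \<notin> F" using ij by (simp_all add: mem_on_line)
    then show ?thesis using 2 ij by (simp add: ext_missing_def)
  next
    case 3
    then have "on_line F = {j}" using cl by (simp add: theta_closed_def)
    then have "x j \<in> F" "x i \<notin> F" using ij by (simp_all add: mem_on_line)
    then show ?thesis using 3 ij by (simp add: ext_missing_def)
  next
    case 4
    then have "i \<notin> on_line F" "j \<notin> on_line F" using cl ij by (auto simp: theta_closed_def)
    then have "x i \<notin> F" "x j \<notin> F" using ij by (simp_all add: mem_on_line)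
    then show ?thesis using 4 ij by (auto simp: ext_missing_def)
  qed
  then show ?thesis using glue_eq[OF sub] by (simp add: ext_def)
qed

text \<open>Every flat above \<open>ext i j H\<close> lacks no y besides y_i and y_j, so it is again
  an \<open>ext i j\<close> of its trace, and maximality of \<open>H\<close> carries over.\<close>

lemma hyperplane_ext:
  assumes H: "H \<in> hyperplanes M\<^sub>1" and ij: "i \<in> N" "j \<in> N" "i \<noteq> j"
  shows "ext i j H \<in> hyperplanes M"
proof (rule hyperplaneI[OF M flat_ext[OF hyperplane_flat[OF H] ij]])
  have sub: "H \<subseteq> E\<^sub>1" using hyperplane_subset[OF H] .
  show "ext i j H \<noteq> ground M"
    using hyperplane_proper[OF H] ext_Int[OF sub, of i j] E1_subset by (metis Int_absorb1)
  fix G assume G: "flat M G" "ext i j H \<subset> G"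
  have "missing G \<subseteq> {i, j}"
    using missing_mono[of "ext i j H" G] G(2) missing_ext[OF sub ij(1,2)] ext_missing_subset by blast
  then have eq: "G = ext i j (G \<inter> E\<^sub>1)" using flat_eq_ext[OF G(1) ij] by blast
  have "H \<subseteq> G \<inter> E\<^sub>1" using G(2) ext_Int[OF sub, of i j] by blast
  then have "G \<inter> E\<^sub>1 = H \<or> G \<inter> E\<^sub>1 = E\<^sub>1" using hyperplane_maximal[OF M1 H flat_trace[OF G(1)]] by blast
  then show "G = ground M" using eq G(2) ext_ground[OF ij(1,2)] by auto
qed

text \<open>A strictly larger flat contains the whole line and lacks at most two y. With all x_i
  present, \<open>theta_closed\<close> rules out one absent y, because n \<ge> 2, and two absent y
  as well.\<close>

lemma hyperplane_top:
  assumes S: "S \<subseteq> N" "card S = 3"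
  shows "glue E\<^sub>1 S \<in> hyperplanes M"
proof (rule hyperplaneI[OF M flat_glue_large[OF flat_ground S(1)]])
  show "3 \<le> card S" using S by simp
  have "missing (ground M) = {}" using ground_M by (auto simp: missing_def)
  then show "glue E\<^sub>1 S \<noteq> ground M" using missing_glue[OF order_refl S(1)] S(2) by auto
  fix G assume G: "flat M G" "glue E\<^sub>1 S \<subset> G"
  have Gg: "G \<subseteq> ground M" using flat_subset[OF G(1)] .
  have E1: "G \<inter> E\<^sub>1 = E\<^sub>1" using G(2) glue_Int[of E\<^sub>1 S] by blast
  then have on: "on_line G = N" unfolding on_line_def using x_E1 by blast
  have "missing G \<subseteq> S" using missing_mono[of "glue E\<^sub>1 S" G] G(2) missing_glue[OF order_refl S(1)] by blast
  moreover have "missing G \<noteq> S"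
  proof
    assume "missing G = S"
    then show False using glue_eq[OF Gg] E1 G(2) by simp
  qed
  moreover have finS: "finite S" using S(2) card.infinite by fastforce
  ultimately have "card (missing G) < 3" using psubset_card_mono[OF finS] S(2) by (metis psubsetI)
  then consider "card (missing G) = 0" | "card (missing G) = 1" | "card (missing G) = 2" by linarith
  then have "missing G = {}"
  proof cases
    case 1
    then show ?thesis using finite_missing by simp
  next
    case 2
    then obtain i where "missing G = {i}" by (auto simp: card_1_singleton_iff)
    then have "N = {i}" using G(1) flat_M_iff[OF Gg] on by (simp add: theta_closed_def)
    then have "card N = 1" by simp
    then show ?thesis using n by simp
  next
    case 3
    then obtain i j where "missing G = {i, j}" "i \<noteq> j" by (auto simp: card_2_iff)
    then have "i \<notin> N" using G(1) flat_M_iff[OF Gg] on by (simp add: theta_closed_def)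
    then show ?thesis using \<open>missing G = {i, j}\<close> missing_subset by blast
  qed
  then show "G = ground M" using glue_eq[OF Gg] E1 by simp
qed

text \<open>If fewer than two y are absent, the pair is a choice. Hence one hyperplane may be
  written as \<open>ext i j H\<close> in several ways, which later has to be shown harmless.\<close>

lemma pair_containing:
  assumes "C \<subseteq> N" "card C \<le> 2"
  obtains i j where "i \<in> N" "j \<in> N" "i \<noteq> j" "C \<subseteq> {i, j}"
proof -
  have "card N = n" by simp
  then obtain P where P: "C \<subseteq> P" "P \<subseteq> N" "card P = 2"
    using assms n exists_subset_between[of C 2 N] by auto
  then obtain i j where "P = {i, j}" "i \<noteq> j" by (auto simp: card_2_iff)
  then show ?thesis using that P by auto
qed

lemma hyperplane_small:
  assumes H: "H \<in> hyperplanes M" and ij: "i \<in> N" "j \<in> N" "i \<noteq> j" and C: "missing H \<subseteq> {i, j}"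
  shows "H \<inter> E\<^sub>1 \<in> hyperplanes M\<^sub>1" "H = ext i j (H \<inter> E\<^sub>1)"
proof -
  show eq: "H = ext i j (H \<inter> E\<^sub>1)" using flat_eq_ext[OF hyperplane_flat[OF H] ij C] .
  show "H \<inter> E\<^sub>1 \<in> hyperplanes M\<^sub>1"
  proof (rule hyperplaneI[OF M1 flat_trace[OF hyperplane_flat[OF H]]])
    show "H \<inter> E\<^sub>1 \<noteq> E\<^sub>1" using eq ext_ground[OF ij(1,2)] hyperplane_proper[OF H] by metis
    fix F assume F: "flat M\<^sub>1 F" "H \<inter> E\<^sub>1 \<subset> F"
    have Fs: "F \<subseteq> E\<^sub>1" using flat_subset[OF F(1)] .
    have "H \<subseteq> ext i j F" using eq ext_mono[of "H \<inter> E\<^sub>1" F i j] F(2) by blast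
    then have "ext i j F = H \<or> ext i j F = ground M"
      using hyperplane_maximal[OF M H flat_ext[OF F(1) ij]] by blast
    then show "F = E\<^sub>1" using ext_Int[OF Fs, of i j] F(2) E1_subset by blast
  qed
qed

text \<open>If at least three y are absent, the hyperplane lies inside
  \<open>glue E\<^sub>1 S\<close> for three of them, and maximality turns the inclusion into
  equality; otherwise it is an \<open>ext\<close>.\<close>

lemma hyperplane_cases:
  assumes H: "H \<in> hyperplanes M"
  obtains (top) "3 = card (missing H)" "H = glue E\<^sub>1 (missing H)" "H \<inter> E\<^sub>1 = E\<^sub>1"
  | (ext) "card (missing H) \<le> 2" "H \<inter> E\<^sub>1 \<in> hyperplanes M\<^sub>1"
proof (cases "card (missing H) \<le> 2")
  case True
  obtain i j where "i \<in> N" "j \<in> N" "i \<noteq> j" "missing H \<subseteq> {i, j}"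
    using pair_containing[OF missing_subset True] .
  then show ?thesis using hyperplane_small[OF H] True ext by blast
next
  case False
  then obtain S where S: "S \<subseteq> missing H" "card S = 3"
    using obtain_subset_with_card_n[of 3 "missing H"] by auto
  have SN: "S \<subseteq> N" using S missing_subset by blast
  have "H \<subseteq> glue E\<^sub>1 S"
    using glue_mono[of "H \<inter> E\<^sub>1" E\<^sub>1 S "missing H"] S(1)
    unfolding glue_eq[OF hyperplane_subset[OF H]] by blast
  then have eq: "glue E\<^sub>1 S = H"
    using hyperplane_maximal[OF M H hyperplane_flat[OF hyperplane_top[OF SN S(2)]]]
      hyperplane_proper[OF hyperplane_top[OF SN S(2)]] by blast
  then have "missing H = S" using missing_glue[OF order_refl SN] by blast
  moreover have "H \<inter> E\<^sub>1 = E\<^sub>1" using glue_Int[of E\<^sub>1 S] eq by blast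
  ultimately show ?thesis using top eq S(2) by simp
qed

text \<open>Taking traces and applying \<open>ext i j\<close> are inverse, order-preserving maps
  between the flats of \<open>M\<close> above Y - {y_i, y_j} and those of \<open>M\<^sub>1\<close>.
  They transfer covering relations, which is all that \<open>colineI\<close> asks for.\<close>

lemma modular_triple_trace:
  assumes t: "modular_triple M A B D" and ij: "i \<in> N" "j \<in> N" "i \<noteq> j"
    and C: "missing (A \<inter> B) \<subseteq> {i, j}"
  shows "modular_triple M\<^sub>1 (A \<inter> E\<^sub>1) (B \<inter> E\<^sub>1) (D \<inter> E\<^sub>1)"
    "A = ext i j (A \<inter> E\<^sub>1)" "B = ext i j (B \<inter> E\<^sub>1)" "D = ext i j (D \<inter> E\<^sub>1)"
proof -
  obtain L where L: "coline M L" and H: "A \<in> hyperplanes M" "B \<in> hyperplanes M" "D \<in> hyperplanes M"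
    and neq: "A \<noteq> B" "A \<noteq> D" "B \<noteq> D" and I: "A \<inter> B = L" "A \<inter> D = L" "B \<inter> D = L"
    using modular_tripleD[OF M t] .
  have CH: "missing A \<subseteq> {i, j}" "missing B \<subseteq> {i, j}" "missing D \<subseteq> {i, j}"
    using C missing_mono[of "A \<inter> B" A] missing_mono[of "A \<inter> B" B] missing_mono[of "A \<inter> B" D] I
    by auto
  have H1: "A \<inter> E\<^sub>1 \<in> hyperplanes M\<^sub>1" "B \<inter> E\<^sub>1 \<in> hyperplanes M\<^sub>1" "D \<inter> E\<^sub>1 \<in> hyperplanes M\<^sub>1"
    and eq: "A = ext i j (A \<inter> E\<^sub>1)" "B = ext i j (B \<inter> E\<^sub>1)" "D = ext i j (D \<inter> E\<^sub>1)"
    using hyperplane_small[OF H(1) ij CH(1)] hyperplane_small[OF H(2) ij CH(2)]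
      hyperplane_small[OF H(3) ij CH(3)] by blast+
  have Lf: "flat M L" using L by (simp add: coline_def)
  have "missing L \<subseteq> {i, j}" using C I by simp
  then have Leq: "L = ext i j (L \<inter> E\<^sub>1)" by (rule flat_eq_ext[OF Lf ij])
  have "L \<noteq> A" using hyperplane_Int_neq[OF M H(1,2) neq(1)] I by simp
  then have neq1: "A \<inter> E\<^sub>1 \<noteq> B \<inter> E\<^sub>1" "A \<inter> E\<^sub>1 \<noteq> D \<inter> E\<^sub>1" "B \<inter> E\<^sub>1 \<noteq> D \<inter> E\<^sub>1" "L \<inter> E\<^sub>1 \<noteq> A \<inter> E\<^sub>1"
    using eq neq Leq by metis+
  have "coline M\<^sub>1 (L \<inter> E\<^sub>1)"
  proof (rule colineI[OF M1 flat_trace[OF Lf] H1(1)])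
    show "L \<inter> E\<^sub>1 \<subset> A \<inter> E\<^sub>1" using neq1(4) I by blast
    fix F assume F: "flat M\<^sub>1 F" "L \<inter> E\<^sub>1 \<subset> F" "F \<subseteq> A \<inter> E\<^sub>1"
    have Fs: "F \<subseteq> E\<^sub>1" using flat_subset[OF F(1)] .
    have "L \<subseteq> ext i j F" using Leq ext_mono[of "L \<inter> E\<^sub>1" F i j] F(2) by blast
    moreover have "ext i j F \<subseteq> A" using eq(1) ext_mono[OF F(3), of i j] by blast
    ultimately have "ext i j F = L \<or> ext i j F = A"
      using coline_cover[OF M L H(1) flat_ext[OF F(1) ij]] by blast
    then show "F = A \<inter> E\<^sub>1" using ext_Int[OF Fs, of i j] F(2) by blast
  qed
  then show "modular_triple M\<^sub>1 (A \<inter> E\<^sub>1) (B \<inter> E\<^sub>1) (D \<inter> E\<^sub>1)"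
    using modular_tripleI[OF M1 _ H1 neq1(1-3)] I by blast
  show "A = ext i j (A \<inter> E\<^sub>1)" "B = ext i j (B \<inter> E\<^sub>1)" "D = ext i j (D \<inter> E\<^sub>1)" using eq .
qed

text \<open>The same correspondence of flats, used in the opposite direction.\<close>

lemma modular_triple_ext:
  assumes t: "modular_triple M\<^sub>1 A B D" and ij: "i \<in> N" "j \<in> N" "i \<noteq> j"
  shows "modular_triple M (ext i j A) (ext i j B) (ext i j D)"
proof -
  obtain L where L: "coline M\<^sub>1 L" and H: "A \<in> hyperplanes M\<^sub>1" "B \<in> hyperplanes M\<^sub>1" "D \<in> hyperplanes M\<^sub>1"
    and neq: "A \<noteq> B" "A \<noteq> D" "B \<noteq> D" and I: "A \<inter> B = L" "A \<inter> D = L" "B \<inter> D = L"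
    using modular_tripleD[OF M1 t] .
  have sub: "A \<subseteq> E\<^sub>1" "B \<subseteq> E\<^sub>1" "D \<subseteq> E\<^sub>1" "L \<subseteq> E\<^sub>1" using hyperplane_subset H I by blast+
  have Lf: "flat M\<^sub>1 L" using L by (simp add: coline_def)
  have neqe: "ext i j F \<noteq> ext i j G" if "F \<noteq> G" "F \<subseteq> E\<^sub>1" "G \<subseteq> E\<^sub>1" for F G
    using that ext_Int by metis
  have LA: "L \<subset> A" using hyperplane_Int_neq[OF M1 H(1,2) neq(1)] I by simp
  have "coline M (ext i j L)"
  proof (rule colineI[OF M flat_ext[OF Lf ij] hyperplane_ext[OF H(1) ij]])
    show "ext i j L \<subset> ext i j A" using LA ext_mono[of L A i j] neqe[of L A] sub by blast
    fix F assume F: "flat M F" "ext i j L \<subset> F" "F \<subseteq> ext i j A"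
    have "missing F \<subseteq> {i, j}"
      using missing_mono[of "ext i j L" F] F(2) missing_ext[OF sub(4) ij(1,2)] ext_missing_subset by blast
    then have eq: "F = ext i j (F \<inter> E\<^sub>1)" using flat_eq_ext[OF F(1) ij] by blast
    have "L \<subseteq> F \<inter> E\<^sub>1" "F \<inter> E\<^sub>1 \<subseteq> A" using F(2,3) ext_Int sub by blast+
    then have "F \<inter> E\<^sub>1 = L \<or> F \<inter> E\<^sub>1 = A" using coline_cover[OF M1 L H(1) flat_trace[OF F(1)]] by blast
    then show "F = ext i j A" using eq F(2) by auto
  qed
  then show ?thesis
    using modular_tripleI[OF M _ hyperplane_ext[OF H(1) ij] hyperplane_ext[OF H(2) ij] hyperplane_ext[OF H(3) ij]]
      neqe neq sub ext_mono I by (metis inf_le1 inf_le2)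
qed

text \<open>Let C be the set of indices absent from the common coline. If C has at most two
  elements, the triple comes from \<open>M\<^sub>1\<close> through a single pair. Otherwise the
  number of hyperplanes containing \<open>E\<^sub>1\<close> decides: three give four absent y, one
  or none give three absent y and one common trace \<open>H\<close>. The rule is stated for a
  relation closed under permutations, so that one order of each kind suffices.\<close>

lemma modular_triple_cases:
  assumes t: "modular_triple M A B D"
    and rotate: "\<And>A B D. R A B D \<Longrightarrow> R B D A" and swap: "\<And>A B D. R A B D \<Longrightarrow> R B A D"
    and lift: "\<And>i j H\<^sub>1 H\<^sub>2 H\<^sub>3. i \<in> N \<Longrightarrow> j \<in> N \<Longrightarrow> i \<noteq> j \<Longrightarrow> modular_triple M\<^sub>1 H\<^sub>1 H\<^sub>2 H\<^sub>3 \<Longrightarrow>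
      R (ext i j H\<^sub>1) (ext i j H\<^sub>2) (ext i j H\<^sub>3)"
    and mixed: "\<And>i j k H. {i, j, k} \<subseteq> N \<Longrightarrow> distinct [i, j, k] \<Longrightarrow> H \<in> hyperplanes M\<^sub>1 \<Longrightarrow>
      R (glue E\<^sub>1 {i, j, k}) (ext i j H) (ext i k H)"
    and same: "\<And>i j k H. {i, j, k} \<subseteq> N \<Longrightarrow> distinct [i, j, k] \<Longrightarrow> H \<in> hyperplanes M\<^sub>1 \<Longrightarrow>
      \<not> x ` N \<subseteq> H \<Longrightarrow> R (ext i j H) (ext i k H) (ext j k H)"
    and top: "\<And>i j k l. {i, j, k, l} \<subseteq> N \<Longrightarrow> distinct [i, j, k, l] \<Longrightarrow>
      R (glue E\<^sub>1 {j, k, l}) (glue E\<^sub>1 {i, k, l}) (glue E\<^sub>1 {i, j, l})"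
  shows "R A B D"
proof -
  obtain L where L: "coline M L" and H: "A \<in> hyperplanes M" "B \<in> hyperplanes M" "D \<in> hyperplanes M"
    and neq: "A \<noteq> B" "A \<noteq> D" "B \<noteq> D" and I: "A \<inter> B = L" "A \<inter> D = L" "B \<inter> D = L"
    using modular_tripleD[OF M t] .
  let ?C = "missing L"
  have Un: "missing A \<union> missing B = ?C" "missing A \<union> missing D = ?C" "missing B \<union> missing D = ?C"
    using missing_Int I by metis+
  have CN: "?C \<subseteq> N" by (rule missing_subset)
  show ?thesis
  proof (cases "card ?C \<le> 2")
    case True
    obtain i j where ij: "i \<in> N" "j \<in> N" "i \<noteq> j" "?C \<subseteq> {i, j}" using pair_containing[OF CN True] .
    note tr = modular_triple_trace[OF t ij(1-3), unfolded I(1), OF ij(4)]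
    show ?thesis using lift[OF ij(1-3) tr(1)] tr(2-4) by simp
  next
    case False
    then have C3: "3 \<le> card ?C" by simp
    have Lf: "flat M L" using L by (simp add: coline_def)
    have Lg: "L \<subseteq> ground M" using flat_subset[OF Lf] .
    have finC: "finite ?C" by (rule finite_missing)
    \<comment> \<open>Since three absent y impose no condition, deleting the y of index in
      \<open>?C\<close> from \<open>G\<close> leaves a flat between \<open>L\<close> and
      \<open>G\<close>. It differs from \<open>G\<close>, hence it is \<open>L\<close>.\<close>
    have wide: "G \<inter> E\<^sub>1 = L \<inter> E\<^sub>1" if G: "G \<in> hyperplanes M" "L \<subseteq> G" "card (missing G) \<le> 2" for G
    proof -
      have Gs: "G \<inter> E\<^sub>1 \<subseteq> E\<^sub>1" by simp
      let ?G = "glue (G \<inter> E\<^sub>1) ?C"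
      have fl: "flat M ?G" using flat_glue_large[OF flat_trace[OF hyperplane_flat[OF G(1)]] CN C3] .
      have "L \<subseteq> ?G" using glue_mono[of "L \<inter> E\<^sub>1" "G \<inter> E\<^sub>1" ?C ?C] G(2)
        unfolding glue_eq[OF Lg] by blast
      moreover have "?G \<subseteq> G"
        using glue_eq[OF hyperplane_subset[OF G(1)]] glue_mono[OF order_refl missing_mono[OF G(2)]] by metis
      ultimately have "?G = L \<or> ?G = G" using coline_cover[OF M L G(1) fl] by blast
      moreover have "?G \<noteq> G" using missing_glue[OF Gs CN] G(3) C3 by force
      ultimately show ?thesis using glue_Int[OF Gs] by metis
    qed
    \<comment> \<open>Here the intermediate flat keeps the y of \<open>G\<close> and shrinks the
      trace to that of \<open>L\<close>; it must be \<open>L\<close> or \<open>G\<close>.\<close>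
    have narrow: "L \<inter> E\<^sub>1 = E\<^sub>1 \<or> missing G = ?C"
      if G: "G \<in> hyperplanes M" "L \<subseteq> G" "card (missing G) = 3" "G = glue E\<^sub>1 (missing G)" for G
    proof -
      have Ls: "L \<inter> E\<^sub>1 \<subseteq> E\<^sub>1" by simp
      let ?G = "glue (L \<inter> E\<^sub>1) (missing G)"
      have fl: "flat M ?G" using flat_glue_large[OF flat_trace[OF Lf] missing_subset] G(3) by simp
      have "L \<subseteq> ?G" using glue_eq[OF Lg] glue_mono[OF order_refl missing_mono[OF G(2)]] by metis
      moreover have "?G \<subseteq> G" using G(4) glue_mono[OF Ls order_refl] by metis
      ultimately have "?G = L \<or> ?G = G" using coline_cover[OF M L G(1) fl] by blast
      then show ?thesis using missing_glue[OF Ls missing_subset, of G] glue_Int[OF Ls, of "missing G"]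
          G(4) glue_Int[OF order_refl, of "missing G"] by metis
    qed
    have sub: "L \<subseteq> A" "L \<subseteq> B" "L \<subseteq> D" using I by auto
    \<comment> \<open>Two hyperplanes containing \<open>E\<^sub>1\<close> force \<open>L\<close>,
      and so the third one, to contain it. Removing one more y from \<open>A\<close> gives a flat
      between \<open>L\<close> and \<open>A\<close>, hence \<open>L\<close> itself, so exactly four
      y are absent from \<open>L\<close>.\<close>
    have all_top: "R A B D"
      if AB: "card (missing A) = 3" "card (missing B) = 3" "A \<inter> E\<^sub>1 = E\<^sub>1" "B \<inter> E\<^sub>1 = E\<^sub>1"
        "A = glue E\<^sub>1 (missing A)" "B = glue E\<^sub>1 (missing B)"
        and H: "A \<in> hyperplanes M" "B \<in> hyperplanes M" "D \<in> hyperplanes M"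
        and neq: "A \<noteq> B" "A \<noteq> D" "B \<noteq> D" and I: "A \<inter> B = L" "A \<inter> D = L" "B \<inter> D = L" for A B D
    proof -
      have Un: "missing A \<union> missing B = ?C" "missing A \<union> missing D = ?C" "missing B \<union> missing D = ?C"
        using missing_Int I by metis+
      have LE: "L \<inter> E\<^sub>1 = E\<^sub>1" using AB(3,4) I(1) by blast
      have DE: "D \<inter> E\<^sub>1 = E\<^sub>1" using LE I(2) by blast
      have "card (missing D) = 3 \<and> D = glue E\<^sub>1 (missing D)"
        using H(3)
      proof (cases rule: hyperplane_cases)
        case ext
        then show ?thesis using DE hyperplane_proper[OF ext(2)] by simp
      qed simp
      then have D: "card (missing D) = 3" "D = glue E\<^sub>1 (missing D)" by blast+
      have "missing A \<noteq> missing B" "missing A \<noteq> missing D" "missing B \<noteq> missing D"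
        using neq AB D by metis+
      note neqC = this
      have "\<not> missing B \<subseteq> missing A"
        using card_subset_eq[OF finite_missing, of "missing B" A] AB neqC by auto
      then obtain i where i: "i \<in> missing B" "i \<notin> missing A" by blast
      let ?S = "insert i (missing A)"
      have SC: "?S \<subseteq> ?C" using Un i by blast
      have cS: "card ?S = 4" using i AB finite_missing by simp
      have SN: "?S \<subseteq> N" using SC CN by blast
      have fl: "flat M (glue E\<^sub>1 ?S)" using flat_glue_large[OF flat_ground SN] cS by simp
      have "L \<subseteq> glue E\<^sub>1 ?S" using glue_eq[OF Lg] LE glue_mono[OF order_refl SC] by metis
      moreover have "glue E\<^sub>1 ?S \<subseteq> A" using AB(5) glue_mono[OF order_refl, of "missing A" ?S] by blast
      moreover have "glue E\<^sub>1 ?S \<noteq> A" using missing_glue[OF order_refl SN] i(2) by (metis insertI1)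
      ultimately have "glue E\<^sub>1 ?S = L" using coline_cover[OF M L H(1) fl] by blast
      then have CS: "?C = ?S" using missing_glue[OF order_refl SN] by simp
      then have c4: "card ?C = 4" using cS by simp
      have compl: "\<exists>u. u \<in> ?C \<and> Q = ?C - {u}" if Q: "Q \<subseteq> ?C" "card Q = 3" for Q
      proof -
        have "card (?C - Q) = 1" using card_Diff_subset[of Q ?C] Q c4 finite_subset[OF Q(1) finC] by simp
        then obtain u where "?C - Q = {u}" by (auto simp: card_1_singleton_iff)
        then show ?thesis using Q(1) by blast
      qed
      obtain u where u: "u \<in> ?C" "missing A = ?C - {u}" using compl[of "missing A"] AB(1) Un by blast
      obtain v where v: "v \<in> ?C" "missing B = ?C - {v}" using compl[of "missing B"] AB(2) Un by blast
      obtain w where w: "w \<in> ?C" "missing D = ?C - {w}" using compl[of "missing D"] D(1) Un by blast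
      have uvw: "u \<noteq> v" "u \<noteq> w" "v \<noteq> w" using neqC u v w by auto
      have "card (?C - {u, v, w}) = 1" using c4 uvw u v w card_Diff_subset[of "{u, v, w}" ?C] by simp
      then obtain z where z: "?C - {u, v, w} = {z}" by (auto simp: card_1_singleton_iff)
      then have Ceq: "?C = {u, v, w, z}" and zd: "z \<noteq> u" "z \<noteq> v" "z \<noteq> w" using u v w by auto
      have "missing A = {v, w, z}" "missing B = {u, w, z}" "missing D = {u, v, z}"
        unfolding u(2) v(2) w(2) using Ceq uvw zd by auto
      moreover have "R (glue E\<^sub>1 {v, w, z}) (glue E\<^sub>1 {u, w, z}) (glue E\<^sub>1 {u, v, z})"
        by (rule top) (use CN Ceq uvw zd in auto)
      ultimately show ?thesis using AB(5,6) D(2) by simp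
    qed
    have one_top: "R A B D"
      if A: "card (missing A) = 3" "A = glue E\<^sub>1 (missing A)"
        and BD: "card (missing B) \<le> 2" "card (missing D) \<le> 2" "B \<inter> E\<^sub>1 \<in> hyperplanes M\<^sub>1"
        and H: "A \<in> hyperplanes M" "B \<in> hyperplanes M" "D \<in> hyperplanes M"
        and I: "A \<inter> B = L" "A \<inter> D = L" "B \<inter> D = L" for A B D
    proof -
      have sub: "L \<subseteq> A" "L \<subseteq> B" "L \<subseteq> D" using I by auto
      have tr: "B \<inter> E\<^sub>1 = L \<inter> E\<^sub>1" "D \<inter> E\<^sub>1 = L \<inter> E\<^sub>1" using wide H BD sub by blast+
      have "L \<inter> E\<^sub>1 \<noteq> E\<^sub>1" using tr(1) hyperplane_proper[OF BD(3)] by simp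
      then have AC: "missing A = ?C" using narrow[OF H(1) sub(1) A] by blast
      have c3: "card ?C = 3" using AC A(1) by simp
      have BDC: "missing B \<union> missing D = ?C" using missing_Int I by metis
      \<comment> \<open>\<open>B\<close> and \<open>D\<close> may lack fewer than two y if their
        trace meets the line; their absent sets are enlarged to pairs so that both can be written as
        an \<open>ext\<close>.\<close>
      obtain P where P: "missing B \<subseteq> P" "P \<subseteq> ?C" "card P = 2"
        using exists_subset_between[of "missing B" 2 ?C] BD(1) c3 BDC finC by auto
      obtain Q where Q: "missing D \<subseteq> Q" "Q \<subseteq> ?C" "card Q = 2"
        using exists_subset_between[of "missing D" 2 ?C] BD(2) c3 BDC finC by auto
      have "P \<noteq> Q"
      proof
        assume "P = Q"
        then have "?C \<subseteq> P" using BDC P Q by blast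
        then have "card ?C \<le> card P" using P(2) finC by (meson card_mono finite_subset)
        then show False using P(3) c3 by simp
      qed
      then obtain i j k where ijk: "distinct [i, j, k]" "?C = {i, j, k}" "P = {i, j}" "Q = {i, k}"
        using two_subsets_of_three[OF c3 P(2) Q(2) P(3) Q(3)] by metis
      have iN: "i \<in> N" "j \<in> N" "k \<in> N" using CN ijk(2) by auto
      have "B = ext i j (L \<inter> E\<^sub>1)"
        using hyperplane_small(2)[OF H(2) iN(1,2)] ijk P(1) tr by simp
      moreover have "D = ext i k (L \<inter> E\<^sub>1)"
        using hyperplane_small(2)[OF H(3) iN(1,3)] ijk Q(1) tr by simp
      moreover have "A = glue E\<^sub>1 {i, j, k}" using A(2) AC ijk(2) by simp
      moreover have "R (glue E\<^sub>1 {i, j, k}) (ext i j (L \<inter> E\<^sub>1)) (ext i k (L \<inter> E\<^sub>1))"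
        by (rule mixed) (use iN ijk BD(3) tr in auto)
      ultimately show ?thesis by simp
    qed
    have no_top: "R A B D"
      if small: "card (missing A) \<le> 2" "card (missing B) \<le> 2" "card (missing D) \<le> 2"
        and HA: "A \<inter> E\<^sub>1 \<in> hyperplanes M\<^sub>1"
    proof -
      have tr: "A \<inter> E\<^sub>1 = L \<inter> E\<^sub>1" "B \<inter> E\<^sub>1 = L \<inter> E\<^sub>1" "D \<inter> E\<^sub>1 = L \<inter> E\<^sub>1"
        using wide H small sub by blast+
      have g: "A \<subseteq> ground M" "B \<subseteq> ground M" "D \<subseteq> ground M" using hyperplane_subset H by auto
      have neqC: "missing A \<noteq> missing B" "missing A \<noteq> missing D" "missing B \<noteq> missing D"
        using eq_if_same_trace g neq tr by metis+
      \<comment> \<open>Disjoint \<open>P\<close> and \<open>Q\<close> would both lie in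
        \<open>W\<close>, which is too small to contain their union. So they overlap, and counting
        leaves only two pairs in a three-element set.\<close>
      have two: "card P = 2 \<and> card Q = 2 \<and> card ?C = 3"
        if PQ: "card P \<le> 2" "card Q \<le> 2" "card W \<le> 2" "P \<union> Q = ?C" "P \<union> W = ?C" "Q \<union> W = ?C"
          "Q \<noteq> W" "P \<noteq> W" for P Q W
      proof -
        have fin: "finite P" "finite Q" "finite W" using PQ finC by (metis finite_Un)+
        have le: "card ?C + card (P \<inter> Q) = card P + card Q" using card_Un_Int[OF fin(1,2)] PQ(4) by simp
        have "P \<inter> Q \<noteq> {}"
        proof
          assume dis: "P \<inter> Q = {}"
          then have "Q \<subseteq> W" "P \<subseteq> W" using PQ(4-6) by blast+
          then have "?C \<subseteq> W" using PQ(4) by blast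
          then have "card ?C \<le> card W" using fin(3) card_mono by blast
          then show False using PQ(3) C3 by simp
        qed
        then have "card (P \<inter> Q) \<noteq> 0" using fin by simp
        then show ?thesis using le PQ(1,2) C3 by linarith
      qed
      have c: "card (missing A) = 2" "card (missing B) = 2" "card ?C = 3" "card (missing D) = 2"
        using two[OF small Un neqC(3,2)] two[OF small(1,3,2) Un(2,1)] Un(3) neqC by (auto simp: Un_commute)
      have CA: "missing A \<subseteq> ?C" "missing B \<subseteq> ?C" "missing D \<subseteq> ?C" using Un by blast+
      obtain i j k where ijk: "distinct [i, j, k]" "?C = {i, j, k}" "missing A = {i, j}" "missing B = {i, k}"
        using two_subsets_of_three[OF c(3) CA(1,2) c(1,2) neqC(1)] .
      have "{j, k} \<subseteq> missing D" using Un ijk by auto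
      moreover have "card {j, k} = 2" using ijk(1) by simp
      ultimately have D: "missing D = {j, k}" using card_subset_eq[OF finite_missing, of "{j, k}" D] c(4) by simp
      have iN: "i \<in> N" "j \<in> N" "k \<in> N" using CN ijk(2) by auto
      have eq: "A = ext i j (L \<inter> E\<^sub>1)" "B = ext i k (L \<inter> E\<^sub>1)" "D = ext j k (L \<inter> E\<^sub>1)"
        using hyperplane_small(2)[OF H(1) iN(1,2)] hyperplane_small(2)[OF H(2) iN(1,3)]
          hyperplane_small(2)[OF H(3) iN(2,3)] ijk D tr by auto
      have "\<not> x ` N \<subseteq> L \<inter> E\<^sub>1"
      proof
        assume "x ` N \<subseteq> L \<inter> E\<^sub>1"
        then have "ext_missing i j (L \<inter> E\<^sub>1) = {}" using iN by (auto simp: ext_missing_def)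
        then show False using missing_ext[of "L \<inter> E\<^sub>1", OF _ iN(1,2)] eq(1) ijk(3) by auto
      qed
      then have "R (ext i j (L \<inter> E\<^sub>1)) (ext i k (L \<inter> E\<^sub>1)) (ext j k (L \<inter> E\<^sub>1))"
        using same[of i j k "L \<inter> E\<^sub>1"] iN ijk(1) HA tr(1) by simp
      then show ?thesis using eq by simp
    qed
    show ?thesis
      using H(1)
    proof (cases rule: hyperplane_cases)
      case A: top
      show ?thesis using H(2)
      proof (cases rule: hyperplane_cases)
        case B: top
        show ?thesis by (rule all_top) (use A B H neq I in auto)
      next
        case B: ext
        show ?thesis using H(3)
        proof (cases rule: hyperplane_cases)
          case D: top
          have "R A D B" by (rule all_top) (use A D H neq I in auto)
          then show ?thesis using rotate swap by blast
        next
          case D: ext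
          show ?thesis by (rule one_top) (use A B D H I in auto)
        qed
      qed
    next
      case A: ext
      show ?thesis using H(2)
      proof (cases rule: hyperplane_cases)
        case B: top
        show ?thesis using H(3)
        proof (cases rule: hyperplane_cases)
          case D: top
          have "R B D A" by (rule all_top) (use B D H neq I in auto)
          then show ?thesis using rotate swap by blast
        next
          case D: ext
          have "R B A D" by (rule one_top) (use A B D H I in auto)
          then show ?thesis using rotate swap by blast
        qed
      next
        case B: ext
        show ?thesis using H(3)
        proof (cases rule: hyperplane_cases)
          case D: top
          have "R D A B" by (rule one_top) (use A B D H I in auto)
          then show ?thesis using rotate swap by blast
        next
          case D: ext
          show ?thesis by (rule no_top) (use A B D in auto)
        qed
      qed
    qed
  qed
qed

end

section \<open>The trace of a representation\<close>

context pasture_struct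
begin

lemma mult_inv_cancel: "a \<in> Units P \<Longrightarrow> b \<in> carrier P \<Longrightarrow> a \<otimes> (inv a \<otimes> b) = b"
  "a \<in> Units P \<Longrightarrow> b \<in> carrier P \<Longrightarrow> inv a \<otimes> (a \<otimes> b) = b"
  by (simp_all add: m_assoc[symmetric] Units_closed)

lemma inv_mult_Units:
  assumes "a \<in> Units P" "b \<in> Units P"
  shows "inv (a \<otimes> b) = inv a \<otimes> inv b"
proof -
  have "(a \<otimes> b) \<otimes> (inv a \<otimes> inv b) = (a \<otimes> inv a) \<otimes> (b \<otimes> inv b)"
    using assms by (simp only: m_ac Units_closed Units_inv_closed m_closed)
  also have "\<dots> = \<one>" using assms by simp
  also have "\<dots> = (a \<otimes> b) \<otimes> inv (a \<otimes> b)" using assms by (intro Units_r_inv[symmetric] Units_m_closed)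
  finally have eq: "(a \<otimes> b) \<otimes> (inv a \<otimes> inv b) = (a \<otimes> b) \<otimes> inv (a \<otimes> b)" .
  have U: "a \<otimes> b \<in> Units P" using assms by (rule Units_m_closed)
  show ?thesis
    by (rule cancel_left[OF U eq[symmetric]]) (use assms U in \<open>simp_all add: Units_closed\<close>)
qed

text \<open>The identity of \<open>rep_ratio\<close> holds for both representations and passes to
  their quotient. Two representations are rescalings of each other when this quotient splits into a
  row factor and a column factor, and the identity is the test for such a splitting.\<close>

lemma rep_quotient_ratio:
  assumes N: "matroid N" and f: "f \<in> representations N P" "f' \<in> representations N P"
    and K: "e \<in> ground N" "z \<in> ground N" "\<And>F. flat N F \<Longrightarrow> K \<subseteq> F \<Longrightarrow> z \<in> F \<longleftrightarrow> e \<in> F"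
    and H: "H \<in> hyperplanes N" "H' \<in> hyperplanes N" "K \<subseteq> H" "K \<subseteq> H'" "e \<notin> H" "e \<notin> H'"
  defines "q \<equiv> \<lambda>H e. f' H e \<otimes> inv (f H e)"
  shows "q H e \<otimes> q H' z = q H' e \<otimes> q H z"
proof -
  have z: "z \<notin> H" "z \<notin> H'" using K(3) hyperplane_flat H by blast+
  have U: "f H e \<in> Units P" "f H z \<in> Units P" "f H' e \<in> Units P" "f H' z \<in> Units P"
    "f' H e \<in> Units P" "f' H z \<in> Units P" "f' H' e \<in> Units P" "f' H' z \<in> Units P"
    using rep_Units[OF f(1)] rep_Units[OF f(2)] H K(1,2) z by auto
  note U = U U[THEN Units_closed]
  have r: "f H e \<otimes> f H' z = f H' e \<otimes> f H z" "f' H e \<otimes> f' H' z = f' H' e \<otimes> f' H z"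
    by (rule rep_ratio[OF N f(1) K(1,2) _ H]; rule K(3); assumption)
      (rule rep_ratio[OF N f(2) K(1,2) _ H]; rule K(3); assumption)
  have "q H e \<otimes> q H' z = (f' H e \<otimes> f' H' z) \<otimes> inv (f H e \<otimes> f H' z)"
    unfolding q_def using U by (simp add: inv_mult_Units m_ac)
  also have "\<dots> = (f' H' e \<otimes> f' H z) \<otimes> inv (f H' e \<otimes> f H z)" by (simp only: r)
  also have "\<dots> = q H' e \<otimes> q H z"
    unfolding q_def using U by (simp add: inv_mult_Units m_ac)
  finally show ?thesis .
qed

end

context theta_extension
begin

lemma one_two: "1 \<in> N" "2 \<in> N" "(1::nat) \<noteq> 2"
  using n by auto

text \<open>The pair 1, 2 is a fixed choice, available since n \<ge> 2. The restrictions make the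
  result extensional, so that surjectivity can be an equation of functions.\<close>

definition trace_rep :: "('e set \<Rightarrow> 'e \<Rightarrow> 'p) \<Rightarrow> 'e set \<Rightarrow> 'e \<Rightarrow> 'p" where
  "trace_rep f = (\<lambda>H\<in>hyperplanes M\<^sub>1. \<lambda>e\<in>E\<^sub>1. f (ext 1 2 H) e)"

lemma trace_rep_apply [simp]:
  "H \<in> hyperplanes M\<^sub>1 \<Longrightarrow> e \<in> E\<^sub>1 \<Longrightarrow> trace_rep f H e = f (ext 1 2 H) e"
  by (simp add: trace_rep_def)

text \<open>Naturality holds on the nose rather than up to rescaling: both sides only select values
  of \<open>f\<close> and apply \<open>\<phi>\<close>.\<close>

lemma push_forward_trace_rep:
  "push_forward M\<^sub>1 \<phi> (trace_rep f) = trace_rep (push_forward M \<phi> f)"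
  unfolding push_forward_def trace_rep_def
  by (intro ext restrict_ext) (use hyperplane_ext[OF _ one_two] E1_subset in \<open>auto simp: restrict_def\<close>)

text \<open>A hyperplane through x_i that avoids one other point of the line contains no further
  point of it. These hyperplanes serve as references both for the column factors of the y_i and for
  the brackets.\<close>

lemma hyperplane_through_point:
  assumes "i \<in> N"
  obtains H where "H \<in> hyperplanes M\<^sub>1" "on_line H = {i}"
proof -
  obtain j where j: "j \<in> N" "i \<noteq> j" using one_two assms by metis
  obtain F where F: "flat M\<^sub>1 F" "x i \<in> F" "x j \<notin> F" using separated[OF assms j] by blast
  obtain H where H: "H \<in> hyperplanes M\<^sub>1" "F \<subseteq> H" "x j \<notin> H"
    using hyperplane_avoiding[OF M1 F(1) x_E1[OF j(1)] F(3)] .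
  have "on_line H = {i} \<or> on_line H = N"
    using on_line_cases[OF hyperplane_flat[OF H(1)] assms] F(2) H(2) by blast
  moreover have "on_line H \<noteq> N" using H(3) j(1) mem_on_line by blast
  ultimately show ?thesis using that H(1) by blast
qed

lemma not_in_if_on_line: "on_line H = {i} \<Longrightarrow> j \<in> N \<Longrightarrow> j \<noteq> i \<Longrightarrow> x j \<notin> H"
  by (simp add: mem_on_line)

end

locale theta_representation = theta_extension n x y M\<^sub>1 M + pasture_struct P
  for n :: nat and x y :: "nat \<Rightarrow> 'e" and M\<^sub>1 M :: "'e matroid" and P :: "'p pasture" (structure)
begin

lemma trace_rep_representations:
  assumes f: "f \<in> representations M P"
  shows "trace_rep f \<in> representations M\<^sub>1 P"
  unfolding representations_iff
proof (intro conjI ballI allI impI)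
  note hyp = hyperplane_ext[OF _ one_two]
  show "trace_rep f \<in> hyperplanes M\<^sub>1 \<rightarrow>\<^sub>E (E\<^sub>1 \<rightarrow>\<^sub>E carrier P)"
    unfolding trace_rep_def using rep_closed[OF f hyp] E1_subset by (intro restrict_PiE_iff[THEN iffD2] ballI) auto
  fix H e assume H: "H \<in> hyperplanes M\<^sub>1" "e \<in> E\<^sub>1"
  have "e \<in> ext 1 2 H \<longleftrightarrow> e \<in> H" using ext_Int[OF hyperplane_subset[OF H(1)], of 1 2] H(2) by blast
  then show "trace_rep f H e = \<zero> \<longleftrightarrow> e \<in> H"
    using rep_zero[OF f hyp[OF H(1)]] H E1_subset by auto
next
  fix H\<^sub>1 H\<^sub>2 H\<^sub>3 assume t: "modular_triple M\<^sub>1 H\<^sub>1 H\<^sub>2 H\<^sub>3"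
  then have H: "H\<^sub>1 \<in> hyperplanes M\<^sub>1" "H\<^sub>2 \<in> hyperplanes M\<^sub>1" "H\<^sub>3 \<in> hyperplanes M\<^sub>1"
    by (auto simp: modular_triple_def)
  have "dependent (ground M) (f (ext 1 2 H\<^sub>1)) (f (ext 1 2 H\<^sub>2)) (f (ext 1 2 H\<^sub>3))"
    using rep_triple[OF f modular_triple_ext[OF t one_two]] .
  then show "dependent E\<^sub>1 (trace_rep f H\<^sub>1) (trace_rep f H\<^sub>2) (trace_rep f H\<^sub>3)"
    by (rule dependent_cong[OF _ E1_subset]) (use H in simp_all)
qed

lemma flat_above_trace:
  assumes H: "H \<in> hyperplanes M\<^sub>1" and F: "flat M F" "H \<subseteq> F" and e: "e \<in> E\<^sub>1 - H" "z \<in> E\<^sub>1 - H"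
  shows "z \<in> F \<longleftrightarrow> e \<in> F"
proof -
  have "H \<subseteq> F \<inter> E\<^sub>1" using F(2) hyperplane_subset[OF H] by blast
  then have "F \<inter> E\<^sub>1 = H \<or> F \<inter> E\<^sub>1 = E\<^sub>1" using hyperplane_maximal[OF M1 H flat_trace[OF F(1)]] by blast
  then show ?thesis using e by blast
qed

lemma flat_above_pair:
  assumes F: "flat M F" "y ` (N - {i, j}) \<subseteq> F" and ij: "i \<in> N" "j \<in> N" "i \<noteq> j"
  shows "y i \<in> F \<longleftrightarrow> x j \<in> F"
proof -
  have "missing F \<subseteq> {i, j}" using F(2) unfolding missing_def by blast
  then have "F = ext i j (F \<inter> E\<^sub>1)" using flat_eq_ext[OF F(1) ij] by blast
  then have "y i \<in> F \<longleftrightarrow> x j \<in> F \<inter> E\<^sub>1" using y_in_ext[of "F \<inter> E\<^sub>1" i i j] ij by auto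
  then show ?thesis using ij by simp
qed

text \<open>The only indices that can be absent are i, j, k, and x_k is present;
  \<open>theta_closed\<close> then excludes the absent sets {i}, {j}, {i, k} and {j, k}. Each
  remaining set contains both of i and j or neither.\<close>

lemma flat_above_triple:
  assumes F: "flat M F" "insert (x k) (y ` (N - {i, j, k})) \<subseteq> F"
    and ijk: "i \<in> N" "j \<in> N" "k \<in> N" "distinct [i, j, k]"
  shows "y j \<in> F \<longleftrightarrow> y i \<in> F"
proof -
  have k: "k \<in> on_line F" using F(2) ijk(3) mem_on_line by blast
  have C: "missing F \<subseteq> {i, j, k}" using F(2) unfolding missing_def by blast
  have cl: "theta_closed (on_line F) (missing F)" using F(1) flat_M_iff[OF flat_subset[OF F(1)]] by blast
  have no: "missing F \<noteq> {l}" "missing F \<noteq> {l, k}" if "l \<noteq> k" for l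
    using cl k that unfolding theta_closed_def by blast+
  have ne: "i \<noteq> k" "j \<noteq> k" using ijk(4) by auto
  have m: "y i \<in> F \<longleftrightarrow> i \<notin> missing F" "y j \<in> F \<longleftrightarrow> j \<notin> missing F"
    using ijk(1,2) by (auto simp: missing_def)
  show ?thesis unfolding m using C no[OF ne(1)] no[OF ne(2)] by blast
qed

text \<open>All comparisons below are instances of the ratio lemma: over \<open>K = H\<close> inside \<open>E\<^sub>1\<close>, over
  \<open>K = Y - {y\<^sub>i, y\<^sub>j}\<close>, where \<open>y\<^sub>i\<close> becomes parallel to \<open>x\<^sub>j\<close>, and over
  \<open>K = {x\<^sub>k} \<union> (Y - {y\<^sub>i, y\<^sub>j, y\<^sub>k})\<close>, where \<open>y\<^sub>i\<close> becomes parallel to \<open>y\<^sub>j\<close>.\<close>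

lemma rescaling_if_trace:
  assumes f: "f \<in> representations M P" "f' \<in> representations M P"
    and tr: "(trace_rep f, trace_rep f') \<in> rescaling M\<^sub>1 P"
  shows "(f, f') \<in> rescaling M P"
proof -
  obtain c d where c: "c \<in> hyperplanes M\<^sub>1 \<rightarrow> Units P" and d: "d \<in> E\<^sub>1 \<rightarrow> Units P"
    and cd: "\<And>H e. H \<in> hyperplanes M\<^sub>1 \<Longrightarrow> e \<in> E\<^sub>1 \<Longrightarrow> f' (ext 1 2 H) e = c H \<otimes> d e \<otimes> f (ext 1 2 H) e"
    using tr unfolding rescaling_def by auto
  have dU: "d e \<in> Units P" if "e \<in> E\<^sub>1" for e using d that by blast
  have cU: "c H \<in> Units P" if "H \<in> hyperplanes M\<^sub>1" for H using c that by blast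
  \<comment> \<open>The aim is a splitting \<open>q A e = w A \<otimes> dM e\<close> for every
    hyperplane \<open>A\<close> and every \<open>e\<close> outside it; the values inside
    \<open>A\<close> are zero on both sides.\<close>
  define q where "q G e = f' G e \<otimes> inv (f G e)" for G e
  have fU: "f G e \<in> Units P" "f' G e \<in> Units P" "q G e \<in> Units P"
    if "G \<in> hyperplanes M" "e \<in> ground M" "e \<notin> G" for G e
    using rep_Units[OF f(1) that(1,2)] rep_Units[OF f(2) that(1,2)] that(3) unfolding q_def by auto
  have ratio: "q H e \<otimes> q H' z = q H' e \<otimes> q H z"
    if "e \<in> ground M" "z \<in> ground M" "\<And>F. flat M F \<Longrightarrow> K \<subseteq> F \<Longrightarrow> z \<in> F \<longleftrightarrow> e \<in> F"
      "H \<in> hyperplanes M" "H' \<in> hyperplanes M" "K \<subseteq> H" "K \<subseteq> H'" "e \<notin> H" "e \<notin> H'" for H H' K e z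
    unfolding q_def
    by (rule rep_quotient_ratio[OF M f that(1,2) _ that(4-9)]; rule that(3); assumption)
  have in_ext: "e \<in> ext i j H \<longleftrightarrow> e \<in> H" if "H \<in> hyperplanes M\<^sub>1" "e \<in> E\<^sub>1" for i j H e
    using ext_Int[OF hyperplane_subset[OF that(1)], of i j] that(2) by blast
  have qc: "q (ext 1 2 H) e = c H \<otimes> d e" if H: "H \<in> hyperplanes M\<^sub>1" "e \<in> E\<^sub>1 - H" for H e
  proof -
    have U: "f (ext 1 2 H) e \<in> Units P" using fU hyperplane_ext[OF H(1) one_two] in_ext H E1_subset by blast
    have "c H \<otimes> d e \<in> carrier P" using cU[OF H(1)] dU H(2) by (auto simp: Units_closed)
    then show ?thesis unfolding q_def using cd[OF H(1)] H(2) U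
      by (simp add: m_assoc Units_closed)
  qed
  \<comment> \<open>Over \<open>K = H\<close> all columns in \<open>E\<^sub>1 - H\<close> are
    parallel, so \<open>ext i j H\<close> has the same column factors there as
    \<open>ext 1 2 H\<close>, up to one row factor.\<close>
  have step1: "\<exists>c\<in>Units P. \<forall>e\<in>E\<^sub>1 - H. q (ext i j H) e = c \<otimes> d e"
    if H: "H \<in> hyperplanes M\<^sub>1" and ij: "i \<in> N" "j \<in> N" "i \<noteq> j" for H i j
  proof -
    obtain z where z: "z \<in> E\<^sub>1 - H" using hyperplane_proper[OF H] hyperplane_subset[OF H] by blast
    let ?c = "q (ext i j H) z \<otimes> inv (d z)"
    have hyps: "ext i j H \<in> hyperplanes M" "ext 1 2 H \<in> hyperplanes M"
      using hyperplane_ext[OF H ij] hyperplane_ext[OF H one_two] .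
    have Hs: "H \<subseteq> ext i j H" "H \<subseteq> ext 1 2 H" unfolding ext_def glue_def by auto
    have U: "q (ext i j H) e \<in> Units P" if "e \<in> E\<^sub>1 - H" for e
      using fU(3)[OF hyps(1)] in_ext[OF H] that E1_subset by blast
    have "q (ext i j H) e = ?c \<otimes> d e" if e: "e \<in> E\<^sub>1 - H" for e
    proof -
      have "q (ext i j H) e \<otimes> q (ext 1 2 H) z = q (ext 1 2 H) e \<otimes> q (ext i j H) z"
        by (rule ratio[OF _ _ _ _ _ Hs])
          (use e z E1_subset hyps in_ext[OF H] flat_above_trace[OF H _ _ e z] in blast)+
      then have "q (ext i j H) e \<otimes> (c H \<otimes> d z) = (c H \<otimes> d e) \<otimes> q (ext i j H) z"
        using qc[OF H] e z by simp
      moreover have V: "q (ext i j H) e \<in> carrier P" "q (ext i j H) z \<in> carrier P"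
        "c H \<in> Units P" "c H \<in> carrier P" "d e \<in> carrier P" "d z \<in> carrier P" "d z \<in> Units P"
        using U[OF e] U[OF z] cU[OF H] dU e z by (auto simp: Units_closed)
      ultimately have "c H \<otimes> (d z \<otimes> q (ext i j H) e) = c H \<otimes> (d e \<otimes> q (ext i j H) z)"
        by (simp add: m_ac)
      then have *: "d z \<otimes> q (ext i j H) e = d e \<otimes> q (ext i j H) z"
        by (rule cancel_left[OF V(3)]) (use V in simp_all)
      have "d z \<otimes> (?c \<otimes> d e) = inv (d z) \<otimes> (d z \<otimes> (d e \<otimes> q (ext i j H) z))"
        using V by (simp add: m_ac)
      also have "\<dots> = d e \<otimes> q (ext i j H) z" using V by (simp add: mult_inv_cancel)
      finally have "d z \<otimes> q (ext i j H) e = d z \<otimes> (?c \<otimes> d e)" using * by simp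
      then show ?thesis by (rule cancel_left[OF V(7)]) (use V in simp_all)
    qed
    moreover have "?c \<in> Units P" using U[OF z] dU z by auto
    ultimately show ?thesis by blast
  qed
  obtain Hp where Hp: "\<And>i. i \<in> N \<Longrightarrow> Hp i \<in> hyperplanes M\<^sub>1" "\<And>i. i \<in> N \<Longrightarrow> on_line (Hp i) = {i}"
  proof -
    have "\<exists>H. H \<in> hyperplanes M\<^sub>1 \<and> on_line H = {i}" if "i \<in> N" for i
      using hyperplane_through_point[OF that] by metis
    then show ?thesis using that by metis
  qed
  have ext_Hp: "ext i j (Hp i) = glue (Hp i) {i}" if "i \<in> N" "j \<in> N" "i \<noteq> j" for i j
  proof -
    have "x i \<in> Hp i" "x j \<notin> Hp i" using Hp(2)[OF that(1)] that mem_on_line by auto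
    then show ?thesis by (simp add: ext_def ext_missing_def)
  qed
  \<comment> \<open>\<open>G i\<close> equals \<open>ext i j (Hp i)\<close> for every
    \<open>j\<close> other than \<open>i\<close>. One reference hyperplane therefore defines the
    factor of y_i and serves all pairs containing \<open>i\<close>.\<close>
  define G where "G i = glue (Hp i) {i}" for i
  have "\<exists>u\<in>Units P. \<forall>e\<in>E\<^sub>1 - Hp i. q (G i) e = u \<otimes> d e" if i: "i \<in> N" for i
  proof -
    obtain j where "j \<in> N" "i \<noteq> j" using one_two i by metis
    then show ?thesis using step1[OF Hp(1)[OF i] i] ext_Hp[OF i] by (simp add: G_def)
  qed
  then obtain u where u: "\<And>i. i \<in> N \<Longrightarrow> u i \<in> Units P"
      "\<And>i e. i \<in> N \<Longrightarrow> e \<in> E\<^sub>1 - Hp i \<Longrightarrow> q (G i) e = u i \<otimes> d e"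
    by metis
  define dy where "dy i = q (G i) (y i) \<otimes> inv (u i)" for i
  have Ghyp: "G i \<in> hyperplanes M" if i: "i \<in> N" for i
  proof -
    obtain j where "j \<in> N" "i \<noteq> j" using one_two i by metis
    then show ?thesis using hyperplane_ext[OF Hp(1)[OF i] i, of j] ext_Hp[OF i, of j] by (simp add: G_def)
  qed
  have yg: "y i \<in> ground M" if "i \<in> N" for i using that ground_M by auto
  have yG: "y i \<notin> G i" if i: "i \<in> N" for i
    unfolding G_def using y_in_glue[OF hyperplane_subset[OF Hp(1)[OF i]] i] by simp
  have dyU: "dy i \<in> Units P" if i: "i \<in> N" for i
    unfolding dy_def using fU(3)[OF Ghyp[OF i] yg[OF i] yG[OF i]] u(1)[OF i] by auto
  have qG: "q (G i) (y i) = u i \<otimes> dy i" if i: "i \<in> N" for i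
  proof -
    have "u i \<otimes> dy i = u i \<otimes> (inv (u i) \<otimes> q (G i) (y i))"
      unfolding dy_def using u(1)[OF i] fU(3)[OF Ghyp[OF i] yg[OF i] yG[OF i]] by (simp add: m_ac Units_closed)
    then show ?thesis
      using u(1)[OF i] fU(3)[OF Ghyp[OF i] yg[OF i] yG[OF i]] by (simp add: mult_inv_cancel Units_closed)
  qed
  \<comment> \<open>Over Y - {y_i, y_j} the columns x_j and y_i are parallel; comparison with
    \<open>G i\<close> carries the known factor of x_j over to y_i.\<close>
  have step2: "q (ext i j H) (y i) = w \<otimes> dy i"
    if H: "H \<in> hyperplanes M\<^sub>1" and ij: "i \<in> N" "j \<in> N" "i \<noteq> j" and xj: "x j \<notin> H"
      and w: "w \<in> Units P" "\<And>e. e \<in> E\<^sub>1 - H \<Longrightarrow> q (ext i j H) e = w \<otimes> d e" for H i j w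
  proof -
    have Hs: "H \<subseteq> E\<^sub>1" "Hp i \<subseteq> E\<^sub>1" using hyperplane_subset H Hp(1)[OF ij(1)] by auto
    have yi: "y i \<notin> ext i j H" using y_in_ext[OF Hs(1) ij(1)] xj by blast
    have xjH: "x j \<notin> ext i j H" using in_ext[OF H x_E1[OF ij(2)]] xj by simp
    have xjp: "x j \<notin> Hp i" by (rule not_in_if_on_line[OF Hp(2)[OF ij(1)] ij(2)]) (use ij in simp)
    have xjG: "x j \<notin> G i" using in_ext[OF Hp(1)[OF ij(1)] x_E1[OF ij(2)], of i j] ext_Hp[OF ij] xjp
      by (simp add: G_def)
    have K: "y ` (N - {i, j}) \<subseteq> ext i j H" "y ` (N - {i, j}) \<subseteq> G i"
      using y_in_ext[OF Hs(1)] by (auto simp: G_def glue_def)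
    have "q (ext i j H) (x j) \<otimes> q (G i) (y i) = q (G i) (x j) \<otimes> q (ext i j H) (y i)"
      by (rule ratio[OF _ _ _ _ _ K])
        (use hyperplane_ext[OF H ij] Ghyp ij yg xjH xjG flat_above_pair[OF _ _ ij] E1_subset x_E1[OF ij(2)] in blast)+
    then have "(w \<otimes> d (x j)) \<otimes> (u i \<otimes> dy i) = (u i \<otimes> d (x j)) \<otimes> q (ext i j H) (y i)"
      using w(2)[of "x j"] u(2)[OF ij(1), of "x j"] qG[OF ij(1)] xj xjp x_E1[OF ij(2)] by simp
    moreover have V: "w \<in> carrier P" "d (x j) \<in> carrier P" "u i \<in> carrier P" "dy i \<in> carrier P"
      "q (ext i j H) (y i) \<in> carrier P"
      using w(1) dU[OF x_E1[OF ij(2)]] u(1)[OF ij(1)] dyU[OF ij(1)]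
        fU(3)[OF hyperplane_ext[OF H ij] yg[OF ij(1)] yi] by (auto simp: Units_closed)
    ultimately have eq: "(u i \<otimes> d (x j)) \<otimes> q (ext i j H) (y i) = (u i \<otimes> d (x j)) \<otimes> (w \<otimes> dy i)"
      by (simp add: m_ac)
    have U: "u i \<otimes> d (x j) \<in> Units P" using u(1)[OF ij(1)] dU[OF x_E1[OF ij(2)]] by auto
    show ?thesis by (rule cancel_left[OF U eq]) (use V in simp_all)
  qed
  define dM where "dM e = (if e \<in> E\<^sub>1 then d e else dy (inv_into N y e))" for e
  have dMy: "dM (y i) = dy i" if "i \<in> N" for i
    using that inv_into_f_f[OF inj_y that] by (simp add: dM_def)
  have dMU: "dM e \<in> Units P" if "e \<in> ground M" for e
    using that dMy dyU dU ground_M unfolding dM_def by (auto simp: inv_into_into)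
  have ext_ok: "\<exists>w\<in>Units P. \<forall>e\<in>ground M - ext i j H. q (ext i j H) e = w \<otimes> dM e"
    if H: "H \<in> hyperplanes M\<^sub>1" and ij: "i \<in> N" "j \<in> N" "i \<noteq> j" for H i j
  proof -
    have Hs: "H \<subseteq> E\<^sub>1" using hyperplane_subset[OF H] .
    obtain w where w: "w \<in> Units P" "\<And>e. e \<in> E\<^sub>1 - H \<Longrightarrow> q (ext i j H) e = w \<otimes> d e"
      using step1[OF H ij] by blast
    have "q (ext i j H) e = w \<otimes> dM e" if e: "e \<in> ground M" "e \<notin> ext i j H" for e
    proof (cases "e \<in> E\<^sub>1")
      case True
      then show ?thesis using w(2)[of e] in_ext[OF H True] e(2) by (simp add: dM_def)
    next
      case False
      then obtain k where k: "k \<in> N" "e = y k" using e(1) ground_M by auto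
      consider "k = i" "x j \<notin> H" | "k = j" "x i \<notin> H" using y_in_ext[OF Hs k(1), of i j] e(2) k(2) by blast
      then show ?thesis
      proof cases
        case 1
        then show ?thesis using step2[OF H ij _ w] dMy k by simp
      next
        case 2
        have "q (ext j i H) (y j) = w \<otimes> dy j"
          by (rule step2[OF H ij(2,1) _ 2(2) w(1)]) (use ij w(2) ext_commute[of j i] in auto)
        then show ?thesis using 2 dMy k ext_commute[of j i] by simp
      qed
    qed
    then show ?thesis using w(1) by blast
  qed
  have top_ok: "\<exists>w\<in>Units P. \<forall>e\<in>ground M - glue E\<^sub>1 S. q (glue E\<^sub>1 S) e = w \<otimes> dM e"
    if S: "S \<subseteq> N" "card S = 3" for S
  proof -
    let ?T = "glue E\<^sub>1 S"
    have hT: "?T \<in> hyperplanes M" using hyperplane_top[OF S] .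
    have yT: "y i \<notin> ?T" if "i \<in> S" for i using y_in_glue[of E\<^sub>1 i S] that S by auto
    have UT: "q ?T (y i) \<in> Units P" if "i \<in> S" for i using fU(3)[OF hT yg yT] that S by auto
    \<comment> \<open>With \<open>k\<close> the third index, \<open>ext i j (Hp k)\<close> contains
      x_k, avoids both y_i and y_j, and already has a known splitting; the columns y_i and y_j are
      compared against it.\<close>
    have pair: "q ?T (y i) \<otimes> dy j = dy i \<otimes> q ?T (y j)" if ij: "i \<in> S" "j \<in> S" "i \<noteq> j" for i j
    proof -
      have "\<not> S \<subseteq> {i, j}"
      proof
        assume "S \<subseteq> {i, j}"
        then have "card S \<le> card {i, j}" by (intro card_mono) auto
        then show False using S(2) ij(3) by simp
      qed
      then obtain k where k: "k \<in> S" "k \<noteq> i" "k \<noteq> j" by blast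
      have fS: "finite S" using S(2) card.infinite by fastforce
      have Seq: "{i, j, k} = S" using ij k S(2) by (intro card_subset_eq[OF fS]) auto
      have iN: "i \<in> N" "j \<in> N" "k \<in> N" using ij k S(1) by auto
      let ?H = "ext i j (Hp k)"
      have Hk: "Hp k \<subseteq> E\<^sub>1" "Hp k \<in> hyperplanes M\<^sub>1" using Hp(1)[OF iN(3)] hyperplane_subset by auto
      have hH: "?H \<in> hyperplanes M" using hyperplane_ext[OF Hk(2) iN(1,2) ij(3)] .
      have xx: "x i \<notin> Hp k" "x j \<notin> Hp k" "x k \<in> Hp k"
        using not_in_if_on_line[OF Hp(2)[OF iN(3)]] iN k mem_on_line[OF iN(3), of "Hp k"] Hp(2)[OF iN(3)] by auto
      have yH: "y i \<notin> ?H" "y j \<notin> ?H" using y_in_ext[OF Hk(1)] iN xx by blast+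
      obtain w where w: "w \<in> Units P" "\<And>e. e \<in> ground M - ?H \<Longrightarrow> q ?H e = w \<otimes> dM e"
        using ext_ok[OF Hk(2) iN(1,2) ij(3)] by blast
      have K: "insert (x k) (y ` (N - {i, j, k})) \<subseteq> ?T" "insert (x k) (y ` (N - {i, j, k})) \<subseteq> ?H"
        using iN Seq xx y_in_ext[OF Hk(1)] ext_Int[OF Hk(1), of i j] by (auto simp: glue_def)
      have dist: "distinct [i, j, k]" using ij k by auto
      have "q ?T (y i) \<otimes> q ?H (y j) = q ?H (y i) \<otimes> q ?T (y j)"
        by (rule ratio[OF _ _ _ _ _ K])
          (use yg iN hT hH yT ij yH flat_above_triple[OF _ _ iN dist] in blast)+
      then have "q ?T (y i) \<otimes> (w \<otimes> dy j) = (w \<otimes> dy i) \<otimes> q ?T (y j)"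
        using w(2)[of "y i"] w(2)[of "y j"] yH yg iN dMy by simp
      moreover have V: "w \<in> carrier P" "dy i \<in> carrier P" "dy j \<in> carrier P"
        "q ?T (y i) \<in> carrier P" "q ?T (y j) \<in> carrier P"
        using w(1) dyU iN UT ij by (auto simp: Units_closed)
      ultimately have "w \<otimes> (q ?T (y i) \<otimes> dy j) = w \<otimes> (dy i \<otimes> q ?T (y j))" by (simp add: m_ac)
      then show ?thesis by (rule cancel_left[OF w(1)]) (use V in simp_all)
    qed
    obtain i where i: "i \<in> S" using S(2) by fastforce
    let ?w = "q ?T (y i) \<otimes> inv (dy i)"
    have iN: "i \<in> N" using i S by blast
    have V: "q ?T (y j) \<in> carrier P" "dy j \<in> carrier P" "dy j \<in> Units P" if "j \<in> S" for j
      using UT[OF that] dyU that S by (auto simp: Units_closed)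
    have qw: "q ?T (y j) = ?w \<otimes> dy j" if j: "j \<in> S" for j
    proof -
      have "dy i \<otimes> (?w \<otimes> dy j) = inv (dy i) \<otimes> (dy i \<otimes> (q ?T (y i) \<otimes> dy j))"
        using V[OF i] V[OF j] by (simp add: m_ac)
      also have "\<dots> = q ?T (y i) \<otimes> dy j" using V[OF i] V[OF j] by (simp add: mult_inv_cancel)
      also have "\<dots> = dy i \<otimes> q ?T (y j)"
        using pair[OF i j] V[OF i] V[OF j] m_comm by (cases "i = j") auto
      finally have eq: "dy i \<otimes> (?w \<otimes> dy j) = dy i \<otimes> q ?T (y j)" .
      show ?thesis by (rule cancel_left[OF V(3)[OF i] eq[symmetric]]) (use V[OF i] V[OF j] in simp_all)
    qed
    have "q ?T e = ?w \<otimes> dM e" if e: "e \<in> ground M - ?T" for e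
    proof -
      obtain j where j: "j \<in> S" "e = y j" using e ground_M unfolding glue_def by blast
      then have "j \<in> N" using S by blast
      then show ?thesis using qw[OF j(1)] dMy j(2) by simp
    qed
    moreover have "?w \<in> Units P" using UT[OF i] V[OF i] by auto
    ultimately show ?thesis by blast
  qed
  have "\<exists>w\<in>Units P. \<forall>e\<in>ground M - A. q A e = w \<otimes> dM e" if A: "A \<in> hyperplanes M" for A
    using A
  proof (cases rule: hyperplane_cases)
    case top
    then show ?thesis using top_ok[OF missing_subset[of A]] by metis
  next
    case ext
    obtain i j where "i \<in> N" "j \<in> N" "i \<noteq> j" "missing A \<subseteq> {i, j}"
      using pair_containing[OF missing_subset ext(1)] .
    then show ?thesis using ext_ok[OF ext(2)] hyperplane_small(2)[OF A] by metis
  qed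
  then obtain w where w: "\<And>A. A \<in> hyperplanes M \<Longrightarrow> w A \<in> Units P"
      "\<And>A e. A \<in> hyperplanes M \<Longrightarrow> e \<in> ground M - A \<Longrightarrow> q A e = w A \<otimes> dM e"
    by metis
  have "f' A e = w A \<otimes> dM e \<otimes> f A e" if A: "A \<in> hyperplanes M" "e \<in> ground M" for A e
  proof (cases "e \<in> A")
    case True
    then show ?thesis using rep_zero[OF f(1) A] rep_zero[OF f(2) A] w(1)[OF A(1)] dMU[OF A(2)]
      by (simp add: Units_closed)
  next
    case False
    have "q A e \<otimes> f A e = f' A e"
      unfolding q_def using fU(1,2)[OF A False] by (simp add: m_assoc Units_closed)
    then show ?thesis using w(2)[OF A(1), of e] A(2) False by simp
  qed
  then show ?thesis unfolding rescaling_def using f w(1) dMU by blast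
qed

end

section \<open>Brackets on the line\<close>

context theta_representation
begin

text \<open>Over \<open>K = {x i}\<close> any two other points of the line are parallel, since a
  flat through x_i and one of them contains the line.\<close>

lemma rep_on_line_ratio:
  assumes g: "g \<in> representations M\<^sub>1 P" and i: "i \<in> N" "j \<in> N" "k \<in> N" "j \<noteq> i" "k \<noteq> i"
    and H: "H \<in> hyperplanes M\<^sub>1" "on_line H = {i}" "H' \<in> hyperplanes M\<^sub>1" "on_line H' = {i}"
  shows "g H (x j) \<otimes> g H' (x k) = g H' (x j) \<otimes> g H (x k)"
proof (rule rep_ratio[OF M1 g x_E1[OF i(2)] x_E1[OF i(3)] _ H(1,3)])
  show "{x i} \<subseteq> H" "{x i} \<subseteq> H'" using mem_on_line[OF i(1)] H by auto
  show "x j \<notin> H" "x j \<notin> H'" using not_in_if_on_line i H by auto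
  fix F assume F: "flat M\<^sub>1 F" "{x i} \<subseteq> F"
  have "x ` N \<subseteq> F" if "x l \<in> F" "l \<in> N" "l \<noteq> i" for l
    using line[OF F(1) i(1) that(2)] that F(2) by auto
  then show "x k \<in> F \<longleftrightarrow> x j \<in> F" using i by blast
qed

text \<open>Row \<open>b i\<close> is the restriction to the line, up to a unit, of every hyperplane
  function vanishing at x_i and at no other point of the line. Rows may still be rescaled
  independently.\<close>

definition proportional_on_line :: "('e set \<Rightarrow> 'e \<Rightarrow> 'p) \<Rightarrow> (nat \<Rightarrow> nat \<Rightarrow> 'p) \<Rightarrow> bool" where
  "proportional_on_line g b \<longleftrightarrow>
     (\<forall>i\<in>N. \<forall>j\<in>N. b i j \<in> carrier P \<and> (b i j = \<zero> \<longleftrightarrow> i = j)) \<and>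
     (\<forall>i\<in>N. \<forall>H\<in>hyperplanes M\<^sub>1. on_line H = {i} \<longrightarrow> (\<exists>u\<in>Units P. \<forall>j\<in>N. g H (x j) = u \<otimes> b i j))"

lemma proportional_on_lineD:
  assumes "proportional_on_line g b" "i \<in> N" "H \<in> hyperplanes M\<^sub>1" "on_line H = {i}"
  obtains u where "u \<in> Units P" "\<And>j. j \<in> N \<Longrightarrow> g H (x j) = u \<otimes> b i j"
proof -
  have "\<exists>u\<in>Units P. \<forall>j\<in>N. g H (x j) = u \<otimes> b i j"
    using assms by (simp add: proportional_on_line_def)
  then show ?thesis using that by blast
qed

text \<open>Replaces the fact that functionals on a plane are combinations of two of them. The
  modular triple joining \<open>H\<close> to hyperplanes at x_i and x_j provides the coefficients;
  if \<open>a\<close> were zero, evaluation at x_i and x_j would annihilate \<open>d\<close> and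
  \<open>c\<close>.\<close>

lemma line_relation:
  assumes g: "g \<in> representations M\<^sub>1 P" and b: "proportional_on_line g b"
    and H: "H \<in> hyperplanes M\<^sub>1" and ij: "i \<in> N" "j \<in> N" "i \<noteq> j" and ni: "x i \<notin> H" "x j \<notin> H"
  obtains a c d where "a \<in> Units P" "c \<in> carrier P" "d \<in> carrier P"
    "\<And>l. l \<in> N \<Longrightarrow> null (a \<otimes> g H (x l)) (c \<otimes> b i l) (d \<otimes> b j l)"
proof -
  have bc: "b i l \<in> carrier P" "b i l = \<zero> \<longleftrightarrow> i = l" if "i \<in> N" "l \<in> N" for i l
    using b that unfolding proportional_on_line_def by blast+
  obtain S where S: "flat M\<^sub>1 S" "x i \<in> S" "x j \<notin> S" using separated[OF ij] by blast
  obtain A B where AB: "A \<in> hyperplanes M\<^sub>1" "B \<in> hyperplanes M\<^sub>1" "x i \<in> A" "x j \<notin> A" "x j \<in> B" "x i \<notin> B"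
    and t: "modular_triple M\<^sub>1 H A B"
    using modular_triple_through[OF M1 H x_E1[OF ij(1)] x_E1[OF ij(2)] ni S] .
  have "on_line A \<noteq> N" "on_line B \<noteq> N" using AB(4,6) ij(1,2) mem_on_line by blast+
  then have on: "on_line A = {i}" "on_line B = {j}"
    using on_line_cases[OF hyperplane_flat[OF AB(1)] ij(1) AB(3)]
      on_line_cases[OF hyperplane_flat[OF AB(2)] ij(2) AB(5)] by blast+
  obtain u where u: "u \<in> Units P" "\<And>l. l \<in> N \<Longrightarrow> g A (x l) = u \<otimes> b i l"
    using proportional_on_lineD[OF b ij(1) AB(1) on(1)] by metis
  obtain v where v: "v \<in> Units P" "\<And>l. l \<in> N \<Longrightarrow> g B (x l) = v \<otimes> b j l"
    using proportional_on_lineD[OF b ij(2) AB(2) on(2)] by metis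
  obtain a c d where acd: "a \<in> carrier P" "c \<in> carrier P" "d \<in> carrier P" "\<not> (a = \<zero> \<and> c = \<zero> \<and> d = \<zero>)"
    and nl: "\<And>e. e \<in> E\<^sub>1 \<Longrightarrow> null (a \<otimes> g H e) (c \<otimes> g A e) (d \<otimes> g B e)"
    using rep_triple[OF g t] unfolding dependent_def by blast
  have uv: "u \<in> carrier P" "v \<in> carrier P" using u v by (auto simp: Units_closed)
  have nl': "null (a \<otimes> g H (x l)) ((c \<otimes> u) \<otimes> b i l) ((d \<otimes> v) \<otimes> b j l)" if l: "l \<in> N" for l
    using nl[OF x_E1[OF l]] u(2)[OF l] v(2)[OF l] bc l ij acd uv by (simp add: m_assoc)
  have "a \<noteq> \<zero>"
  proof
    assume a: "a = \<zero>"
    have "null \<zero> \<zero> ((d \<otimes> v) \<otimes> b j i)" "null \<zero> ((c \<otimes> u) \<otimes> b i j) \<zero>"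
      using nl'[OF ij(1)] nl'[OF ij(2)] bc[OF ij(1,1)] bc[OF ij(2,2)] a acd uv
        rep_closed[OF g H x_E1[OF ij(1)]] rep_closed[OF g H x_E1[OF ij(2)]] by auto
    then have "(d \<otimes> v) \<otimes> b j i = \<zero>" "(c \<otimes> u) \<otimes> b i j = \<zero>"
      using null_single null_rotate bc ij acd uv by (metis m_closed)+
    then have "d = \<zero>" "c = \<zero>" using bc ij acd uv u v by (auto simp: Units_iff)
    then show False using acd(4) a by simp
  qed
  then have "a \<in> Units P" using acd(1) Units_iff by simp
  then show ?thesis using that[of a "c \<otimes> u" "d \<otimes> v"] nl' acd uv by auto
qed

lemma proportional_exists:
  assumes g: "g \<in> representations M\<^sub>1 P"
  obtains b where "proportional_on_line g b"
proof -
  have "\<exists>H. H \<in> hyperplanes M\<^sub>1 \<and> on_line H = {i}" if "i \<in> N" for i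
    using hyperplane_through_point[OF that] by metis
  then obtain Hp where Hp: "\<And>i. i \<in> N \<Longrightarrow> Hp i \<in> hyperplanes M\<^sub>1" "\<And>i. i \<in> N \<Longrightarrow> on_line (Hp i) = {i}"
    by metis
  define b where "b i j = g (Hp i) (x j)" for i j
  have mem: "x j \<in> H \<longleftrightarrow> i = j" if "on_line H = {i}" "j \<in> N" for H i j
    using mem_on_line[OF that(2), of H] that(1) by auto
  have "proportional_on_line g b"
    unfolding proportional_on_line_def
  proof (intro conjI ballI impI)
    fix i j assume ij: "i \<in> N" "j \<in> N"
    show "b i j \<in> carrier P" unfolding b_def using rep_closed[OF g Hp(1)[OF ij(1)] x_E1[OF ij(2)]] .
    show "b i j = \<zero> \<longleftrightarrow> i = j"
      unfolding b_def using rep_zero[OF g Hp(1)[OF ij(1)] x_E1[OF ij(2)]] mem[OF Hp(2)[OF ij(1)] ij(2)] by simp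
  next
    fix i H assume i: "i \<in> N" and H: "H \<in> hyperplanes M\<^sub>1" "on_line H = {i}"
    obtain k where k: "k \<in> N" "k \<noteq> i" using one_two i by metis
    have U: "g H' (x j) \<in> Units P" if "H' \<in> hyperplanes M\<^sub>1" "on_line H' = {i}" "j \<in> N" "j \<noteq> i" for H' j
      using rep_Units[OF g that(1) x_E1[OF that(3)]] mem[OF that(2,3)] that(4) by simp
    let ?u = "g H (x k) \<otimes> inv (b i k)"
    have bU: "b i k \<in> Units P" unfolding b_def using U[OF Hp(1)[OF i] Hp(2)[OF i] k] .
    have "g H (x j) = ?u \<otimes> b i j" if j: "j \<in> N" for j
    proof (cases "j = i")
      case True
      have "g H (x i) = \<zero>" "b i i = \<zero>"
        unfolding b_def using rep_zero[OF g _ x_E1[OF i]] H Hp i mem by auto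
      then show ?thesis using True U[OF H k] bU by (simp add: Units_closed)
    next
      case False
      have c: "g H (x j) \<in> carrier P" "g H (x k) \<in> carrier P" "b i j \<in> carrier P" "b i k \<in> carrier P"
        using U[OF H j False] U[OF H k] bU U[OF Hp(1)[OF i] Hp(2)[OF i] j False]
        unfolding b_def by (auto simp: Units_closed)
      have r: "g H (x j) \<otimes> b i k = b i j \<otimes> g H (x k)"
        unfolding b_def by (rule rep_on_line_ratio[OF g i j k(1) False k(2) H Hp(1)[OF i] Hp(2)[OF i]])
      have "b i k \<otimes> (?u \<otimes> b i j) = b i k \<otimes> (inv (b i k) \<otimes> (b i j \<otimes> g H (x k)))"
        using c bU by (simp add: m_ac)
      also have "\<dots> = g H (x j) \<otimes> b i k" using c bU r by (simp add: mult_inv_cancel)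
      also have "\<dots> = b i k \<otimes> g H (x j)" using c by (simp add: m_comm)
      finally have eq: "b i k \<otimes> (?u \<otimes> b i j) = b i k \<otimes> g H (x j)" .
      show ?thesis by (rule cancel_left[OF bU eq[symmetric]]) (use c bU in auto)
    qed
    moreover have "?u \<in> Units P" using U[OF H k] bU by auto
    ultimately show "\<exists>u\<in>Units P. \<forall>j\<in>N. g H (x j) = u \<otimes> b i j" by blast
  qed
  then show ?thesis using that by blast
qed

text \<open>This identity is unaffected by scaling the rows of \<open>b\<close> and holds for
  antisymmetric \<open>b\<close>, so it is the obstruction to antisymmetry. It results from
  eliminating the coefficients of \<open>line_relation\<close>, for a hyperplane meeting the line in
  x_k, evaluated at x_i, x_j and x_k.\<close>

lemma cyclic_product:
  assumes g: "g \<in> representations M\<^sub>1 P" and b: "proportional_on_line g b"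
    and ijk: "i \<in> N" "j \<in> N" "k \<in> N" "distinct [i, j, k]"
  shows "b k i \<otimes> b i j \<otimes> b j k = \<epsilon> \<otimes> (b k j \<otimes> b j i \<otimes> b i k)"
proof -
  have bc: "b i l \<in> carrier P" "b i l = \<zero> \<longleftrightarrow> i = l" if "i \<in> N" "l \<in> N" for i l
    using b that unfolding proportional_on_line_def by blast+
  have ne: "i \<noteq> j" "i \<noteq> k" "j \<noteq> k" using ijk(4) by auto
  obtain H where H: "H \<in> hyperplanes M\<^sub>1" "on_line H = {k}" using hyperplane_through_point[OF ijk(3)] .
  obtain u where u: "u \<in> Units P" "\<And>l. l \<in> N \<Longrightarrow> g H (x l) = u \<otimes> b k l"
    using proportional_on_lineD[OF b ijk(3) H] by metis
  have "x i \<notin> H" "x j \<notin> H" using not_in_if_on_line[OF H(2)] ijk ne by auto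
  then obtain a c d where acd: "a \<in> Units P" "c \<in> carrier P" "d \<in> carrier P"
    and nl: "\<And>l. l \<in> N \<Longrightarrow> null (a \<otimes> g H (x l)) (c \<otimes> b i l) (d \<otimes> b j l)"
    using line_relation[OF g b H(1) ijk(1,2) ne(1)] by metis
  let ?a = "a \<otimes> u"
  have aU: "?a \<in> Units P" using acd(1) u(1) by auto
  have C: "b i j \<in> carrier P" "b j i \<in> carrier P" "b i k \<in> carrier P" "b k i \<in> carrier P"
    "b j k \<in> carrier P" "b k j \<in> carrier P" "?a \<in> carrier P" "a \<in> carrier P" "u \<in> carrier P"
    using bc ijk aU acd(1) u(1) by (auto simp: Units_closed)
  have nl': "null (?a \<otimes> b k l) (c \<otimes> b i l) (d \<otimes> b j l)" if l: "l \<in> N" for l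
    using nl[OF l] u(2)[OF l] bc[OF ijk(3) l] C by (simp add: m_assoc)
  have z: "b i i = \<zero>" "b j j = \<zero>" "b k k = \<zero>"
    using bc(2)[OF ijk(1,1)] bc(2)[OF ijk(2,2)] bc(2)[OF ijk(3,3)] by simp_all
  have 1: "d \<otimes> b j i = \<epsilon> \<otimes> (?a \<otimes> b k i)"
    using nl'[OF ijk(1)] z acd C null_pair null_rotate null_swap by (metis m_closed mult_zero)
  have 2: "c \<otimes> b i j = \<epsilon> \<otimes> (?a \<otimes> b k j)"
    using nl'[OF ijk(2)] z acd C null_pair by (metis m_closed mult_zero)
  have 3: "d \<otimes> b j k = \<epsilon> \<otimes> (c \<otimes> b i k)"
    using nl'[OF ijk(3)] z acd C null_pair null_rotate by (metis m_closed mult_zero)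
  have "d \<noteq> \<zero>"
  proof
    assume "d = \<zero>"
    then have "\<epsilon> \<otimes> (?a \<otimes> b k i) = \<zero>" using 1 C by simp
    then have "?a = \<zero> \<or> b k i = \<zero>" using C by auto
    then show False using aU bc[OF ijk(3,1)] ne Units_iff by auto
  qed
  then have dU: "d \<in> Units P" using acd Units_iff by simp
  have "d \<otimes> (b k i \<otimes> b i j \<otimes> b j k) = b k i \<otimes> b i j \<otimes> (d \<otimes> b j k)"
    using C acd by (simp add: m_ac)
  also have "\<dots> = \<epsilon> \<otimes> (b k i \<otimes> b i k \<otimes> (c \<otimes> b i j))" unfolding 3 using C acd by (simp add: m_ac)
  also have "\<dots> = \<epsilon> \<otimes> (b i k \<otimes> b k j \<otimes> (\<epsilon> \<otimes> (?a \<otimes> b k i)))"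
    unfolding 2 using C neg_closed by (simp only: m_ac m_closed)
  also have "\<dots> = d \<otimes> (\<epsilon> \<otimes> (b k j \<otimes> b j i \<otimes> b i k))"
    unfolding 1[symmetric] using C acd neg_closed by (simp only: m_ac m_closed)
  finally show ?thesis by (rule cancel_left[OF dU]) (use C in auto)
qed

text \<open>\<open>b i j\<close> plays the role of the determinant of \<open>x\<^sub>i\<close> and \<open>x\<^sub>j\<close> in a plane containing \<open>X\<close>.\<close>

definition brackets :: "('e set \<Rightarrow> 'e \<Rightarrow> 'p) \<Rightarrow> (nat \<Rightarrow> nat \<Rightarrow> 'p) \<Rightarrow> bool" where
  "brackets g b \<longleftrightarrow> proportional_on_line g b \<and> (\<forall>i\<in>N. \<forall>j\<in>N. i \<noteq> j \<longrightarrow> b j i = \<epsilon> \<otimes> b i j)"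

text \<open>Row 1 is kept and each other row is scaled to be antisymmetric against it; for two
  indices other than 1, antisymmetry follows from \<open>cyclic_product\<close> with third index
  1.\<close>

lemma brackets_exist:
  assumes g: "g \<in> representations M\<^sub>1 P"
  obtains b where "brackets g b"
proof -
  obtain b where b: "proportional_on_line g b" using proportional_exists[OF g] .
  have bc: "b i l \<in> carrier P" "b i l = \<zero> \<longleftrightarrow> i = l" if "i \<in> N" "l \<in> N" for i l
    using b that unfolding proportional_on_line_def by blast+
  have bU: "b i l \<in> Units P" if "i \<in> N" "l \<in> N" "i \<noteq> l" for i l
    using bc[OF that(1,2)] that(3) Units_iff by simp
  define s where "s i = (if i = 1 then \<one> else \<epsilon> \<otimes> (b 1 i \<otimes> inv (b i 1)))" for i
  have one: "(1::nat) \<in> N" by (rule one_two)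
  have sU: "s i \<in> Units P" if "i \<in> N" for i
    unfolding s_def using bU[OF one that] bU[OF that one] by auto
  have s1: "s i \<otimes> b i 1 = \<epsilon> \<otimes> b 1 i" if i: "i \<in> N" "i \<noteq> 1" for i
  proof -
    have U: "b 1 i \<in> Units P" "b i 1 \<in> Units P" using bU[OF one i(1)] bU[OF i(1) one] i(2) by auto
    note C = U[THEN Units_closed] U[THEN Units_inv_closed]
    have "s i = \<epsilon> \<otimes> (b 1 i \<otimes> inv (b i 1))" using i(2) by (simp add: s_def)
    then have "s i \<otimes> b i 1 = \<epsilon> \<otimes> (b 1 i \<otimes> (b i 1 \<otimes> inv (b i 1)))"
      by (simp only: m_ac m_closed neg_closed C)
    then show ?thesis using U C by simp
  qed
  have anti: "s j \<otimes> b j i = \<epsilon> \<otimes> (s i \<otimes> b i j)" if ij: "i \<in> N" "j \<in> N" "i \<noteq> j" for i j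
  proof -
    consider "i = 1" | "j = 1" | "i \<noteq> 1" "j \<noteq> 1" by blast
    then show ?thesis
    proof cases
      case 1
      then show ?thesis using s1[OF ij(2)] ij bc by (auto simp: s_def)
    next
      case 2
      then show ?thesis using s1[OF ij(1)] ij bc by (auto simp: s_def)
    next
      case 3
      let ?d = "b i 1 \<otimes> b j 1"
      have dU: "?d \<in> Units P" using bU[OF ij(1) one] bU[OF ij(2) one] 3 by auto
      have C: "b i j \<in> carrier P" "b j i \<in> carrier P" "b i 1 \<in> carrier P" "b 1 i \<in> carrier P"
        "b j 1 \<in> carrier P" "b 1 j \<in> carrier P" "s i \<in> carrier P" "s j \<in> carrier P"
        using bc ij one sU by (auto simp: Units_closed)
      note ac = m_ac m_closed neg_closed C
      have cyc: "b 1 i \<otimes> b i j \<otimes> b j 1 = \<epsilon> \<otimes> (b 1 j \<otimes> b j i \<otimes> b i 1)"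
        by (rule cyclic_product[OF g b ij(1,2) one]) (use ij 3 in auto)
      have "?d \<otimes> (s j \<otimes> b j i) = (s j \<otimes> b j 1) \<otimes> (b j i \<otimes> b i 1)" by (simp only: ac)
      also have "\<dots> = \<epsilon> \<otimes> (b 1 j \<otimes> b j i \<otimes> b i 1)"
        unfolding s1[OF ij(2) 3(2)] by (simp only: ac)
      also have "\<dots> = b 1 i \<otimes> b i j \<otimes> b j 1" using cyc by simp
      also have "\<dots> = \<epsilon> \<otimes> (\<epsilon> \<otimes> (b 1 i \<otimes> b i j \<otimes> b j 1))" using C by simp
      also have "\<dots> = \<epsilon> \<otimes> ((s i \<otimes> b i 1) \<otimes> (b i j \<otimes> b j 1))"
        unfolding s1[OF ij(1) 3(1)] by (simp only: ac)
      also have "\<dots> = ?d \<otimes> (\<epsilon> \<otimes> (s i \<otimes> b i j))" by (simp only: ac)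
      finally show ?thesis by (rule cancel_left[OF dU]) (use C in auto)
    qed
  qed
  have "proportional_on_line g (\<lambda>i j. s i \<otimes> b i j)"
    unfolding proportional_on_line_def
  proof (intro conjI ballI impI)
    fix i j assume ij: "i \<in> N" "j \<in> N"
    show "s i \<otimes> b i j \<in> carrier P" using sU[OF ij(1)] bc[OF ij] by (simp add: Units_closed)
    show "s i \<otimes> b i j = \<zero> \<longleftrightarrow> i = j" using sU[OF ij(1)] bc[OF ij] by (auto simp: Units_iff)
  next
    fix i H assume i: "i \<in> N" and H: "H \<in> hyperplanes M\<^sub>1" "on_line H = {i}"
    obtain u where u: "u \<in> Units P" "\<And>j. j \<in> N \<Longrightarrow> g H (x j) = u \<otimes> b i j"
      using proportional_on_lineD[OF b i H] by metis
    have "g H (x j) = (u \<otimes> inv (s i)) \<otimes> (s i \<otimes> b i j)" if j: "j \<in> N" for j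
    proof -
      have "(u \<otimes> inv (s i)) \<otimes> (s i \<otimes> b i j) = u \<otimes> (inv (s i) \<otimes> (s i \<otimes> b i j))"
        using u(1) sU[OF i] bc[OF i j] by (simp add: m_assoc Units_closed)
      then show ?thesis using u sU[OF i] bc[OF i j] j by (simp add: mult_inv_cancel)
    qed
    moreover have "u \<otimes> inv (s i) \<in> Units P" using u(1) sU[OF i] by auto
    ultimately show "\<exists>u\<in>Units P. \<forall>j\<in>N. g H (x j) = u \<otimes> (s i \<otimes> b i j)" by blast
  qed
  then show ?thesis using that[of "\<lambda>i j. s i \<otimes> b i j"] anti unfolding brackets_def by blast
qed

end

locale bracketed_representation = theta_representation n x y M\<^sub>1 M P
  for n :: nat and x y :: "nat \<Rightarrow> 'e" and M\<^sub>1 M :: "'e matroid" and P :: "'p pasture" (structure) +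
  fixes g :: "'e set \<Rightarrow> 'e \<Rightarrow> 'p" and b :: "nat \<Rightarrow> nat \<Rightarrow> 'p"
  assumes g: "g \<in> representations M\<^sub>1 P" and brackets: "brackets g b"
begin

lemma proportional: "proportional_on_line g b"
  using brackets by (simp add: brackets_def)

lemma b_closed [simp]: "i \<in> N \<Longrightarrow> j \<in> N \<Longrightarrow> b i j \<in> carrier P"
  using proportional unfolding proportional_on_line_def by blast

lemma b_zero: "i \<in> N \<Longrightarrow> j \<in> N \<Longrightarrow> b i j = \<zero> \<longleftrightarrow> i = j"
  using proportional unfolding proportional_on_line_def by blast

lemma b_self [simp]: "i \<in> N \<Longrightarrow> b i i = \<zero>"
  using b_zero by blast

lemma b_Units [simp]: "i \<in> N \<Longrightarrow> j \<in> N \<Longrightarrow> i \<noteq> j \<Longrightarrow> b i j \<in> Units P"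
  using b_zero b_closed Units_iff by blast

lemma b_swap: "i \<in> N \<Longrightarrow> j \<in> N \<Longrightarrow> i \<noteq> j \<Longrightarrow> b j i = \<epsilon> \<otimes> b i j"
  using brackets unfolding brackets_def by blast

lemma g_on_line:
  assumes "i \<in> N" "H \<in> hyperplanes M\<^sub>1" "on_line H = {i}"
  obtains u where "u \<in> Units P" "\<And>j. j \<in> N \<Longrightarrow> g H (x j) = u \<otimes> b i j"
  using proportional_on_lineD[OF proportional assms] by metis

lemma g_closed [simp]: "H \<in> hyperplanes M\<^sub>1 \<Longrightarrow> e \<in> E\<^sub>1 \<Longrightarrow> g H e \<in> carrier P"
  using rep_closed[OF g] .

text \<open>Evaluating \<open>line_relation\<close> at x_i and x_j determines \<open>d\<close> and
  \<open>c\<close> in terms of \<open>a\<close>. Inserting them at x_k and multiplying by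
  \<open>b i j\<close> leaves three terms, and antisymmetry of \<open>b\<close> produces the cyclic
  signs.\<close>

lemma pluecker:
  assumes H: "H \<in> hyperplanes M\<^sub>1" and ijk: "i \<in> N" "j \<in> N" "k \<in> N" "distinct [i, j, k]"
  shows "null (g H (x i) \<otimes> b j k) (g H (x j) \<otimes> b k i) (g H (x k) \<otimes> b i j)"
proof -
  have core: "null (g H (x i) \<otimes> b j k) (g H (x j) \<otimes> b k i) (g H (x k) \<otimes> b i j)"
    if ijk: "i \<in> N" "j \<in> N" "k \<in> N" "distinct [i, j, k]" and ni: "x i \<notin> H" "x j \<notin> H" for i j k
  proof -
    have ne: "i \<noteq> j" "i \<noteq> k" "j \<noteq> k" using ijk(4) by auto
    obtain a c d where acd: "a \<in> Units P" "c \<in> carrier P" "d \<in> carrier P"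
      and nl: "\<And>l. l \<in> N \<Longrightarrow> null (a \<otimes> g H (x l)) (c \<otimes> b i l) (d \<otimes> b j l)"
      using line_relation[OF g proportional H ijk(1,2) ne(1) ni] by metis
    define hi hj hk where h: "hi = g H (x i)" "hj = g H (x j)" "hk = g H (x k)"
    have C: "hi \<in> carrier P" "hj \<in> carrier P" "hk \<in> carrier P" "a \<in> carrier P" "b i j \<in> carrier P"
      "b j i \<in> carrier P" "b j k \<in> carrier P" "b k i \<in> carrier P" "b i k \<in> carrier P"
      unfolding h using acd(1) H ijk by (auto simp: Units_closed)
    note ac = m_ac m_closed neg_closed C acd
    have 1: "d \<otimes> b j i = \<epsilon> \<otimes> (a \<otimes> hi)"
    proof -
      have "null (a \<otimes> hi) (d \<otimes> b j i) \<zero>"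
        using nl[OF ijk(1)] ijk(1) acd null_rotate null_swap unfolding h by (metis b_self mult_zero)
      then show ?thesis using null_pair C acd by simp
    qed
    have 2: "c \<otimes> b i j = \<epsilon> \<otimes> (a \<otimes> hj)"
    proof -
      have "null (a \<otimes> hj) (c \<otimes> b i j) \<zero>" using nl[OF ijk(2)] ijk(2) acd unfolding h by simp
      then show ?thesis using null_pair C acd by simp
    qed
    have "null (b i j \<otimes> (a \<otimes> hk)) (b i j \<otimes> (c \<otimes> b i k)) (b i j \<otimes> (d \<otimes> b j k))"
      using null_mult[OF nl[OF ijk(3)] C(5)] unfolding h .
    moreover have "b i j \<otimes> (a \<otimes> hk) = a \<otimes> (hk \<otimes> b i j)" by (simp only: ac)
    moreover have "b i j \<otimes> (c \<otimes> b i k) = a \<otimes> (hj \<otimes> b k i)"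
    proof -
      have "b i j \<otimes> (c \<otimes> b i k) = (c \<otimes> b i j) \<otimes> b i k" by (simp only: ac)
      also have "\<dots> = a \<otimes> (hj \<otimes> (\<epsilon> \<otimes> b i k))" unfolding 2 by (simp only: ac)
      finally show ?thesis using b_swap[OF ijk(1,3) ne(2)] by simp
    qed
    moreover have "b i j \<otimes> (d \<otimes> b j k) = a \<otimes> (hi \<otimes> b j k)"
    proof -
      have "b i j \<otimes> (d \<otimes> b j k) = \<epsilon> \<otimes> (d \<otimes> b j i) \<otimes> b j k"
        using b_swap[OF ijk(2,1) ne(1)[symmetric]] by (simp only: ac)
      also have "\<dots> = a \<otimes> (hi \<otimes> b j k)" unfolding 1 using C by (simp add: m_assoc)
      finally show ?thesis .
    qed
    ultimately have "null (a \<otimes> (hk \<otimes> b i j)) (a \<otimes> (hj \<otimes> b k i)) (a \<otimes> (hi \<otimes> b j k))" by simp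
    then have "null (hk \<otimes> b i j) (hj \<otimes> b k i) (hi \<otimes> b j k)"
      using null_mult_iff[OF acd(1)] C by simp
    then show ?thesis unfolding h using null_rotate null_swap by blast
  qed
  have ne: "i \<noteq> j" "i \<noteq> k" "j \<noteq> k" using ijk(4) by auto
  have two: "x ` N \<subseteq> H" if "l \<in> N" "m \<in> N" "l \<noteq> m" "x l \<in> H" "x m \<in> H" for l m
    using line[OF hyperplane_flat[OF H] that] .
  \<comment> \<open>A hyperplane through two of the three points contains the line and makes all
    terms zero. Otherwise two points lie off \<open>H\<close>, and cyclic symmetry moves them to the
    first two places.\<close>
  consider "x i \<notin> H" "x j \<notin> H" | "x j \<notin> H" "x k \<notin> H" | "x k \<notin> H" "x i \<notin> H" | "x ` N \<subseteq> H"
    using two ijk ne by blast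
  then show ?thesis
  proof cases
    case 1
    then show ?thesis using core ijk by blast
  next
    case 2
    have "null (g H (x j) \<otimes> b k i) (g H (x k) \<otimes> b i j) (g H (x i) \<otimes> b j k)"
      by (rule core) (use 2 ijk in auto)
    then show ?thesis using null_rotate by blast
  next
    case 3
    have "null (g H (x k) \<otimes> b i j) (g H (x i) \<otimes> b j k) (g H (x j) \<otimes> b k i)"
      by (rule core) (use 3 ijk in auto)
    then show ?thesis using null_rotate by blast
  next
    case 4
    then have "g H (x l) = \<zero>" if "l \<in> N" for l using rep_zero[OF g H x_E1[OF that]] that by blast
    then show ?thesis using ijk by simp
  qed
qed

text \<open>The relation \<open>pluecker\<close> for a hyperplane meeting the line in x_l alone,
  with its unit divided out: the three-term Grassmann-Pluecker relation of rank two.\<close>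

lemma pluecker_brackets:
  assumes "i \<in> N" "j \<in> N" "k \<in> N" "l \<in> N" "distinct [i, j, k]"
  shows "null (b l i \<otimes> b j k) (b l j \<otimes> b k i) (b l k \<otimes> b i j)"
proof -
  obtain H where H: "H \<in> hyperplanes M\<^sub>1" "on_line H = {l}" using hyperplane_through_point[OF assms(4)] .
  obtain u where u: "u \<in> Units P" "\<And>j. j \<in> N \<Longrightarrow> g H (x j) = u \<otimes> b l j"
    using g_on_line[OF assms(4) H] by metis
  have "null (u \<otimes> (b l i \<otimes> b j k)) (u \<otimes> (b l j \<otimes> b k i)) (u \<otimes> (b l k \<otimes> b i j))"
    using pluecker[OF H(1) assms(1-3,5)] u assms by (simp add: m_assoc Units_closed)
  then show ?thesis using null_mult_iff[OF u(1)] assms by simp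
qed

end

section \<open>Lifting representations\<close>

context bracketed_representation
begin

lemma inv_b_closed [simp]: "i \<in> N \<Longrightarrow> j \<in> N \<Longrightarrow> i \<noteq> j \<Longrightarrow> inv (b i j) \<in> carrier P"
  by simp

lemma b_cancel:
  assumes "i \<in> N" "j \<in> N" "i \<noteq> j" "a \<in> carrier P"
  shows "b i j \<otimes> (inv (b i j) \<otimes> a) = a" "b j i \<otimes> (inv (b i j) \<otimes> a) = \<epsilon> \<otimes> a"
proof -
  show 1: "b i j \<otimes> (inv (b i j) \<otimes> a) = a" using assms by (simp add: mult_inv_cancel)
  show "b j i \<otimes> (inv (b i j) \<otimes> a) = \<epsilon> \<otimes> a"
    unfolding b_swap[OF assms(1-3)] using assms 1 by (simp add: m_assoc)
qed

text \<open>In coordinates, \<open>x\<^sub>k\<close> is the sum of the \<open>b i k\<close> multiples of the \<open>y\<^sub>i\<close>, and a hyperplane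
  function of \<open>M\<close> must be compatible with this. For \<open>ext i j H\<close> one solves for the only two nonzero
  values on \<open>Y\<close>. For \<open>E\<^sub>1 \<union> (Y - {y\<^sub>i, y\<^sub>j, y\<^sub>k})\<close> the Pluecker relation suggests \<open>b j k\<close>, \<open>b k i\<close>,
  \<open>b i j\<close>; dividing by the product of the three makes the value at \<open>y\<^sub>i\<close>, up to a common sign,
  symmetric in \<open>j\<close> and \<open>k\<close>, so that no ordering of the triple has to be chosen.\<close>

definition y_value :: "'e set \<Rightarrow> nat \<Rightarrow> 'p \<Rightarrow> bool" where
  "y_value G i v \<longleftrightarrow>
     (\<exists>H j. H \<in> hyperplanes M\<^sub>1 \<and> j \<in> N \<and> j \<noteq> i \<and> G = ext i j H \<and> v = g H (x j) \<otimes> inv (b i j)) \<or>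
     (\<exists>j k. j \<in> N \<and> k \<in> N \<and> distinct [i, j, k] \<and> G = glue E\<^sub>1 {i, j, k} \<and>
        v = inv (b i j) \<otimes> inv (b i k))"

lemma ext_ne_top: "H \<in> hyperplanes M\<^sub>1 \<Longrightarrow> ext i j H \<noteq> glue E\<^sub>1 S"
  using ext_Int[OF hyperplane_subset, of H i j] glue_Int[of E\<^sub>1 S] hyperplane_proper by (metis order_refl)

text \<open>Two presentations with different \<open>j\<close> and \<open>k\<close> can coincide only
  if x_i lies in \<open>H\<close>. Then \<open>g H\<close> on the line is either zero or a unit
  multiple of row \<open>b i\<close>, so that the quotient does not depend on the chosen
  index.\<close>

lemma y_value_ext_unique:
  assumes i: "i \<in> N" and H: "H \<in> hyperplanes M\<^sub>1" and jk: "j \<in> N" "j \<noteq> i" "k \<in> N" "k \<noteq> i"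
    and eq: "ext i j H = ext i k H"
  shows "g H (x j) \<otimes> inv (b i j) = g H (x k) \<otimes> inv (b i k)"
proof (cases "j = k")
  case False
  have Hs: "H \<subseteq> E\<^sub>1" using hyperplane_subset[OF H] .
  have yj: "y j \<in> ext i j H \<longleftrightarrow> x i \<in> H" using y_in_ext[OF Hs jk(1)] jk by auto
  have "y j \<in> ext i k H" using y_in_ext[OF Hs jk(1)] jk False by auto
  then have xi: "x i \<in> H" using yj eq by simp
  have "on_line H = {i} \<or> on_line H = N" using on_line_cases[OF hyperplane_flat[OF H] i xi] .
  then show ?thesis
  proof
    assume "on_line H = N"
    then have "x j \<in> H" "x k \<in> H" using jk by (simp_all add: mem_on_line)
    then have "g H (x j) = \<zero>" "g H (x k) = \<zero>" using rep_zero[OF g H] jk by auto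
    then show ?thesis using i jk by simp
  next
    assume "on_line H = {i}"
    then obtain u where u: "u \<in> Units P" "\<And>j. j \<in> N \<Longrightarrow> g H (x j) = u \<otimes> b i j"
      using g_on_line[OF i H] by metis
    have "(u \<otimes> b i l) \<otimes> inv (b i l) = u" if "l \<in> N" "l \<noteq> i" for l
      using u(1) i that by (simp add: m_assoc Units_closed)
    then show ?thesis using u(2) jk by simp
  qed
qed simp

lemma y_value_unique:
  assumes i: "i \<in> N" and v: "y_value G i v" and w: "y_value G i w"
  shows "v = w"
  using v unfolding y_value_def
proof (elim disjE exE conjE)
  fix H j assume H: "H \<in> hyperplanes M\<^sub>1" and j: "j \<in> N" "j \<noteq> i" and G: "G = ext i j H"
    and v: "v = g H (x j) \<otimes> inv (b i j)"
  from w obtain H' k where H': "H' \<in> hyperplanes M\<^sub>1" "k \<in> N" "k \<noteq> i" "G = ext i k H'"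
      "w = g H' (x k) \<otimes> inv (b i k)"
    unfolding y_value_def using ext_ne_top[OF H] G by metis
  have "H' = H" using G H'(4) ext_Int[OF hyperplane_subset[OF H]] ext_Int[OF hyperplane_subset[OF H'(1)]] by metis
  then show ?thesis using y_value_ext_unique[OF i H j H'(2,3)] G H' v by simp
next
  fix j k assume jk: "j \<in> N" "k \<in> N" "distinct [i, j, k]" and G: "G = glue E\<^sub>1 {i, j, k}"
    and v: "v = inv (b i j) \<otimes> inv (b i k)"
  from w obtain j' k' where jk': "j' \<in> N" "k' \<in> N" "distinct [i, j', k']" "G = glue E\<^sub>1 {i, j', k'}"
      "w = inv (b i j') \<otimes> inv (b i k')"
    unfolding y_value_def using ext_ne_top G by metis
  have "{i, j, k} = {i, j', k'}"
    using missing_glue[of E\<^sub>1 "{i, j, k}"] missing_glue[of E\<^sub>1 "{i, j', k'}"] G jk'(4) i jk(1,2) jk'(1,2)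
    by (metis empty_subsetI insert_subset order_refl)
  then have "j = j' \<and> k = k' \<or> j = k' \<and> k = j'" using jk(3) jk'(3) by auto
  then show ?thesis using v jk'(5) i jk by (auto simp: m_comm)
qed

text \<open>The test \<open>E\<^sub>1 \<subseteq> G\<close> separates the hyperplanes containing
  \<open>E\<^sub>1\<close>, whose trace is not a hyperplane of \<open>M\<^sub>1\<close>, so that
  \<open>g\<close> cannot be consulted there.\<close>

definition lift :: "'e set \<Rightarrow> 'e \<Rightarrow> 'p" where
  "lift G = (\<lambda>e\<in>ground M. if e \<in> E\<^sub>1 then (if E\<^sub>1 \<subseteq> G then \<zero> else g (G \<inter> E\<^sub>1) e)
     else if e \<in> G then \<zero> else THE v. y_value G (inv_into N y e) v)"

lemma lift_y:
  assumes "i \<in> N"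
  shows "y i \<in> G \<Longrightarrow> lift G (y i) = \<zero>" "y i \<notin> G \<Longrightarrow> y_value G i v \<Longrightarrow> lift G (y i) = v"
proof -
  have yg: "y i \<in> ground M" using assms ground_M by auto
  show "y i \<in> G \<Longrightarrow> lift G (y i) = \<zero>" using yg assms by (simp add: lift_def)
  assume *: "y i \<notin> G" "y_value G i v"
  have "(THE v. y_value G i v) = v" using y_value_unique[OF assms _ *(2)] *(2) by (intro the_equality)
  then show "lift G (y i) = v" using yg assms * inv_into_f_f[OF inj_y assms] by (simp add: lift_def)
qed

section \<open>Values and zeros of the lifted functions\<close>

lemma lift_ext_E1:
  assumes "H \<in> hyperplanes M\<^sub>1" "e \<in> E\<^sub>1"
  shows "lift (ext i j H) e = g H e"
proof -
  have I: "ext i j H \<inter> E\<^sub>1 = H" using ext_Int[OF hyperplane_subset[OF assms(1)]] .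
  have "\<not> E\<^sub>1 \<subseteq> ext i j H" using I hyperplane_proper[OF assms(1)] by blast
  then show ?thesis using I assms(2) E1_subset by (simp add: lift_def subsetD)
qed

lemma lift_ext_y:
  assumes H: "H \<in> hyperplanes M\<^sub>1" and ij: "i \<in> N" "j \<in> N" "i \<noteq> j"
  shows "lift (ext i j H) (y i) = g H (x j) \<otimes> inv (b i j)"
    "lift (ext i j H) (y j) = g H (x i) \<otimes> inv (b j i)"
    "\<And>l. l \<in> N \<Longrightarrow> l \<noteq> i \<Longrightarrow> l \<noteq> j \<Longrightarrow> lift (ext i j H) (y l) = \<zero>"
proof -
  have Hs: "H \<subseteq> E\<^sub>1" using hyperplane_subset[OF H] .
  have *: "lift (ext i j H) (y i) = g H (x j) \<otimes> inv (b i j)" if ij: "i \<in> N" "j \<in> N" "i \<noteq> j" for i j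
  proof (cases "x j \<in> H")
    case True
    then have "y i \<in> ext i j H" using y_in_ext[OF Hs ij(1)] ij by simp
    moreover have "g H (x j) = \<zero>" using rep_zero[OF g H x_E1[OF ij(2)]] True by simp
    ultimately show ?thesis using lift_y(1)[OF ij(1)] ij by simp
  next
    case False
    then have "y i \<notin> ext i j H" using y_in_ext[OF Hs ij(1)] by blast
    moreover have "y_value (ext i j H) i (g H (x j) \<otimes> inv (b i j))"
      unfolding y_value_def using H ij by blast
    ultimately show ?thesis using lift_y(2)[OF ij(1)] by blast
  qed
  show "lift (ext i j H) (y i) = g H (x j) \<otimes> inv (b i j)" using *[OF ij] .
  show "lift (ext i j H) (y j) = g H (x i) \<otimes> inv (b j i)" using *[OF ij(2,1)] ij(3) ext_commute[of i j] by simp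
  show "lift (ext i j H) (y l) = \<zero>" if "l \<in> N" "l \<noteq> i" "l \<noteq> j" for l
    using lift_y(1)[OF that(1)] y_in_ext[OF Hs that(1), of i j] that by simp
qed

lemma lift_top_E1: "e \<in> E\<^sub>1 \<Longrightarrow> lift (glue E\<^sub>1 S) e = \<zero>"
  using E1_subset by (auto simp: lift_def glue_def)

lemma lift_top_y:
  assumes "i \<in> N" "j \<in> N" "k \<in> N" "distinct [i, j, k]" "S = {i, j, k}"
  shows "lift (glue E\<^sub>1 S) (y i) = inv (b i j) \<otimes> inv (b i k)"
proof (rule lift_y(2)[OF assms(1)])
  show "y i \<notin> glue E\<^sub>1 S" using y_in_glue[of E\<^sub>1 i S] assms by auto
  show "y_value (glue E\<^sub>1 S) i (inv (b i j) \<otimes> inv (b i k))"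
    unfolding y_value_def using assms by blast
qed

lemma lift_top_zero: "l \<in> N \<Longrightarrow> l \<notin> S \<Longrightarrow> lift (glue E\<^sub>1 S) (y l) = \<zero>"
  using lift_y(1) y_in_glue[of E\<^sub>1 l S] by auto

lemma groundE:
  assumes "e \<in> ground M"
  obtains "e \<in> E\<^sub>1" | l where "l \<in> N" "e = y l"
  using assms ground_M by auto

lemma lift_closed_zero:
  assumes G: "G \<in> hyperplanes M" and e: "e \<in> ground M"
  shows "lift G e \<in> carrier P" "lift G e = \<zero> \<longleftrightarrow> e \<in> G"
proof -
  have "lift G e \<in> carrier P \<and> (lift G e = \<zero> \<longleftrightarrow> e \<in> G)"
    using G
  proof (cases rule: hyperplane_cases)
    case top
    obtain i j k where ijk: "missing G = {i, j, k}" "i \<noteq> j" "i \<noteq> k" "j \<noteq> k"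
      using top(1)[symmetric] by (auto simp: card_3_iff)
    then have S: "G = glue E\<^sub>1 {i, j, k}" using top(2) by simp
    have iN: "i \<in> N" "j \<in> N" "k \<in> N" using ijk(1) missing_subset by blast+
    show ?thesis using e
    proof (cases rule: groundE)
      case 1
      then show ?thesis using lift_top_E1 top(3) S by auto
    next
      case (2 l)
      have yl: "y l \<in> G \<longleftrightarrow> l \<notin> {i, j, k}" unfolding S using y_in_glue[of E\<^sub>1 l] 2(1) by simp
      have val: "lift G (y l) \<in> Units P"
        if "l \<in> N" "j' \<in> N" "k' \<in> N" "distinct [l, j', k']" "{i, j, k} = {l, j', k'}" for l j' k'
        unfolding S lift_top_y[OF that] using that by (intro Units_m_closed Units_inv_Units b_Units) auto
      consider "l = i" | "l = j" | "l = k" | "l \<notin> {i, j, k}" by blast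
      then show ?thesis
      proof cases
        case l: 1
        have "lift G (y i) \<in> Units P" by (rule val[of i j k]) (use iN ijk in auto)
        then show ?thesis using yl l 2 by (auto simp: Units_iff)
      next
        case l: 2
        have "lift G (y j) \<in> Units P" by (rule val[of j i k]) (use iN ijk in auto)
        then show ?thesis using yl l 2 by (auto simp: Units_iff)
      next
        case l: 3
        have "lift G (y k) \<in> Units P" by (rule val[of k i j]) (use iN ijk in auto)
        then show ?thesis using yl l 2 by (auto simp: Units_iff)
      next
        case l: 4
        then show ?thesis using yl lift_top_zero[OF 2(1) l] S 2(2) by simp
      qed
    qed
  next
    case H: ext
    obtain i j where ij: "i \<in> N" "j \<in> N" "i \<noteq> j" "missing G \<subseteq> {i, j}"
      using pair_containing[OF missing_subset H(1)] .
    define H where "H = G \<inter> E\<^sub>1"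
    have Hh: "H \<in> hyperplanes M\<^sub>1" and GH: "G = ext i j H"
      using hyperplane_small[OF G ij] unfolding H_def by blast+
    have Hs: "H \<subseteq> E\<^sub>1" by (simp add: H_def)
    show ?thesis using e
    proof (cases rule: groundE)
      case 1
      have "lift G e = g H e" using lift_ext_E1[OF Hh 1, of i j] GH by simp
      moreover have "e \<in> G \<longleftrightarrow> e \<in> H" using 1 by (simp add: H_def)
      ultimately show ?thesis using rep_zero[OF g Hh 1] rep_closed[OF g Hh 1] by simp
    next
      case (2 l)
      have val: "g H (x j) \<otimes> inv (b i j) \<in> carrier P \<and> (g H (x j) \<otimes> inv (b i j) = \<zero> \<longleftrightarrow> x j \<in> H)"
        if "i \<in> N" "j \<in> N" "i \<noteq> j" for i j
        using rep_zero[OF g Hh x_E1[OF that(2)]] that Hh by simp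
      consider "l = i" | "l = j" | "l \<noteq> i" "l \<noteq> j" by blast
      then show ?thesis
      proof cases
        case l: 1
        have "lift G e = g H (x j) \<otimes> inv (b i j)" using lift_ext_y(1)[OF Hh ij(1-3)] l GH 2(2) by simp
        moreover have "e \<in> G \<longleftrightarrow> x j \<in> H" using y_in_ext[OF Hs ij(1), of i j] ij(3) l GH 2(2) by simp
        ultimately show ?thesis using val[OF ij(1-3)] by simp
      next
        case l: 2
        have "lift G e = g H (x i) \<otimes> inv (b j i)" using lift_ext_y(2)[OF Hh ij(1-3)] l GH 2(2) by simp
        moreover have "e \<in> G \<longleftrightarrow> x i \<in> H" using y_in_ext[OF Hs ij(2), of i j] ij(3) l GH 2(2) by simp
        ultimately show ?thesis using val[OF ij(2,1) ij(3)[symmetric]] by simp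
      next
        case l: 3
        then show ?thesis using lift_ext_y(3)[OF Hh ij(1-3) 2(1)] y_in_ext[OF Hs 2(1), of i j] GH 2 by simp
      qed
    qed
  qed
  then show "lift G e \<in> carrier P" "lift G e = \<zero> \<longleftrightarrow> e \<in> G" by blast+
qed

section \<open>Relations for the four kinds of modular triples\<close>

lemma null_neg:
  assumes "a \<in> carrier P"
  shows "null a (\<epsilon> \<otimes> a) \<zero>" "null (\<epsilon> \<otimes> a) a \<zero>" "null a \<zero> (\<epsilon> \<otimes> a)" "null (\<epsilon> \<otimes> a) \<zero> a"
    "null \<zero> a (\<epsilon> \<otimes> a)" "null \<zero> (\<epsilon> \<otimes> a) a"
proof -
  show 1: "null a (\<epsilon> \<otimes> a) \<zero>" using null_pair assms by simp
  show "null (\<epsilon> \<otimes> a) a \<zero>" "null a \<zero> (\<epsilon> \<otimes> a)" "null (\<epsilon> \<otimes> a) \<zero> a"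
    "null \<zero> a (\<epsilon> \<otimes> a)" "null \<zero> (\<epsilon> \<otimes> a) a"
    using 1 null_rotate null_swap by metis+
qed

text \<open>At y_i each function is its value at x_j times the same factor
  \<open>inv (b i j)\<close>, and symmetrically at y_j; on the other y all vanish. The coefficients
  of the triple in \<open>M\<^sub>1\<close> therefore serve unchanged.\<close>

lemma lift_dependent_ext:
  assumes ij: "i \<in> N" "j \<in> N" "i \<noteq> j" and t: "modular_triple M\<^sub>1 H\<^sub>1 H\<^sub>2 H\<^sub>3"
  shows "dependent (ground M) (lift (ext i j H\<^sub>1)) (lift (ext i j H\<^sub>2)) (lift (ext i j H\<^sub>3))"
proof -
  have H: "H\<^sub>1 \<in> hyperplanes M\<^sub>1" "H\<^sub>2 \<in> hyperplanes M\<^sub>1" "H\<^sub>3 \<in> hyperplanes M\<^sub>1"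
    using t by (auto simp: modular_triple_def)
  obtain a c d where acd: "a \<in> carrier P" "c \<in> carrier P" "d \<in> carrier P" "\<not> (a = \<zero> \<and> c = \<zero> \<and> d = \<zero>)"
    and nl: "\<And>e. e \<in> E\<^sub>1 \<Longrightarrow> null (a \<otimes> g H\<^sub>1 e) (c \<otimes> g H\<^sub>2 e) (d \<otimes> g H\<^sub>3 e)"
    using rep_triple[OF g t] unfolding dependent_def by blast
  have scaled: "null (a \<otimes> (g H\<^sub>1 e \<otimes> w)) (c \<otimes> (g H\<^sub>2 e \<otimes> w)) (d \<otimes> (g H\<^sub>3 e \<otimes> w))"
    if e: "e \<in> E\<^sub>1" and w: "w \<in> carrier P" for e w
    using null_mult[OF nl[OF e] w] acd H e w by (simp add: m_ac)
  show ?thesis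
  proof (rule dependentI[OF acd])
    fix e assume "e \<in> ground M"
    then show "null (a \<otimes> lift (ext i j H\<^sub>1) e) (c \<otimes> lift (ext i j H\<^sub>2) e) (d \<otimes> lift (ext i j H\<^sub>3) e)"
    proof (cases rule: groundE)
      case 1
      then show ?thesis using lift_ext_E1 H nl by simp
    next
      case (2 l)
      consider "l = i" | "l = j" | "l \<noteq> i" "l \<noteq> j" by blast
      then show ?thesis
      proof cases
        case l: 1
        have "inv (b i j) \<in> carrier P" using ij by simp
        then show ?thesis using scaled[OF x_E1[OF ij(2)]] lift_ext_y(1)[OF _ ij] H l 2 by simp
      next
        case l: 2
        have "inv (b j i) \<in> carrier P" using ij by simp
        then show ?thesis using scaled[OF x_E1[OF ij(1)]] lift_ext_y(2)[OF _ ij] H l 2 by simp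
      next
        case l: 3
        then show ?thesis using lift_ext_y(3)[OF _ ij 2(1)] H acd 2 by simp
      qed
    qed
  qed
qed

text \<open>The functions of \<open>ext i j H\<close> and \<open>ext i k H\<close> agree on
  \<open>E\<^sub>1\<close>, so their difference should be a multiple of the function vanishing on
  \<open>E\<^sub>1\<close>. Evaluation at y_j dictates the coefficient
  \<open>\<epsilon> \<otimes> (hi \<otimes> b j k)\<close>, antisymmetry confirms it at y_k, and at
  y_i the relation is \<open>pluecker\<close> divided by two brackets.\<close>

lemma lift_dependent_mixed:
  assumes ijk: "{i, j, k} \<subseteq> N" "distinct [i, j, k]" and H: "H \<in> hyperplanes M\<^sub>1"
  shows "dependent (ground M) (lift (glue E\<^sub>1 {i, j, k})) (lift (ext i j H)) (lift (ext i k H))"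
proof -
  have iN: "i \<in> N" "j \<in> N" "k \<in> N" and ne: "i \<noteq> j" "i \<noteq> k" "j \<noteq> k" using ijk by auto
  define hi hj hk where h: "hi = g H (x i)" "hj = g H (x j)" "hk = g H (x k)"
  have C: "hi \<in> carrier P" "hj \<in> carrier P" "hk \<in> carrier P"
    "b i j \<in> carrier P" "b j k \<in> carrier P" "b k i \<in> carrier P"
    "inv (b i j) \<in> carrier P" "inv (b j i) \<in> carrier P" "inv (b i k) \<in> carrier P"
    "inv (b k i) \<in> carrier P" "inv (b j k) \<in> carrier P" "inv (b k j) \<in> carrier P"
    unfolding h by (simp_all only: g_closed[OF H] x_E1 b_closed Units_inv_closed b_Units iN ne
      ne[symmetric] not_False_eq_True)
  note ac = m_ac m_closed neg_closed C
  have perm: "{i, j, k} = {j, i, k}" "{i, j, k} = {k, i, j}" by auto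
  let ?c = "\<epsilon> \<otimes> (hi \<otimes> b j k)"
  show ?thesis
  proof (rule dependentI[of ?c \<one> \<epsilon>])
    fix e assume "e \<in> ground M"
    then show "null (?c \<otimes> lift (glue E\<^sub>1 {i, j, k}) e) (\<one> \<otimes> lift (ext i j H) e) (\<epsilon> \<otimes> lift (ext i k H) e)"
    proof (cases rule: groundE)
      case 1
      then show ?thesis using lift_ext_E1[OF H 1] lift_top_E1[OF 1] null_neg(5) C H by simp
    next
      case (2 l)
      consider "l = i" | "l = j" | "l = k" | "l \<noteq> i" "l \<noteq> j" "l \<noteq> k" by blast
      then show ?thesis
      proof cases
        case l: 1
        have v: "lift (glue E\<^sub>1 {i, j, k}) e = inv (b i j) \<otimes> inv (b i k)"
          "lift (ext i j H) e = hj \<otimes> inv (b i j)" "lift (ext i k H) e = hk \<otimes> inv (b i k)"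
          unfolding 2(2) l h using lift_top_y[OF iN(1,2,3)] ijk(2) lift_ext_y(1)[OF H] iN ne by auto
        let ?w = "\<epsilon> \<otimes> (inv (b i j) \<otimes> inv (b i k))"
        have "null (?w \<otimes> (hi \<otimes> b j k)) (?w \<otimes> (hj \<otimes> b k i)) (?w \<otimes> (hk \<otimes> b i j))"
          using null_mult[OF pluecker[OF H iN ijk(2)], of ?w] C unfolding h by simp
        moreover have "?w \<otimes> (hi \<otimes> b j k) = ?c \<otimes> (inv (b i j) \<otimes> inv (b i k))" by (simp only: ac)
        moreover have "?w \<otimes> (hj \<otimes> b k i) = \<one> \<otimes> (hj \<otimes> inv (b i j))"
        proof -
          have "?w \<otimes> (hj \<otimes> b k i) = \<epsilon> \<otimes> (b k i \<otimes> (inv (b i k) \<otimes> (hj \<otimes> inv (b i j))))" by (simp only: ac)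
          then show ?thesis using b_cancel(2)[OF iN(1,3) ne(2)] C by simp
        qed
        moreover have "?w \<otimes> (hk \<otimes> b i j) = \<epsilon> \<otimes> (hk \<otimes> inv (b i k))"
        proof -
          have "?w \<otimes> (hk \<otimes> b i j) = \<epsilon> \<otimes> (b i j \<otimes> (inv (b i j) \<otimes> (hk \<otimes> inv (b i k))))" by (simp only: ac)
          then show ?thesis using b_cancel(1)[OF iN(1,2) ne(1)] C by simp
        qed
        ultimately show ?thesis unfolding v by simp
      next
        case l: 2
        have v: "lift (glue E\<^sub>1 {i, j, k}) e = inv (b j i) \<otimes> inv (b j k)"
          "lift (ext i j H) e = hi \<otimes> inv (b j i)" "lift (ext i k H) e = \<zero>"
          unfolding 2(2) l h using lift_top_y[OF iN(2,1,3) _ perm(1)] lift_ext_y[OF H] iN ne by auto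
        have "?c \<otimes> (inv (b j i) \<otimes> inv (b j k)) = \<epsilon> \<otimes> (b j k \<otimes> (inv (b j k) \<otimes> (hi \<otimes> inv (b j i))))"
          by (simp only: ac)
        then have "?c \<otimes> (inv (b j i) \<otimes> inv (b j k)) = \<epsilon> \<otimes> (hi \<otimes> inv (b j i))"
          using b_cancel(1)[OF iN(2,3) ne(3)] C by simp
        then show ?thesis unfolding v using null_neg(2)[of "hi \<otimes> inv (b j i)"] C by simp
      next
        case l: 3
        have v: "lift (glue E\<^sub>1 {i, j, k}) e = inv (b k i) \<otimes> inv (b k j)"
          "lift (ext i j H) e = \<zero>" "lift (ext i k H) e = hi \<otimes> inv (b k i)"
          unfolding 2(2) l h using lift_top_y[OF iN(3,1,2) _ perm(2)] lift_ext_y[OF H] iN ne by auto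
        have "?c \<otimes> (inv (b k i) \<otimes> inv (b k j)) = \<epsilon> \<otimes> (b j k \<otimes> (inv (b k j) \<otimes> (hi \<otimes> inv (b k i))))"
          by (simp only: ac)
        then have "?c \<otimes> (inv (b k i) \<otimes> inv (b k j)) = hi \<otimes> inv (b k i)"
          using b_cancel(2)[OF iN(3,2) ne(3)[symmetric]] C by simp
        then show ?thesis unfolding v using null_neg(3)[of "hi \<otimes> inv (b k i)"] C by simp
      next
        case l: 4
        have v: "lift (glue E\<^sub>1 {i, j, k}) e = \<zero>" "lift (ext i j H) e = \<zero>" "lift (ext i k H) e = \<zero>"
          unfolding 2(2) using lift_top_zero[OF 2(1), of "{i, j, k}"] l
            lift_ext_y(3)[OF H iN(1,2) ne(1) 2(1)] lift_ext_y(3)[OF H iN(1,3) ne(2) 2(1)] by simp_all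
        show ?thesis unfolding v using C by simp
      qed
    qed
  qed (use C in auto)
qed

text \<open>On \<open>E\<^sub>1\<close> all three functions are \<open>g H\<close>, so the
  coefficients must themselves be a null sum, and \<open>pluecker\<close> supplies one whose terms
  also cancel in pairs at y_i, y_j and y_k. As the line is not contained in \<open>H\<close>, at
  most one of the three points lies in \<open>H\<close>, and the coefficients are not all
  zero.\<close>

lemma lift_dependent_same:
  assumes ijk: "{i, j, k} \<subseteq> N" "distinct [i, j, k]" and H: "H \<in> hyperplanes M\<^sub>1" and not: "\<not> x ` N \<subseteq> H"
  shows "dependent (ground M) (lift (ext i j H)) (lift (ext i k H)) (lift (ext j k H))"
proof -
  have iN: "i \<in> N" "j \<in> N" "k \<in> N" and ne: "i \<noteq> j" "i \<noteq> k" "j \<noteq> k" using ijk by auto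
  define hi hj hk where h: "hi = g H (x i)" "hj = g H (x j)" "hk = g H (x k)"
  have C: "hi \<in> carrier P" "hj \<in> carrier P" "hk \<in> carrier P"
    "b i j \<in> carrier P" "b j k \<in> carrier P" "b k i \<in> carrier P"
    "inv (b i j) \<in> carrier P" "inv (b j i) \<in> carrier P" "inv (b i k) \<in> carrier P"
    "inv (b k i) \<in> carrier P" "inv (b j k) \<in> carrier P" "inv (b k j) \<in> carrier P"
    unfolding h by (simp_all only: g_closed[OF H] x_E1 b_closed Units_inv_closed b_Units iN ne
      ne[symmetric] not_False_eq_True)
  note ac = m_ac m_closed neg_closed C
  have nz: "hj \<noteq> \<zero> \<or> hk \<noteq> \<zero>"
  proof (rule ccontr)
    assume "\<not> ?thesis"
    then have "x j \<in> H" "x k \<in> H" using rep_zero[OF g H] iN unfolding h by auto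
    then show False using line[OF hyperplane_flat[OF H] iN(2,3) ne(3)] not by blast
  qed
  let ?A = "hk \<otimes> b i j" and ?B = "hj \<otimes> b k i" and ?D = "hi \<otimes> b j k"
  show ?thesis
  proof (rule dependentI[of ?A ?B ?D])
    show "\<not> (?A = \<zero> \<and> ?B = \<zero> \<and> ?D = \<zero>)" using nz C b_zero iN ne by auto
    fix e assume "e \<in> ground M"
    then show "null (?A \<otimes> lift (ext i j H) e) (?B \<otimes> lift (ext i k H) e) (?D \<otimes> lift (ext j k H) e)"
    proof (cases rule: groundE)
      case 1
      have "null ?D ?B ?A" using pluecker[OF H iN ijk(2)] unfolding h .
      then have "null ?A ?B ?D" using null_rotate null_swap by metis
      then have "null (g H e \<otimes> ?A) (g H e \<otimes> ?B) (g H e \<otimes> ?D)" using null_mult 1 H by simp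
      then show ?thesis using lift_ext_E1[OF H 1] 1 H C by (simp add: m_comm)
    next
      case (2 l)
      consider "l = i" | "l = j" | "l = k" | "l \<noteq> i" "l \<noteq> j" "l \<noteq> k" by blast
      then show ?thesis
      proof cases
        case l: 1
        have v: "lift (ext i j H) e = hj \<otimes> inv (b i j)" "lift (ext i k H) e = hk \<otimes> inv (b i k)"
          "lift (ext j k H) e = \<zero>"
          unfolding 2(2) l h using lift_ext_y[OF H] iN ne by auto
        have "?A \<otimes> (hj \<otimes> inv (b i j)) = b i j \<otimes> (inv (b i j) \<otimes> (hk \<otimes> hj))"
          "?B \<otimes> (hk \<otimes> inv (b i k)) = b k i \<otimes> (inv (b i k) \<otimes> (hk \<otimes> hj))" by (simp_all only: ac)
        then have e: "?A \<otimes> (hj \<otimes> inv (b i j)) = hk \<otimes> hj" "?B \<otimes> (hk \<otimes> inv (b i k)) = \<epsilon> \<otimes> (hk \<otimes> hj)"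
          using b_cancel(1)[OF iN(1,2) ne(1)] b_cancel(2)[OF iN(1,3) ne(2)] C by simp_all
        show ?thesis unfolding v e using null_neg(1) C by simp
      next
        case l: 2
        have v: "lift (ext i j H) e = hi \<otimes> inv (b j i)" "lift (ext i k H) e = \<zero>"
          "lift (ext j k H) e = hk \<otimes> inv (b j k)"
          unfolding 2(2) l h using lift_ext_y[OF H] iN ne by auto
        have "?A \<otimes> (hi \<otimes> inv (b j i)) = b i j \<otimes> (inv (b j i) \<otimes> (hk \<otimes> hi))"
          "?D \<otimes> (hk \<otimes> inv (b j k)) = b j k \<otimes> (inv (b j k) \<otimes> (hk \<otimes> hi))" by (simp_all only: ac)
        then have e: "?A \<otimes> (hi \<otimes> inv (b j i)) = \<epsilon> \<otimes> (hk \<otimes> hi)" "?D \<otimes> (hk \<otimes> inv (b j k)) = hk \<otimes> hi"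
          using b_cancel(2)[OF iN(2,1) ne(1)[symmetric]] b_cancel(1)[OF iN(2,3) ne(3)] C by simp_all
        show ?thesis unfolding v e using null_neg(4) C by simp
      next
        case l: 3
        have v: "lift (ext i j H) e = \<zero>" "lift (ext i k H) e = hi \<otimes> inv (b k i)"
          "lift (ext j k H) e = hj \<otimes> inv (b k j)"
          unfolding 2(2) l h using lift_ext_y[OF H] iN ne by auto
        have "?B \<otimes> (hi \<otimes> inv (b k i)) = b k i \<otimes> (inv (b k i) \<otimes> (hj \<otimes> hi))"
          "?D \<otimes> (hj \<otimes> inv (b k j)) = b j k \<otimes> (inv (b k j) \<otimes> (hj \<otimes> hi))" by (simp_all only: ac)
        then have e: "?B \<otimes> (hi \<otimes> inv (b k i)) = hj \<otimes> hi" "?D \<otimes> (hj \<otimes> inv (b k j)) = \<epsilon> \<otimes> (hj \<otimes> hi)"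
          using b_cancel(1)[OF iN(3,1) ne(2)[symmetric]] b_cancel(2)[OF iN(3,2) ne(3)[symmetric]] C by simp_all
        show ?thesis unfolding v e using null_neg(5) C by simp
      next
        case l: 4
        have v: "lift (ext i j H) e = \<zero>" "lift (ext i k H) e = \<zero>" "lift (ext j k H) e = \<zero>"
          unfolding 2(2) using lift_ext_y(3)[OF H iN(1,2) ne(1) 2(1)] l
            lift_ext_y(3)[OF H iN(1,3) ne(2) 2(1)] lift_ext_y(3)[OF H iN(2,3) ne(3) 2(1)] by simp_all
        show ?thesis unfolding v using C by simp
      qed
    qed
  qed (use C in auto)
qed

text \<open>Each of y_i, y_j, y_k lies outside only two of the hyperplanes, and cancellation there
  fixes the coefficients up to a common factor. At y_l all three terms survive and form
  \<open>pluecker_brackets\<close>, divided by the three brackets with l.\<close>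

lemma lift_dependent_top:
  assumes ijkl: "{i, j, k, l} \<subseteq> N" "distinct [i, j, k, l]"
  shows "dependent (ground M) (lift (glue E\<^sub>1 {j, k, l})) (lift (glue E\<^sub>1 {i, k, l})) (lift (glue E\<^sub>1 {i, j, l}))"
proof -
  have iN: "i \<in> N" "j \<in> N" "k \<in> N" "l \<in> N"
    and ne: "i \<noteq> j" "i \<noteq> k" "j \<noteq> k" "i \<noteq> l" "j \<noteq> l" "k \<noteq> l" using ijkl by auto
  have C: "b i j \<in> carrier P" "b j k \<in> carrier P" "b k i \<in> carrier P"
    "b l i \<in> carrier P" "b l j \<in> carrier P" "b l k \<in> carrier P"
    "inv (b i j) \<in> carrier P" "inv (b j i) \<in> carrier P" "inv (b i k) \<in> carrier P"
    "inv (b k i) \<in> carrier P" "inv (b j k) \<in> carrier P" "inv (b k j) \<in> carrier P"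
    "inv (b i l) \<in> carrier P" "inv (b j l) \<in> carrier P" "inv (b k l) \<in> carrier P"
    "inv (b l i) \<in> carrier P" "inv (b l j) \<in> carrier P" "inv (b l k) \<in> carrier P"
    by (simp_all only: b_closed Units_inv_closed b_Units iN ne ne[symmetric] not_False_eq_True)
  note ac = m_ac m_closed neg_closed C
  have perm: "{i, j, l} = {j, i, l}" "{j, k, l} = {k, j, l}" "{i, k, l} = {k, i, l}"
    "{j, k, l} = {l, j, k}" "{i, k, l} = {l, i, k}" "{i, j, l} = {l, i, j}" by auto
  let ?A = "glue E\<^sub>1 {j, k, l}" and ?B = "glue E\<^sub>1 {i, k, l}" and ?D = "glue E\<^sub>1 {i, j, l}"
  show ?thesis
  proof (rule dependentI[of "b j k" "b k i" "b i j"])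
    show "\<not> (b j k = \<zero> \<and> b k i = \<zero> \<and> b i j = \<zero>)" using b_zero iN ne by auto
    fix e assume "e \<in> ground M"
    then show "null (b j k \<otimes> lift ?A e) (b k i \<otimes> lift ?B e) (b i j \<otimes> lift ?D e)"
    proof (cases rule: groundE)
      case 1
      then show ?thesis using lift_top_E1[OF 1] C by simp
    next
      case (2 m)
      consider "m = i" | "m = j" | "m = k" | "m = l" | "m \<notin> {i, j, k, l}" by blast
      then show ?thesis
      proof cases
        case m: 1
        have v: "lift ?A e = \<zero>" "lift ?B e = inv (b i k) \<otimes> inv (b i l)" "lift ?D e = inv (b i j) \<otimes> inv (b i l)"
          unfolding 2(2) m using lift_top_zero[OF iN(1)] lift_top_y[OF iN(1,3,4)] lift_top_y[OF iN(1,2,4)] ne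
          by auto
        show ?thesis unfolding v
          using b_cancel(2)[OF iN(1,3) ne(2)] b_cancel(1)[OF iN(1,2) ne(1)] null_neg(6) C by simp
      next
        case m: 2
        have v: "lift ?A e = inv (b j k) \<otimes> inv (b j l)" "lift ?B e = \<zero>" "lift ?D e = inv (b j i) \<otimes> inv (b j l)"
          unfolding 2(2) m
          using lift_top_zero[OF iN(2)] lift_top_y[OF iN(2,3,4)] lift_top_y[OF iN(2,1,4) _ perm(1)] ne
          by auto
        show ?thesis unfolding v
          using b_cancel(2)[OF iN(2,1) ne(1)[symmetric]] b_cancel(1)[OF iN(2,3) ne(3)] null_neg(3) C by simp
      next
        case m: 3
        have v: "lift ?A e = inv (b k j) \<otimes> inv (b k l)" "lift ?B e = inv (b k i) \<otimes> inv (b k l)" "lift ?D e = \<zero>"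
          unfolding 2(2) m
          using lift_top_zero[OF iN(3)] lift_top_y[OF iN(3,2,4) _ perm(2)]
            lift_top_y[OF iN(3,1,4) _ perm(3)] ne by auto
        show ?thesis unfolding v
          using b_cancel(2)[OF iN(3,2) ne(3)[symmetric]] b_cancel(1)[OF iN(3,1) ne(2)[symmetric]] null_neg(2) C
          by simp
      next
        case m: 4
        have v: "lift ?A e = inv (b l j) \<otimes> inv (b l k)" "lift ?B e = inv (b l i) \<otimes> inv (b l k)"
          "lift ?D e = inv (b l i) \<otimes> inv (b l j)"
          unfolding 2(2) m
          using lift_top_y[OF iN(4,2,3) _ perm(4)] lift_top_y[OF iN(4,1,3) _ perm(5)]
            lift_top_y[OF iN(4,1,2) _ perm(6)] ne by auto
        let ?w = "inv (b l i) \<otimes> (inv (b l j) \<otimes> inv (b l k))"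
        have "null (?w \<otimes> (b l i \<otimes> b j k)) (?w \<otimes> (b l j \<otimes> b k i)) (?w \<otimes> (b l k \<otimes> b i j))"
          using null_mult[OF pluecker_brackets[OF iN], of ?w] ne C by simp
        moreover have "?w \<otimes> (b l i \<otimes> b j k) = b l i \<otimes> (inv (b l i) \<otimes> (b j k \<otimes> (inv (b l j) \<otimes> inv (b l k))))"
          "?w \<otimes> (b l j \<otimes> b k i) = b l j \<otimes> (inv (b l j) \<otimes> (b k i \<otimes> (inv (b l i) \<otimes> inv (b l k))))"
          "?w \<otimes> (b l k \<otimes> b i j) = b l k \<otimes> (inv (b l k) \<otimes> (b i j \<otimes> (inv (b l i) \<otimes> inv (b l j))))"
          by (simp_all only: ac)
        ultimately show ?thesis unfolding v
          using b_cancel(1)[OF iN(4,1) ne(4)[symmetric]] b_cancel(1)[OF iN(4,2) ne(5)[symmetric]]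
            b_cancel(1)[OF iN(4,3) ne(6)[symmetric]] C by simp
      next
        case m: 5
        have v: "lift ?A e = \<zero>" "lift ?B e = \<zero>" "lift ?D e = \<zero>"
          unfolding 2(2) using lift_top_zero[OF 2(1)] m by auto
        show ?thesis unfolding v using C by simp
      qed
    qed
  qed (use C in auto)
qed

lemma trace_rep_surj: "\<exists>f\<in>representations M P. trace_rep f = g"
proof
  let ?f = "\<lambda>G\<in>hyperplanes M. lift G"
  show "?f \<in> representations M P"
    unfolding representations_iff
  proof (intro conjI ballI allI impI)
    have "lift G \<in> ground M \<rightarrow>\<^sub>E carrier P" if "G \<in> hyperplanes M" for G
    proof (rule PiE_I)
      show "lift G e \<in> carrier P" if "e \<in> ground M" for e using lift_closed_zero(1)[OF \<open>G \<in> _\<close> that] .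
      show "lift G e = undefined" if "e \<notin> ground M" for e using that by (simp add: lift_def)
    qed
    then show "?f \<in> hyperplanes M \<rightarrow>\<^sub>E (ground M \<rightarrow>\<^sub>E carrier P)" by auto
    show "?f G e = \<zero> \<longleftrightarrow> e \<in> G" if "G \<in> hyperplanes M" "e \<in> ground M" for G e
      using lift_closed_zero(2)[OF that] that(1) by simp
    fix A B D assume t: "modular_triple M A B D"
    then have H: "A \<in> hyperplanes M" "B \<in> hyperplanes M" "D \<in> hyperplanes M"
      by (auto simp: modular_triple_def)
    have "dependent (ground M) (lift A) (lift B) (lift D)"
      by (rule modular_triple_cases[OF t, where R = "\<lambda>A B D. dependent (ground M) (lift A) (lift B) (lift D)"])
        (fact dependent_rotate dependent_swap lift_dependent_ext lift_dependent_mixed lift_dependent_same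
          lift_dependent_top)+
    then show "dependent (ground M) (?f A) (?f B) (?f D)" using H by simp
  qed
  have gE: "g \<in> hyperplanes M\<^sub>1 \<rightarrow>\<^sub>E (E\<^sub>1 \<rightarrow>\<^sub>E carrier P)" using g by (simp add: representations_iff)
  show "trace_rep ?f = g"
  proof
    fix H show "trace_rep ?f H = g H"
    proof (cases "H \<in> hyperplanes M\<^sub>1")
      case True
      have gH: "g H \<in> E\<^sub>1 \<rightarrow>\<^sub>E carrier P" using gE True by (rule PiE_mem)
      show ?thesis
      proof
        fix e show "trace_rep ?f H e = g H e"
        proof (cases "e \<in> E\<^sub>1")
          case e: True
          then show ?thesis using True lift_ext_E1[OF True e] hyperplane_ext[OF True one_two] by simp
        next
          case False
          then show ?thesis using PiE_arb[OF gH False] True by (simp add: trace_rep_def)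
        qed
      qed
    next
      case False
      then show ?thesis using PiE_arb[OF gE False] by (simp add: trace_rep_def)
    qed
  qed
qed

end

context theta_representation
begin

lemma trace_rep_onto:
  assumes "g \<in> representations M\<^sub>1 P"
  shows "\<exists>f\<in>representations M P. trace_rep f = g"
proof -
  obtain b where "brackets g b" using brackets_exist[OF assms] .
  with assms have "bracketed_representation n x y M\<^sub>1 M P g b"
    by (intro bracketed_representation.intro theta_representation_axioms bracketed_representation_axioms.intro)
  then show ?thesis by (rule bracketed_representation.trace_rep_surj)
qed

lemma rescaling_trace_iff:
  assumes f: "f \<in> representations M P" "f' \<in> representations M P"
  shows "(trace_rep f, trace_rep f') \<in> rescaling M\<^sub>1 P \<longleftrightarrow> (f, f') \<in> rescaling M P"
proof
  assume "(f, f') \<in> rescaling M P"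
  then obtain c d where c: "c \<in> hyperplanes M \<rightarrow> Units P" and d: "d \<in> ground M \<rightarrow> Units P"
    and cd: "\<And>H e. H \<in> hyperplanes M \<Longrightarrow> e \<in> ground M \<Longrightarrow> f' H e = c H \<otimes> d e \<otimes> f H e"
    unfolding rescaling_def by auto
  have "(\<lambda>H. c (ext 1 2 H)) \<in> hyperplanes M\<^sub>1 \<rightarrow> Units P" using c hyperplane_ext[OF _ one_two] by auto
  moreover have "d \<in> E\<^sub>1 \<rightarrow> Units P" using d E1_subset by auto
  moreover have "trace_rep f' H e = c (ext 1 2 H) \<otimes> d e \<otimes> trace_rep f H e"
    if "H \<in> hyperplanes M\<^sub>1" "e \<in> E\<^sub>1" for H e
    using cd[OF hyperplane_ext[OF that(1) one_two], of e] that E1_subset by auto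
  ultimately show "(trace_rep f, trace_rep f') \<in> rescaling M\<^sub>1 P"
    unfolding rescaling_def mem_Collect_eq prod.case using trace_rep_representations f
    by (intro conjI bexI[of _ "\<lambda>H. c (ext 1 2 H)"] bexI[of _ d]) blast+
qed (rule rescaling_if_trace[OF f])

end

section \<open>Isomorphism of foundations\<close>

context pasture_struct
begin

lemma null_set_carrier: "s \<in> nullset P \<Longrightarrow> set_mset s \<subseteq> carrier P"
  using pasture unfolding pasture_def by blast

lemma id_pasture_hom: "(\<lambda>a\<in>carrier P. a) \<in> pasture_hom P P"
proof -
  have "image_mset (\<lambda>a\<in>carrier P. a) s = s" if s: "s \<in> nullset P" for s
  proof -
    have "set_mset s \<subseteq> carrier P" using null_set_carrier[OF s] .
    then have "image_mset (\<lambda>a\<in>carrier P. a) s = image_mset (\<lambda>a. a) s"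
      by (intro image_mset_cong) auto
    then show ?thesis by simp
  qed
  then show ?thesis unfolding pasture_hom_def by (auto simp: hom_def)
qed

lemma compose_pasture_hom:
  assumes \<phi>: "\<phi> \<in> pasture_hom P Q" and \<psi>: "\<psi> \<in> pasture_hom Q R"
  shows "compose (carrier P) \<psi> \<phi> \<in> pasture_hom P R"
proof -
  have im: "image_mset (compose (carrier P) \<psi> \<phi>) s = image_mset \<psi> (image_mset \<phi> s)"
    if s: "s \<in> nullset P" for s
  proof -
    have "set_mset s \<subseteq> carrier P" using null_set_carrier[OF s] .
    then have "image_mset (compose (carrier P) \<psi> \<phi>) s = image_mset (\<lambda>a. \<psi> (\<phi> a)) s"
      by (intro image_mset_cong) (auto simp: compose_def)
    then show ?thesis by (simp add: image_mset.compositionality comp_def)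
  qed
  have c: "\<phi> a \<in> carrier Q" if "a \<in> carrier P" for a
    using \<phi> that by (auto simp: pasture_hom_def hom_def)
  show ?thesis
    using \<phi> \<psi> c im unfolding pasture_hom_def hom_def
    by (auto simp: compose_def)
qed

lemma equiv_rescaling: "equiv (representations N P) (rescaling N P)"
proof -
  have U: "a \<in> carrier P" "inv a \<in> carrier P" if "a \<in> Units P" for a using that by auto
  show ?thesis
  proof (rule equivI)
    show "rescaling N P \<subseteq> representations N P \<times> representations N P"
      by (auto simp: rescaling_def)
    show "refl_on (representations N P) (rescaling N P)"
    proof (rule refl_onI)
      fix f assume f: "f \<in> representations N P"
      have "\<exists>c\<in>hyperplanes N \<rightarrow> Units P. \<exists>d\<in>ground N \<rightarrow> Units P.
          \<forall>H\<in>hyperplanes N. \<forall>e\<in>ground N. f H e = c H \<otimes> d e \<otimes> f H e"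
        by (intro bexI[of _ "\<lambda>_. \<one>"]) (use rep_closed[OF f] in auto)
      then show "(f, f) \<in> rescaling N P" using f by (simp add: rescaling_def)
    qed
    show "sym (rescaling N P)"
    proof (rule symI)
      fix f f' assume r: "(f, f') \<in> rescaling N P"
      then have f: "f \<in> representations N P" "f' \<in> representations N P" by (auto simp: rescaling_def)
      obtain c d where c: "c \<in> hyperplanes N \<rightarrow> Units P" and d: "d \<in> ground N \<rightarrow> Units P"
        and cd: "\<And>H e. H \<in> hyperplanes N \<Longrightarrow> e \<in> ground N \<Longrightarrow> f' H e = c H \<otimes> d e \<otimes> f H e"
        using r unfolding rescaling_def by auto
      have "f H e = inv (c H) \<otimes> inv (d e) \<otimes> f' H e" if He: "H \<in> hyperplanes N" "e \<in> ground N" for H e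
      proof -
        have V: "c H \<in> Units P" "d e \<in> Units P" "f H e \<in> carrier P"
          using c d He rep_closed[OF f(1) He] by auto
        have "inv (c H) \<otimes> inv (d e) \<otimes> f' H e = inv (c H) \<otimes> (c H \<otimes> (inv (d e) \<otimes> (d e \<otimes> f H e)))"
          unfolding cd[OF He] by (simp only: m_ac m_closed V U)
        then show ?thesis using V U by (simp add: mult_inv_cancel)
      qed
      moreover have "(\<lambda>H. inv (c H)) \<in> hyperplanes N \<rightarrow> Units P" "(\<lambda>e. inv (d e)) \<in> ground N \<rightarrow> Units P"
        using c d by auto
      ultimately show "(f', f) \<in> rescaling N P" unfolding rescaling_def mem_Collect_eq prod.case
        using f by (intro conjI bexI[of _ "\<lambda>H. inv (c H)"] bexI[of _ "\<lambda>e. inv (d e)"]) blast+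
    qed
    show "trans (rescaling N P)"
    proof (rule transI)
      fix f f' f'' assume r: "(f, f') \<in> rescaling N P" "(f', f'') \<in> rescaling N P"
      then have f: "f \<in> representations N P" "f'' \<in> representations N P" by (auto simp: rescaling_def)
      obtain c d where c: "c \<in> hyperplanes N \<rightarrow> Units P" and d: "d \<in> ground N \<rightarrow> Units P"
        and cd: "\<And>H e. H \<in> hyperplanes N \<Longrightarrow> e \<in> ground N \<Longrightarrow> f' H e = c H \<otimes> d e \<otimes> f H e"
        using r(1) unfolding rescaling_def by auto
      obtain c' d' where c': "c' \<in> hyperplanes N \<rightarrow> Units P" and d': "d' \<in> ground N \<rightarrow> Units P"
        and cd': "\<And>H e. H \<in> hyperplanes N \<Longrightarrow> e \<in> ground N \<Longrightarrow> f'' H e = c' H \<otimes> d' e \<otimes> f' H e"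
        using r(2) unfolding rescaling_def by auto
      have "f'' H e = (c H \<otimes> c' H) \<otimes> (d e \<otimes> d' e) \<otimes> f H e"
        if He: "H \<in> hyperplanes N" "e \<in> ground N" for H e
      proof -
        have V: "c H \<in> Units P" "d e \<in> Units P" "c' H \<in> Units P" "d' e \<in> Units P" "f H e \<in> carrier P"
          using c d c' d' He rep_closed[OF f(1) He] by auto
        show ?thesis unfolding cd'[OF He] cd[OF He] by (simp only: m_ac m_closed V U)
      qed
      moreover have "(\<lambda>H. c H \<otimes> c' H) \<in> hyperplanes N \<rightarrow> Units P"
        "(\<lambda>e. d e \<otimes> d' e) \<in> ground N \<rightarrow> Units P"
        using c d c' d' by auto
      ultimately show "(f, f'') \<in> rescaling N P" unfolding rescaling_def mem_Collect_eq prod.case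
        using f by (intro conjI bexI[of _ "\<lambda>H. c H \<otimes> c' H"] bexI[of _ "\<lambda>e. d e \<otimes> d' e"]) blast+
    qed
  qed
qed

end

lemmas pasture_hom_id = pasture_struct.id_pasture_hom[OF pasture_structI]
lemmas pasture_hom_compose = pasture_struct.compose_pasture_hom[OF pasture_structI]
lemmas rescaling_equiv = pasture_struct.equiv_rescaling[OF pasture_structI]

text \<open>Resolves the bijection onto rescaling classes into statements about single
  representations, so that the Yoneda argument can work with members instead of classes.\<close>

lemma is_foundationE:
  fixes F :: "'p pasture" and N :: "'e matroid"
  assumes "is_foundation F N"
  obtains \<eta> :: "'p pasture \<Rightarrow> ('p \<Rightarrow> 'p) \<Rightarrow> ('e set \<Rightarrow> 'e \<Rightarrow> 'p) set"
  where "\<And>P g f. pasture P \<Longrightarrow> g \<in> pasture_hom F P \<Longrightarrow> f \<in> \<eta> P g \<Longrightarrow> f \<in> representations N P"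
    "\<And>P g f f'. pasture P \<Longrightarrow> g \<in> pasture_hom F P \<Longrightarrow> f \<in> \<eta> P g \<Longrightarrow>
      f' \<in> \<eta> P g \<longleftrightarrow> (f, f') \<in> rescaling N P"
    "\<And>P g. pasture P \<Longrightarrow> g \<in> pasture_hom F P \<Longrightarrow> \<exists>f. f \<in> \<eta> P g"
    "\<And>P f. pasture P \<Longrightarrow> f \<in> representations N P \<Longrightarrow> \<exists>g\<in>pasture_hom F P. f \<in> \<eta> P g"
    "\<And>P g g' f. pasture P \<Longrightarrow> g \<in> pasture_hom F P \<Longrightarrow> g' \<in> pasture_hom F P \<Longrightarrow>
      f \<in> \<eta> P g \<Longrightarrow> f \<in> \<eta> P g' \<Longrightarrow> g = g'"
    "\<And>P Q \<phi> g f. \<phi> \<in> pasture_hom P Q \<Longrightarrow> g \<in> pasture_hom F P \<Longrightarrow> pasture P \<Longrightarrow> pasture Q \<Longrightarrow>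
      f \<in> \<eta> P g \<Longrightarrow> push_forward N \<phi> f \<in> \<eta> Q (compose (carrier F) \<phi> g)"
proof -
  obtain \<eta> :: "'p pasture \<Rightarrow> ('p \<Rightarrow> 'p) \<Rightarrow> ('e set \<Rightarrow> 'e \<Rightarrow> 'p) set"
    where nat: "(\<forall>P. pasture P \<longrightarrow> bij_betw (\<eta> P) (pasture_hom F P) (rescaling_classes N P)) \<and>
    (\<forall>P Q. \<forall>\<phi>\<in>pasture_hom P Q. \<forall>g\<in>pasture_hom F P. pasture P \<and> pasture Q \<longrightarrow>
      (\<forall>f\<in>\<eta> P g. push_forward N \<phi> f \<in> \<eta> Q (compose (carrier F) \<phi> g)))"
    by (rule exE[OF conjunct2[OF assms[unfolded is_foundation_def]]])
  then have \<eta>: "\<And>P. pasture P \<Longrightarrow> bij_betw (\<eta> P) (pasture_hom F P) (rescaling_classes N P)"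
    by simp
  have cls: "\<eta> P g \<in> representations N P // rescaling N P" if "pasture P" "g \<in> pasture_hom F P" for P g
    using bij_betwE[OF \<eta>[OF that(1)]] that(2) by (simp add: rescaling_classes_def)
  show ?thesis
  proof (rule that[of \<eta>])
    fix P :: "'p pasture" and g f f' assume P: "pasture P" and g: "g \<in> pasture_hom F P"
    note equiv = rescaling_equiv[OF P, of N]
    show "\<exists>f. f \<in> \<eta> P g" using in_quotient_imp_non_empty[OF equiv cls[OF P g]] by blast
    assume f: "f \<in> \<eta> P g"
    show "f \<in> representations N P" using in_quotient_imp_subset[OF equiv cls[OF P g]] f by blast
    show "f' \<in> \<eta> P g \<longleftrightarrow> (f, f') \<in> rescaling N P"
      using in_quotient_imp_in_rel[OF equiv cls[OF P g], of f f']
        in_quotient_imp_closed[OF equiv cls[OF P g] f, of f'] f by auto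
  next
    fix P :: "'p pasture" and f assume P: "pasture P" and f: "f \<in> representations N P"
    have "rescaling N P `` {f} \<in> rescaling_classes N P"
      unfolding rescaling_classes_def using f by (rule quotientI)
    then obtain g where "g \<in> pasture_hom F P" "\<eta> P g = rescaling N P `` {f}"
      using bij_betw_imp_surj_on[OF \<eta>[OF P]] by (metis imageE)
    then show "\<exists>g\<in>pasture_hom F P. f \<in> \<eta> P g"
      using equiv_class_self[OF rescaling_equiv[OF P] f] by blast
  next
    fix P :: "'p pasture" and g g' f assume P: "pasture P" and g: "g \<in> pasture_hom F P" "g' \<in> pasture_hom F P"
      and f: "f \<in> \<eta> P g" "f \<in> \<eta> P g'"
    have "\<eta> P g = \<eta> P g'"
      using quotient_disj[OF rescaling_equiv[OF P] cls[OF P g(1)] cls[OF P g(2)]] f by blast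
    then show "g = g'" using bij_betw_imp_inj_on[OF \<eta>[OF P]] g by (meson inj_onD)
  qed (use nat in simp)
qed

text \<open>Yoneda: below, \<open>f\<close> and \<open>k = \<tau> h\<close> lie in the universal classes over \<open>F\<close> and \<open>F'\<close>, and
  \<open>\<alpha>\<close>, \<open>\<beta>\<close> classify their images under \<open>\<tau>\<close> and its inverse.\<close>

lemma foundation_iso:
  fixes N :: "'e matroid" and N' :: "'f matroid" and F F' :: "'p pasture"
    and \<tau> :: "('e set \<Rightarrow> 'e \<Rightarrow> 'p) \<Rightarrow> 'f set \<Rightarrow> 'f \<Rightarrow> 'p"
  assumes F: "is_foundation F N" and F': "is_foundation F' N'"
    and closed: "\<And>P f. pasture P \<Longrightarrow> f \<in> representations N P \<Longrightarrow> \<tau> f \<in> representations N' P"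
    and onto: "\<And>P g. pasture P \<Longrightarrow> g \<in> representations N' P \<Longrightarrow> \<exists>f\<in>representations N P. \<tau> f = g"
    and rescale: "\<And>P f f'. pasture P \<Longrightarrow> f \<in> representations N P \<Longrightarrow> f' \<in> representations N P \<Longrightarrow>
      (\<tau> f, \<tau> f') \<in> rescaling N' P \<longleftrightarrow> (f, f') \<in> rescaling N P"
    and natural: "\<And>\<phi> f. push_forward N' \<phi> (\<tau> f) = \<tau> (push_forward N \<phi> f)"
  shows "pasture_iso F F'"
proof -
  have P: "pasture F" "pasture F'" using F F' by (auto simp: is_foundation_def)
  from F obtain \<eta> :: "'p pasture \<Rightarrow> ('p \<Rightarrow> 'p) \<Rightarrow> ('e set \<Rightarrow> 'e \<Rightarrow> 'p) set"
    where rep: "\<And>P g f. pasture P \<Longrightarrow> g \<in> pasture_hom F P \<Longrightarrow> f \<in> \<eta> P g \<Longrightarrow> f \<in> representations N P"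
    and mem: "\<And>P g f f'. pasture P \<Longrightarrow> g \<in> pasture_hom F P \<Longrightarrow> f \<in> \<eta> P g \<Longrightarrow>
      f' \<in> \<eta> P g \<longleftrightarrow> (f, f') \<in> rescaling N P"
    and ne: "\<And>P g. pasture P \<Longrightarrow> g \<in> pasture_hom F P \<Longrightarrow> \<exists>f. f \<in> \<eta> P g"
    and hit: "\<And>P f. pasture P \<Longrightarrow> f \<in> representations N P \<Longrightarrow> \<exists>g\<in>pasture_hom F P. f \<in> \<eta> P g"
    and inj: "\<And>P g g' f. pasture P \<Longrightarrow> g \<in> pasture_hom F P \<Longrightarrow> g' \<in> pasture_hom F P \<Longrightarrow>
      f \<in> \<eta> P g \<Longrightarrow> f \<in> \<eta> P g' \<Longrightarrow> g = g'"
    and nat: "\<And>P Q \<phi> g f. \<phi> \<in> pasture_hom P Q \<Longrightarrow> g \<in> pasture_hom F P \<Longrightarrow> pasture P \<Longrightarrow> pasture Q \<Longrightarrow>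
      f \<in> \<eta> P g \<Longrightarrow> push_forward N \<phi> f \<in> \<eta> Q (compose (carrier F) \<phi> g)"
    by (rule is_foundationE) blast
  from F' obtain \<eta>' :: "'p pasture \<Rightarrow> ('p \<Rightarrow> 'p) \<Rightarrow> ('f set \<Rightarrow> 'f \<Rightarrow> 'p) set"
    where rep': "\<And>P g f. pasture P \<Longrightarrow> g \<in> pasture_hom F' P \<Longrightarrow> f \<in> \<eta>' P g \<Longrightarrow> f \<in> representations N' P"
    and mem': "\<And>P g f f'. pasture P \<Longrightarrow> g \<in> pasture_hom F' P \<Longrightarrow> f \<in> \<eta>' P g \<Longrightarrow>
      f' \<in> \<eta>' P g \<longleftrightarrow> (f, f') \<in> rescaling N' P"
    and ne': "\<And>P g. pasture P \<Longrightarrow> g \<in> pasture_hom F' P \<Longrightarrow> \<exists>f. f \<in> \<eta>' P g"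
    and hit': "\<And>P f. pasture P \<Longrightarrow> f \<in> representations N' P \<Longrightarrow> \<exists>g\<in>pasture_hom F' P. f \<in> \<eta>' P g"
    and inj': "\<And>P g g' f. pasture P \<Longrightarrow> g \<in> pasture_hom F' P \<Longrightarrow> g' \<in> pasture_hom F' P \<Longrightarrow>
      f \<in> \<eta>' P g \<Longrightarrow> f \<in> \<eta>' P g' \<Longrightarrow> g = g'"
    and nat': "\<And>P Q \<phi> g f. \<phi> \<in> pasture_hom P Q \<Longrightarrow> g \<in> pasture_hom F' P \<Longrightarrow> pasture P \<Longrightarrow> pasture Q \<Longrightarrow>
      f \<in> \<eta>' P g \<Longrightarrow> push_forward N' \<phi> f \<in> \<eta>' Q (compose (carrier F') \<phi> g)"
    by (rule is_foundationE) blast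
  let ?id = "\<lambda>a\<in>carrier F. a" and ?id' = "\<lambda>a\<in>carrier F'. a"
  have id: "?id \<in> pasture_hom F F" "?id' \<in> pasture_hom F' F'" using pasture_hom_id P by auto
  obtain f where f: "f \<in> \<eta> F ?id" using ne[OF P(1) id(1)] by blast
  have fr: "f \<in> representations N F" using rep[OF P(1) id(1) f] .
  obtain \<alpha> where \<alpha>: "\<alpha> \<in> pasture_hom F' F" "\<tau> f \<in> \<eta>' F \<alpha>" using hit'[OF P(1) closed[OF P(1) fr]] by blast
  obtain k where k: "k \<in> \<eta>' F' ?id'" using ne'[OF P(2) id(2)] by blast
  obtain h where h: "h \<in> representations N F'" "\<tau> h = k" using onto[OF P(2) rep'[OF P(2) id(2) k]] by blast
  obtain \<beta> where \<beta>: "\<beta> \<in> pasture_hom F F'" "h \<in> \<eta> F' \<beta>" using hit[OF P(2) h(1)] by blast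
  have comp_id: "compose (carrier F') \<alpha> ?id' = \<alpha>" "compose (carrier F) \<beta> ?id = \<beta>"
    using \<alpha>(1) \<beta>(1) unfolding pasture_hom_def by (auto simp: compose_def extensional_def fun_eq_iff)
  \<comment> \<open>The representation \<open>push_forward N \<alpha> h\<close> lies in the class of
    the composite by naturality and in the universal class because its image under
    \<open>\<tau>\<close> is equivalent to that of \<open>f\<close>; injectivity identifies the two
    morphisms.\<close>
  have "compose (carrier F) \<alpha> \<beta> = ?id"
  proof (rule inj[OF P(1) pasture_hom_compose[OF P(1) \<beta>(1) \<alpha>(1)] id(1)])
    show h': "push_forward N \<alpha> h \<in> \<eta> F (compose (carrier F) \<alpha> \<beta>)"
      using nat[OF \<alpha>(1) \<beta>(1) P(2,1) \<beta>(2)] .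
    have r: "push_forward N \<alpha> h \<in> representations N F"
      using rep[OF P(1) pasture_hom_compose[OF P(1) \<beta>(1) \<alpha>(1)] h'] .
    have "\<tau> (push_forward N \<alpha> h) \<in> \<eta>' F \<alpha>"
      using nat'[OF \<alpha>(1) id(2) P(2,1) k] h(2) natural[of \<alpha> h] comp_id by simp
    then have "(f, push_forward N \<alpha> h) \<in> rescaling N F"
      using mem'[OF P(1) \<alpha>] rescale[OF P(1) fr r] by blast
    then show "push_forward N \<alpha> h \<in> \<eta> F ?id" using mem[OF P(1) id(1) f] by blast
  qed
  moreover have "compose (carrier F') \<beta> \<alpha> = ?id'"
  proof (rule inj'[OF P(2) pasture_hom_compose[OF P(2) \<alpha>(1) \<beta>(1)] id(2)])
    show "push_forward N' \<beta> (\<tau> f) \<in> \<eta>' F' (compose (carrier F') \<beta> \<alpha>)"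
      using nat'[OF \<beta>(1) \<alpha>(1) P(1,2) \<alpha>(2)] .
    have b: "push_forward N \<beta> f \<in> \<eta> F' \<beta>"
      using nat[OF \<beta>(1) id(1) P(1,2) f] comp_id by simp
    then have "(h, push_forward N \<beta> f) \<in> rescaling N F'" using mem[OF P(2) \<beta>] by blast
    then have "(\<tau> h, \<tau> (push_forward N \<beta> f)) \<in> rescaling N' F'"
      using rescale[OF P(2) h(1) rep[OF P(2) \<beta>(1) b]] by blast
    then show "push_forward N' \<beta> (\<tau> f) \<in> \<eta>' F' ?id'"
      using mem'[OF P(2) id(2) k] h(2) natural[of \<beta> f] by simp
  qed
  ultimately have "\<alpha> (\<beta> a) = a" if "a \<in> carrier F" for a using that by (metis compose_eq restrict_apply')
  moreover have "\<beta> (\<alpha> a) = a" if "a \<in> carrier F'" for a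
    using that \<open>compose (carrier F') \<beta> \<alpha> = ?id'\<close> by (metis compose_eq restrict_apply')
  ultimately show ?thesis unfolding pasture_iso_def using \<alpha>(1) \<beta>(1) by blast
qed

section \<open>From the parallel connection to the combinatorial hypotheses\<close>

lemma bases_restriction_uniform:
  assumes "matroid_iso (restriction M X) (uniform_matroid r n)"
  shows "bases (restriction M X) = {B. B \<subseteq> X \<and> card B = r}"
proof -
  obtain \<phi> where \<phi>: "bij_betw \<phi> X {1..n}"
    and im: "{B. B \<subseteq> {1..n} \<and> card B = r} = (\<lambda>B. \<phi> ` B) ` bases (restriction M X)"
    using assms unfolding matroid_iso_def restriction_def uniform_matroid_def by auto
  have inj: "inj_on \<phi> X" and onto: "\<phi> ` X = {1..n}" using \<phi> by (auto simp: bij_betw_def)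
  have sub: "B \<subseteq> X" if "B \<in> bases (restriction M X)" for B using that by (simp add: restriction_def)
  have card: "card (\<phi> ` B) = card B" if "B \<subseteq> X" for B using card_image[OF inj_on_subset[OF inj that]] .
  show ?thesis
  proof (intro equalityI subsetI CollectI)
    fix B assume B: "B \<in> bases (restriction M X)"
    then have "\<phi> ` B \<in> {B. B \<subseteq> {1..n} \<and> card B = r}" unfolding im by (rule imageI)
    then show "B \<subseteq> X \<and> card B = r" using sub[OF B] card[OF sub[OF B]] by simp
  next
    fix B assume B: "B \<in> {B. B \<subseteq> X \<and> card B = r}"
    then have "\<phi> ` B \<subseteq> \<phi> ` X" "card (\<phi> ` B) = r" using card[of B] by auto
    then have "\<phi> ` B \<in> {B. B \<subseteq> {1..n} \<and> card B = r}" unfolding onto by simp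
    then obtain B' where B': "B' \<in> bases (restriction M X)" "\<phi> ` B = \<phi> ` B'" unfolding im by blast
    have "B \<subseteq> X" using B by simp
    then have "B = B'" using inj_on_image_eq_iff[OF inj _ sub[OF B'(1)]] B'(2) by simp
    then show "B \<in> bases (restriction M X)" using B' by simp
  qed
qed

lemma indep_if_restriction_uniform:
  assumes b: "bases (restriction M X) = {B. B \<subseteq> X \<and> card B = r}"
  shows "B \<subseteq> X \<Longrightarrow> card B = r \<Longrightarrow> indep M B" "indep M I \<Longrightarrow> I \<subseteq> X \<Longrightarrow> card I \<le> r"
proof -
  have max: "indep M B \<and> (\<forall>J. indep M J \<and> J \<subseteq> X \<and> B \<subseteq> J \<longrightarrow> J = B)" if "B \<subseteq> X" "card B = r" for B
  proof -
    have "B \<in> bases (restriction M X)" using that b by simp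
    then show ?thesis unfolding restriction_def by simp
  qed
  then show "B \<subseteq> X \<Longrightarrow> card B = r \<Longrightarrow> indep M B" by blast
  assume I: "indep M I" "I \<subseteq> X"
  show "card I \<le> r"
  proof (rule ccontr)
    assume "\<not> card I \<le> r"
    then obtain B where B: "B \<subseteq> I" "card B = r" using obtain_subset_with_card_n[of r I] by auto
    then have "I = B" using max[of B] I by blast
    then show False using B \<open>\<not> card I \<le> r\<close> by simp
  qed
qed

text \<open>Two points of \<open>X\<close> have rank two and \<open>X\<close> has rank at most two,
  so a flat through both contains \<open>X\<close>; a single point has rank at most one, so closures
  separate points. Flats of \<open>M\<^sub>1\<close> thus meet the line in nothing, one point or
  everything, which is exactly the range in which \<open>flat_Theta_iff\<close> applies.\<close>

lemma (in theta_labels) theta_extension_if_connection: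
  fixes M\<^sub>1 M :: "'e matroid"
  assumes M1: "matroid M\<^sub>1" and X: "X \<subseteq> ground M\<^sub>1"
    and iso: "matroid_iso (restriction M\<^sub>1 X) (uniform_matroid 2 n)"
    and xX: "x ` N = X" and y: "y ` N \<inter> ground M\<^sub>1 = {}"
    and con: "is_gen_parallel_connection X M\<^sub>1 (Theta n x y) M"
  shows "theta_extension n x y M\<^sub>1 M"
proof -
  note b = bases_restriction_uniform[OF iso]
  have M: "matroid M" and gM: "ground M = ground M\<^sub>1 \<union> y ` N"
    and fl: "\<And>F. F \<subseteq> ground M \<Longrightarrow>
      flat M F \<longleftrightarrow> flat M\<^sub>1 (F \<inter> ground M\<^sub>1) \<and> flat (Theta n x y) (F \<inter> cell N N)"
    using con xX X unfolding is_gen_parallel_connection_def by auto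
  have xg: "x i \<in> ground M\<^sub>1" "x i \<in> X" if "i \<in> N" for i using that xX X by auto
  have rank_le: "rank_of M\<^sub>1 A \<le> card A" if "A \<subseteq> ground M\<^sub>1" for A
    using rank_of_obtain[OF M1 that] that matroid_finite[OF M1] by (metis card_mono finite_subset)
  have rank_X: "rank_of M\<^sub>1 A \<le> 2" if "A \<subseteq> X" for A
  proof -
    have "A \<subseteq> ground M\<^sub>1" using that X by blast
    then obtain I where "indep M\<^sub>1 I" "I \<subseteq> A" "card I = rank_of M\<^sub>1 A" using rank_of_obtain[OF M1] by metis
    then show ?thesis using indep_if_restriction_uniform(2)[OF b, of I] that by auto
  qed
  have rank_pair: "rank_of M\<^sub>1 {x i, x j} = 2" if ij: "i \<in> N" "j \<in> N" "i \<noteq> j" for i j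
  proof -
    have c: "card {x i, x j} = 2" using ij by simp
    have "indep M\<^sub>1 {x i, x j}" by (rule indep_if_restriction_uniform(1)[OF b]) (use c xg ij in auto)
    then have "2 \<le> rank_of M\<^sub>1 {x i, x j}" using rank_of_ge[OF M1, of "{x i, x j}" "{x i, x j}"] c xg ij by auto
    then show ?thesis using rank_X[of "{x i, x j}"] xg ij by auto
  qed
  have line: "x ` N \<subseteq> F" if F: "flat M\<^sub>1 F" and ij: "i \<in> N" "j \<in> N" "i \<noteq> j" "x i \<in> F" "x j \<in> F" for F i j
  proof
    fix e assume "e \<in> x ` N"
    then have e: "e \<in> X" "e \<in> ground M\<^sub>1" using xX X by auto
    have "rank_of M\<^sub>1 {x i, x j} \<le> rank_of M\<^sub>1 (insert e {x i, x j})"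
      by (rule rank_of_mono[OF M1]) (use e xg ij in auto)
    moreover have "rank_of M\<^sub>1 (insert e {x i, x j}) \<le> 2" by (rule rank_X) (use e xg ij in auto)
    ultimately have "rank_of M\<^sub>1 (insert e {x i, x j}) = rank_of M\<^sub>1 {x i, x j}"
      using rank_pair[OF ij(1-3)] by simp
    then have "rank_of M\<^sub>1 (insert e F) = rank_of M\<^sub>1 F"
      by (intro rank_of_insert_eq_mono[OF M1 flat_subset[OF F] _ e(2)]) (use ij in auto)
    then show "e \<in> F" using F e(2) unfolding flat_def by (metis DiffI less_irrefl)
  qed
  have sep: "\<exists>F. flat M\<^sub>1 F \<and> x i \<in> F \<and> x j \<notin> F" if ij: "i \<in> N" "j \<in> N" "i \<noteq> j" for i j
  proof (intro exI conjI)
    have s: "{x i} \<subseteq> ground M\<^sub>1" using xg ij by simp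
    show "flat M\<^sub>1 (mcl M\<^sub>1 {x i})" using flat_mcl[OF M1 s] .
    show "x i \<in> mcl M\<^sub>1 {x i}" using mcl_extensive[OF s] by simp
    have "rank_of M\<^sub>1 {x i} \<le> 1" using rank_le[OF s] by simp
    moreover have "rank_of M\<^sub>1 (insert (x j) {x i}) = 2" using rank_pair[OF ij(2,1)] ij by simp
    ultimately show "x j \<notin> mcl M\<^sub>1 {x i}" by (simp add: mcl_def)
  qed
  have flat_M: "flat M F \<longleftrightarrow> flat M\<^sub>1 (F \<inter> ground M\<^sub>1) \<and> theta_closed {i \<in> N. x i \<in> F} {i \<in> N. y i \<notin> F}"
    if F: "F \<subseteq> ground M" for F
  proof (cases "flat M\<^sub>1 (F \<inter> ground M\<^sub>1)")
    case True
    let ?T = "{i \<in> N. x i \<in> F}" and ?C = "{i \<in> N. y i \<notin> F}"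
    have T: "?T = {} \<or> (\<exists>i\<in>N. ?T = {i}) \<or> ?T = N"
    proof (cases "\<exists>i\<in>N. \<exists>j\<in>N. i \<noteq> j \<and> x i \<in> F \<and> x j \<in> F")
      case two: True
      then obtain i j where "i \<in> N" "j \<in> N" "i \<noteq> j" "x i \<in> F" "x j \<in> F" by blast
      then have "x ` N \<subseteq> F \<inter> ground M\<^sub>1" using line[OF True] xg by blast
      then show ?thesis by blast
    next
      case False
      then show ?thesis by blast
    qed
    have C: "?C \<subseteq> N" by blast
    have eq: "F \<inter> cell N N = cell ?T (N - ?C)" by auto
    have "flat (Theta n x y) (F \<inter> cell N N) \<longleftrightarrow> theta_closed ?T ?C"
      unfolding eq by (rule flat_Theta_iff[OF T C])
    then show ?thesis using fl[OF F] by blast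
  qed (use fl[OF F] in blast)
  show ?thesis
    by (intro theta_extension.intro theta_labels_axioms theta_extension_axioms.intro)
      (use M1 M xX X y gM line sep flat_M in auto)
qed

theorem theorem5p5:
  fixes M\<^sub>1 M :: "'e matroid" and n :: nat and x y :: "nat \<Rightarrow> 'e" and X :: "'e set"
    and F F\<^sub>1 :: "'p pasture"
  assumes "matroid M\<^sub>1" and "n \<ge> 2"
    and "X \<subseteq> ground M\<^sub>1" and "matroid_iso (restriction M\<^sub>1 X) (uniform_matroid 2 n)"
    and "bij_betw x {1..n} X"
    and "inj_on y {1..n}" and "y ` {1..n} \<inter> ground M\<^sub>1 = {}"
    and "is_gen_parallel_connection X M\<^sub>1 (Theta n x y) M"
    and "is_foundation F M" and "is_foundation F\<^sub>1 M\<^sub>1"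
  shows "pasture_iso F F\<^sub>1"
proof -
  have xX: "x ` {1..n} = X" "inj_on x {1..n}" using assms(5) by (auto simp: bij_betw_def)
  have "theta_labels n x y"
    by (rule theta_labels.intro) (use assms(2,3,6,7) xX in auto)
  then have ext: "theta_extension n x y M\<^sub>1 M"
    using assms(1,3,4) xX(1) assms(7,8) by (rule theta_labels.theta_extension_if_connection)
  have rep: "theta_representation n x y M\<^sub>1 M P" if "pasture P" for P :: "'p pasture"
    using ext pasture_structI[OF that] by (rule theta_representation.intro)
  show ?thesis
    by (rule foundation_iso[OF assms(9,10), where \<tau> = "theta_extension.trace_rep n x y M\<^sub>1"])
      (fact theta_representation.trace_rep_representations[OF rep]
        theta_representation.trace_rep_onto[OF rep] theta_representation.rescaling_trace_iff[OF rep]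
        theta_extension.push_forward_trace_rep[OF ext])+
qed

end
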